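(* Let $\mathcal{H}$ be a separable Hilbert space, $T>0$, $x_0\in\mathcal{H}$. Let $F\colon[0,T]\times\mathcal{H}\rightrightarrows\mathcal{H}$ have nonempty, closed, convex values and satisfy: (F1) for each $v$, $F(\cdot,v)$ is measurable; (F2) for a.e. $t$, $F(t,\cdot)$ is upper semicontinuous from $\mathcal{H}$ into $\mathcal{H}_w$; (F3) there exist integrable $c,d\colon[0,T]\to\mathbb{R}_+$ with $\inf\{\|w\|\colon w\in F(t,v)\}\le c(t)\|v\|+d(t)$ for all $v$ and a.e. $t$; (F4) there is an integrable $k\colon[0,T]\to\mathbb{R}_+$ such that for a.e. $t$ and every bounded $A\subset\mathcal{H}$, $\gamma(F(t,A))\le k(t)\gamma(A)$, where $\gamma$ is either the Kuratowski or the Hausdorff measure of non-compactness. Let $g\colon[0,T]\times[0,T]\times\mathcal{H}\to\mathcal{H}$ satisfy: (g1) for each $v$, $(t,s)\mapsto g(t,s,v)$ is measurable; (g2) for every $r>0$ there is an integrable $\mu_r\colon[0,T]\to\mathbb{R}_+$ with $\|g(t,s,x)-g(t,s,y)\|\le\mu_r(t)\|x-y\|$ for all $(t,s)\in D:=\{(t,s)\in[0,T]^2\colon s\le t\}$ and $x,y\in r\mathbb{B}$; (g3) there is a nonnegative integrable $\sigma\colon D\to\mathbb{R}$ with $\|g(t,s,x)\|\le\sigma(t,s)(1+\|x\|)$ for all $(t,s)\in D$, $x\in\mathcal{H}$. Then the problem $$\dot x(t)\in F(t,x(t))+\int_0^tg(t,s,x(s))ds\ \text{ a.e. } t\in[0,T],\qquad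 x(0)=x_0,$$ admits an absolutely continuous solution $x$ with $\|x(t)\|\le r(t)$ for all $t$ and $\|\dot x(t)\|\le\psi(t)$ for a.e. $t$, where $$e(t_2,t_1):=\exp\left(\int_{t_1}^{t_2}\Big(c(s)+\int_0^s\sigma(s,\tau)d\tau\Big)ds\right),\quad r(t):=\|x_0\|e(t,0)+\int_0^t\Big(d(s)+\int_0^s\sigma(s,\tau)d\tau\Big)e(t,s)ds,$$ $$\psi(t):=c(t)r(t)+d(t)+\int_0^t\sigma(t,s)ds+\int_0^t\sigma(t,s)r(s)ds.$$
   Context: $\mathbb{B}$ is the closed unit ball, $\mathcal{H}_w$ is $\mathcal{H}$ with the weak topology. For bounded $A\subset\mathcal{H}$: Kuratowski measure $\alpha(A)=\inf\{d>0\colon A$ admits a finite cover by sets of diameter $\le d\}$; Hausdorff measure $\beta(A)=\inf\{r>0\colon A$ can be covered by finitely many balls of radius $r\}$. $F(t,A)=\bigcup_{a\in A}F(t,a)$. *)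

theory Defs
  imports "HOL-Analysis.Analysis"
begin

definition weakly_open :: "'a::real_inner set \<Rightarrow> bool" where
  "weakly_open W \<longleftrightarrow> (\<forall>w\<in>W. \<exists>Y. finite Y \<and> (\<exists>\<epsilon>>0. {z. \<forall>y\<in>Y. \<bar>(z - w) \<bullet> y\<bar> < \<epsilon>} \<subseteq> W))"

definition usc_into_weak :: "('a::real_inner \<Rightarrow> 'a set) \<Rightarrow> bool" where
  "usc_into_weak G \<longleftrightarrow> (\<forall>v W. weakly_open W \<and> G v \<subseteq> W \<longrightarrow>
      (\<exists>\<delta>>0. \<forall>u. norm (u - v) < \<delta> \<longrightarrow> G u \<subseteq> W))"

definition measurable_multimap :: "real \<Rightarrow> (real \<Rightarrow> 'a::topological_space set) \<Rightarrow> bool" where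
  "measurable_multimap T G \<longleftrightarrow>
     (\<forall>U. open U \<longrightarrow> {t\<in>{0..T}. G t \<inter> U \<noteq> {}} \<in> sets (lebesgue_on {0..T}))"

text \<open>Kuratowski measure of non-compactness (value \<infinity> if no finite cover exists, i.e. A unbounded).\<close>
definition kuratowski_mnc :: "'a::metric_space set \<Rightarrow> ereal" where
  "kuratowski_mnc A = Inf {ereal d | d. d > 0 \<and>
      (\<exists>C. finite C \<and> A \<subseteq> \<Union>C \<and> (\<forall>S\<in>C. \<forall>x\<in>S. \<forall>y\<in>S. dist x y \<le> d))}"

definition hausdorff_mnc :: "'a::metric_space set \<Rightarrow> ereal" where
  "hausdorff_mnc A = Inf {ereal r | r. r > 0 \<and>
      (\<exists>X. finite X \<and> A \<subseteq> (\<Union>x\<in>X. cball x r))}"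

definition abs_continuous_on :: "real \<Rightarrow> real \<Rightarrow> (real \<Rightarrow> 'a::real_normed_vector) \<Rightarrow> bool" where
  "abs_continuous_on a b x \<longleftrightarrow>
     (\<forall>\<epsilon>>0. \<exists>\<delta>>0. \<forall>(n::nat) (l::nat \<Rightarrow> real) (u::nat \<Rightarrow> real).
        (\<forall>i<n. a \<le> l i \<and> l i \<le> u i \<and> u i \<le> b) \<and>
        (\<forall>i<n. \<forall>j<n. i \<noteq> j \<longrightarrow> u i \<le> l j \<or> u j \<le> l i) \<and>
        (\<Sum>i<n. u i - l i) < \<delta>
        \<longrightarrow> (\<Sum>i<n. norm (x (u i) - x (l i))) < \<epsilon>)"

definition e_fun :: "(real \<Rightarrow> real) \<Rightarrow> (real \<Rightarrow> real \<Rightarrow> real) \<Rightarrow> real \<Rightarrow> real \<Rightarrow> real" where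
  "e_fun c \<sigma> t2 t1 = exp (integral\<^sup>L (lebesgue_on {t1..t2})
       (\<lambda>s. c s + integral\<^sup>L (lebesgue_on {0..s}) (\<lambda>\<tau>. \<sigma> s \<tau>)))"

definition r_fun :: "'a::real_normed_vector \<Rightarrow> (real \<Rightarrow> real) \<Rightarrow> (real \<Rightarrow> real) \<Rightarrow> (real \<Rightarrow> real \<Rightarrow> real) \<Rightarrow> real \<Rightarrow> real" where
  "r_fun x0 c d \<sigma> t = norm x0 * e_fun c \<sigma> t 0 +
     integral\<^sup>L (lebesgue_on {0..t})
       (\<lambda>s. (d s + integral\<^sup>L (lebesgue_on {0..s}) (\<lambda>\<tau>. \<sigma> s \<tau>)) * e_fun c \<sigma> t s)"

definition psi_fun :: "'a::real_normed_vector \<Rightarrow> (real \<Rightarrow> real) \<Rightarrow> (real \<Rightarrow> real) \<Rightarrow> (real \<Rightarrow> real \<Rightarrow> real) \<Rightarrow> real \<Rightarrow> real" where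
  "psi_fun x0 c d \<sigma> t = c t * r_fun x0 c d \<sigma> t + d t
     + integral\<^sup>L (lebesgue_on {0..t}) (\<lambda>s. \<sigma> t s)
     + integral\<^sup>L (lebesgue_on {0..t}) (\<lambda>s. \<sigma> t s * r_fun x0 c d \<sigma> s)"

end

theory Submission
  imports Defs "HOL-Library.Diagonal_Subsequence"
begin

text \<open>
  Euler polygons driven by minimal-norm selections of \<open>F(t, v)\<close> for frozen \<open>v\<close> stay below \<open>r\<close> because
  \<open>r\<close> is a supersolution of \<open>r' = (c + \<sigma>bar) r + d + \<sigma>bar\<close>, where \<open>\<sigma>bar t\<close> is the integral of \<open>\<sigma> t\<close> over
  \<open>[0, t]\<close>. In a separable Hilbert space the Hausdorff measure of noncompactness of a bounded sequence is
  the limit of the suprema of the norms of its tails with respect to an orthonormal system; hence it can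
  be pulled inside an integral, and a Gronwall argument shows that the polygons are relatively compact
  at each time. Along a convergent subsequence the velocities converge almost everywhere after passing
  to convex combinations that almost minimise a weighted square norm. Separation of points from closed
  convex sets and upper semicontinuity place the limit in \<open>F(t, x(t))\<close>, and the Lebesgue
  differentiation theorem identifies it with the derivative of the limit.
\<close>

section \<open>Convex sets in Hilbert space\<close>

text \<open>The state is frozen on grid cells because measurability of \<open>F\<close> is assumed
  only for a fixed state; a step function reduces a moving state to countably many fixed ones.
  Minimal norm is the natural choice because the growth condition controls only the infimum of the
  norms over \<open>F t v\<close>: the minimal selection inherits that integrable bound, a general
  one does not. Measurability in \<open>t\<close> of the measure of noncompactness of the polygons
  is never addressed. The integral estimate works with explicit integrable majorants instead, and
  the Gronwall argument improves a bound of the form \<open>S * E t\<close> to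
  \<open>S / 2 * E t\<close> again and again. The two measures differ by a factor of at most 2, so
  both alternatives of the compactness condition are weakened to one estimate for the Hausdorff
  measure with coefficient \<open>2 * k\<close>. The argument tolerates any integrable coefficient.
  Convergence of the positions does not make the velocities converge pointwise. This is where
  convexity of the values enters: half-spaces that contain the selections also contain their convex
  combinations.\<close>

text \<open>The parallelogram law, with the norm of the midpoint bounded below by \<delta>. Keeping
  \<delta> separate from \<open>norm p\<close> lets the estimate serve minimising sequences as well
  as the minimiser itself.\<close>

lemma convex_min_norm_bound:
  fixes p y :: "'a::real_inner"
  assumes "convex C" "p \<in> C" "y \<in> C" "\<And>z. z \<in> C \<Longrightarrow> \<delta> \<le> norm z" "0 \<le> \<delta>"
  shows "(norm (y - p))\<^sup>2 \<le> 2 * (norm y)\<^sup>2 + 2 * (norm p)\<^sup>2 - 4 * \<delta>\<^sup>2"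
proof -
  have "(1/2) *\<^sub>R p + (1/2) *\<^sub>R y \<in> C"
    using assms by (intro convexD) auto
  then have "\<delta> \<le> norm ((1/2) *\<^sub>R (p + y))"
    using assms(4) by (simp add: scaleR_add_right)
  then have "\<delta>\<^sup>2 \<le> (norm ((1/2) *\<^sub>R (p + y)))\<^sup>2"
    using assms(5) by (intro power_mono) auto
  also have "\<dots> = (norm (p + y))\<^sup>2 / 4"
    by (simp add: power2_eq_square)
  finally have "4 * \<delta>\<^sup>2 \<le> (norm (p + y))\<^sup>2" by simp
  then show ?thesis
    by (simp add: power2_norm_eq_inner algebra_simps inner_commute)
qed

text \<open>A minimising sequence is Cauchy by the midpoint estimate, so completeness takes the
  place of compactness.\<close>

lemma min_norm_exists:
  fixes C :: "'a::{real_inner,banach} set"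
  assumes "closed C" "convex C" "C \<noteq> {}"
  obtains p where "p \<in> C" "\<And>z. z \<in> C \<Longrightarrow> norm p \<le> norm z"
proof -
  define \<delta> where "\<delta> = (INF z\<in>C. norm z)"
  have bdd: "bdd_below (norm ` C)" by (intro bdd_belowI[of _ 0]) auto
  have \<delta>le: "\<delta> \<le> norm z" if "z \<in> C" for z
    unfolding \<delta>_def using bdd that by (intro cINF_lower) auto
  have \<delta>0: "0 \<le> \<delta>" unfolding \<delta>_def using assms(3) by (intro cINF_greatest) auto
  have "\<exists>z\<in>C. (norm z)\<^sup>2 < \<delta>\<^sup>2 + 1 / real (Suc n)" for n
  proof -
    have "\<delta> < sqrt (\<delta>\<^sup>2 + 1 / real (Suc n))"
      using \<delta>0 by (intro real_less_rsqrt) auto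
    then obtain z where "z \<in> C" "norm z < sqrt (\<delta>\<^sup>2 + 1 / real (Suc n))"
      unfolding \<delta>_def using assms(3) bdd by (subst (asm) cINF_less_iff) (auto simp: \<delta>_def)
    then have "(norm z)\<^sup>2 < (sqrt (\<delta>\<^sup>2 + 1 / real (Suc n)))\<^sup>2"
      by (intro power_strict_mono) auto
    then show ?thesis using \<open>z \<in> C\<close> by (auto simp: add_nonneg_nonneg)
  qed
  then obtain z where z: "\<And>n. z n \<in> C" "\<And>n. (norm (z n))\<^sup>2 < \<delta>\<^sup>2 + 1 / real (Suc n)"
    by metis
  have dist: "(norm (z m - z n))\<^sup>2 \<le> 4 / real (Suc N)" if "N \<le> m" "N \<le> n" for m n N
  proof -
    have "(norm (z m - z n))\<^sup>2 \<le> 2 * (norm (z m))\<^sup>2 + 2 * (norm (z n))\<^sup>2 - 4 * \<delta>\<^sup>2"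
      using convex_min_norm_bound[OF assms(2) z(1) z(1) \<delta>le \<delta>0] by auto
    also have "\<dots> \<le> 2 * (1 / real (Suc m)) + 2 * (1 / real (Suc n))"
      using z(2)[of m] z(2)[of n] by simp
    also have "\<dots> \<le> 2 * (1 / real (Suc N)) + 2 * (1 / real (Suc N))"
      using that by (intro add_mono mult_left_mono divide_left_mono) auto
    finally show ?thesis by simp
  qed
  have "Cauchy z"
  proof (rule CauchyI)
    fix e :: real assume "e > 0"
    obtain N :: nat where N: "4 / e\<^sup>2 < real N" using reals_Archimedean2 by blast
    have "4 / real (Suc N) < e\<^sup>2"
    proof -
      have "4 < real N * e\<^sup>2" using N \<open>e > 0\<close> by (simp add: divide_simps)
      also have "\<dots> \<le> real (Suc N) * e\<^sup>2" by (intro mult_right_mono) auto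
      finally show ?thesis by (simp add: divide_simps mult.commute)
    qed
    then have "norm (z m - z n) < e" if "N \<le> m" "N \<le> n" for m n
      using dist[OF that] \<open>e > 0\<close> by (meson less_eq_real_def order_le_less_trans power2_less_imp_less)
    then show "\<exists>M. \<forall>m\<ge>M. \<forall>n\<ge>M. norm (z m - z n) < e" by blast
  qed
  then obtain p where p: "z \<longlonglongrightarrow> p" using Cauchy_convergent convergent_def by blast
  have "p \<in> C" using assms(1) z(1) p closed_sequentially by blast
  moreover have "(norm p)\<^sup>2 \<le> \<delta>\<^sup>2"
  proof (rule LIMSEQ_le)
    show "(\<lambda>n. (norm (z n))\<^sup>2) \<longlonglongrightarrow> (norm p)\<^sup>2" by (intro tendsto_intros p)
    show "(\<lambda>n. \<delta>\<^sup>2 + 1 / real (Suc n)) \<longlonglongrightarrow> \<delta>\<^sup>2"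
      using tendsto_add[OF tendsto_const LIMSEQ_inverse_real_of_nat] by (simp add: inverse_eq_divide)
    show "\<exists>N. \<forall>n\<ge>N. (norm (z n))\<^sup>2 \<le> \<delta>\<^sup>2 + 1 / real (Suc n)"
      using z(2) less_imp_le by blast
  qed
  then have "norm p \<le> \<delta>" using \<delta>0 power2_le_imp_le by blast
  ultimately show thesis using that \<delta>le by (meson order_trans)
qed

lemma closed_convex_strict_separation:
  fixes C :: "'a::{real_inner,banach} set"
  assumes "closed C" "convex C" "C \<noteq> {}" "x \<notin> C"
  obtains y a where "\<And>z. z \<in> C \<Longrightarrow> z \<bullet> y < a" "a < x \<bullet> y"
proof -
  let ?C = "(\<lambda>z. z - x) ` C"
  have "closed ?C" "convex ?C" "?C \<noteq> {}"
    using assms closed_translation[of C "-x"] convex_translation[of C "-x"] by simp_all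
  then obtain p where p: "p \<in> ?C" "\<And>z. z \<in> ?C \<Longrightarrow> norm p \<le> norm z"
    using min_norm_exists by blast
  have p0: "p \<noteq> 0" using p(1) assms(4) by auto
  have var: "0 \<le> p \<bullet> (z - p)" if "z \<in> ?C" for z
  proof (rule ccontr)
    assume neg: "\<not> 0 \<le> p \<bullet> (z - p)"
    define w where "w = z - p"
    have w: "p \<bullet> w < 0" and w0: "w \<bullet> w > 0" using neg by (auto simp: w_def)
    \<comment> \<open>The step length in \<open>[0, 1]\<close> that minimises the norm along the
      segment from \<open>p\<close> to \<open>z\<close>.\<close>
    define s where "s = min 1 (- (p \<bullet> w) / (w \<bullet> w))"
    have s: "0 < s" "s \<le> 1" using w w0 by (auto simp: s_def divide_neg_pos)
    have sw: "s * (w \<bullet> w) \<le> - (p \<bullet> w)"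
      using w0 by (simp add: s_def min_def field_simps)
    have "(1 - s) *\<^sub>R p + s *\<^sub>R z \<in> ?C" using \<open>convex ?C\<close> p(1) that s by (intro convexD) auto
    then have "norm p \<le> norm (p + s *\<^sub>R w)" using p(2) by (simp add: w_def algebra_simps)
    then have "(norm p)\<^sup>2 \<le> (norm (p + s *\<^sub>R w))\<^sup>2" by (intro power_mono) auto
    then have "0 \<le> s * (2 * (p \<bullet> w) + s * (w \<bullet> w))"
      by (simp add: power2_norm_eq_inner algebra_simps inner_commute)
    then have "0 \<le> 2 * (p \<bullet> w) + s * (w \<bullet> w)" using s by (simp add: zero_le_mult_iff)
    then show False using sw w by linarith
  qed
  have pp: "p \<bullet> p > 0" using p0 by simp
  show thesis
  \<comment> \<open>On \<open>C\<close> the inequality \<open>var\<close> gives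
    \<open>z \<bullet> (- p) \<le> x \<bullet> (- p) - p \<bullet> p\<close>. The level sits in the
    middle of this gap, so both inequalities are strict.\<close>
  proof (rule that[of "-p" "x \<bullet> (-p) - (p \<bullet> p) / 2"])
    fix z assume "z \<in> C"
    then have "0 \<le> p \<bullet> ((z - x) - p)" by (intro var) auto
    then show "z \<bullet> - p < x \<bullet> - p - p \<bullet> p / 2" using pp
      by (simp add: algebra_simps inner_commute) (smt (verit, best) field_sum_of_halves inner_gt_zero_iff pp)
  qed (use pp in auto)
qed

text \<open>Almost minimal points of a convex set lie near the minimal one. It therefore suffices to
  pick from a dense sequence a point that is close to \<open>G t\<close> and has almost minimal
  norm; both conditions are measurable, and taking the least index keeps the choice
  measurable.\<close>

lemma min_norm_selection_measurable:
  fixes G :: "'b \<Rightarrow> 'a::{real_inner,banach,second_countable_topology} set"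
  assumes meas: "\<And>U. open U \<Longrightarrow> {t\<in>space M. G t \<inter> U \<noteq> {}} \<in> sets M"
    and G: "\<And>t. t \<in> space M \<Longrightarrow> G t \<noteq> {} \<and> closed (G t) \<and> convex (G t)"
    and p: "\<And>t. t \<in> space M \<Longrightarrow> p t \<in> G t" "\<And>t z. t \<in> space M \<Longrightarrow> z \<in> G t \<Longrightarrow> norm (p t) \<le> norm z"
  shows "p \<in> borel_measurable M"
proof -
  obtain Y :: "'a set" where Y: "countable Y" "\<And>X. open X \<Longrightarrow> X \<noteq> {} \<Longrightarrow> \<exists>d\<in>Y. d \<in> X"
    by (erule countable_dense_setE)
  then have "Y \<noteq> {}" by (metis UNIV_not_empty empty_iff open_UNIV)
  define y where "y = from_nat_into Y"
  have dense: "\<exists>j. y j \<in> X" if "open X" "X \<noteq> {}" for X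
    using Y(2)[OF that] from_nat_into_surj[OF Y(1)] unfolding y_def by metis
  have near: "{t\<in>space M. G t \<inter> ball a e \<noteq> {}} \<in> sets M" for a e
    by (rule meas) auto
  have np: "(\<lambda>t. norm (p t)) \<in> borel_measurable M"
  proof (rule borel_measurableI_less)
    fix a :: real
    have "{t\<in>space M. norm (p t) < a} = {t\<in>space M. G t \<inter> ball 0 a \<noteq> {}}"
      using p by (force intro: order_le_less_trans)
    then show "{t\<in>space M. norm (p t) < a} \<in> sets M" using near by simp
  qed
  define ok where "ok n t j \<longleftrightarrow> G t \<inter> ball (y j) (1 / real (Suc n)) \<noteq> {} \<and> norm (y j) < norm (p t) + 1 / real (Suc n)" for n t j
  define f where "f n t = y (LEAST j. ok n t j)" for n t
  have [measurable]: "Measurable.pred M (\<lambda>t. ok n t j)" for n j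
  proof -
    have 1: "Measurable.pred M (\<lambda>t. G t \<inter> ball (y j) (1 / real (Suc n)) \<noteq> {})"
      using near by (simp only: pred_def)
    have 2: "Measurable.pred M (\<lambda>t. norm (y j) < norm (p t) + 1 / real (Suc n))"
      using np by measurable
    show ?thesis unfolding ok_def by (rule pred_intros_logic(3)[OF 1 2])
  qed
  have f: "f n \<in> borel_measurable M" for n
    unfolding f_def by (rule measurable_compose[of _ M "count_space UNIV"]) auto
  show ?thesis
  proof (rule borel_measurable_LIMSEQ_metric[of f])
    show "f n \<in> borel_measurable M" for n by (rule f)
    fix t assume t: "t \<in> space M"
    have ex: "\<exists>j. ok n t j" for n
    proof -
      have "\<exists>j. y j \<in> ball (p t) (1 / real (Suc n))" by (intro dense) auto
      then obtain j where j: "dist (p t) (y j) < 1 / real (Suc n)" by auto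
      have "norm (y j) \<le> norm (p t) + dist (p t) (y j)"
        by (metis dist_commute dist_norm norm_triangle_sub)
      then have "ok n t j" using j p(1)[OF t] by (force simp: ok_def dist_commute)
      then show ?thesis by blast
    qed
    have okf: "G t \<inter> ball (f n t) (1 / real (Suc n)) \<noteq> {}" "norm (f n t) < norm (p t) + 1 / real (Suc n)" for n
      using LeastI_ex[OF ex, of n] by (auto simp: ok_def f_def)
    define e where "e n = 1 / real (Suc n)" for n
    have e0: "e \<longlonglongrightarrow> 0" unfolding e_def using LIMSEQ_inverse_real_of_nat by (simp add: inverse_eq_divide)
    \<comment> \<open>\<open>f n t\<close> is within \<open>e n\<close> of some \<open>z\<close> in
      \<open>G t\<close> whose norm exceeds the minimum by at most \<open>2 * e n\<close>; the
      square root is the midpoint estimate for this \<open>z\<close>.\<close>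
    have bd: "dist (f n t) (p t) \<le> e n + sqrt (2 * (norm (p t) + 2 * e n)\<^sup>2 - 2 * (norm (p t))\<^sup>2)" for n
    proof -
      obtain z where z: "z \<in> G t" "dist (f n t) z < e n" using okf(1)[of n] by (auto simp: e_def)
      have "norm z \<le> norm (f n t) + dist (f n t) z"
        by (metis dist_commute dist_norm norm_triangle_sub)
      then have nz: "norm z \<le> norm (p t) + 2 * e n" using z okf(2)[of n] by (simp add: e_def)
      have "(norm (z - p t))\<^sup>2 \<le> 2 * (norm z)\<^sup>2 + 2 * (norm (p t))\<^sup>2 - 4 * (norm (p t))\<^sup>2"
        using G t p z(1) by (intro convex_min_norm_bound[of "G t"]) auto
      also have "\<dots> \<le> 2 * (norm (p t) + 2 * e n)\<^sup>2 - 2 * (norm (p t))\<^sup>2"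
        using power_mono[OF nz, of 2] by simp
      finally have "norm (z - p t) \<le> sqrt (2 * (norm (p t) + 2 * e n)\<^sup>2 - 2 * (norm (p t))\<^sup>2)"
        using real_le_rsqrt by blast
      then show ?thesis using dist_triangle[of "f n t" "p t" z] z(2) by (simp add: dist_norm)
    qed
    have "(\<lambda>n. e n + sqrt (2 * (norm (p t) + 2 * e n)\<^sup>2 - 2 * (norm (p t))\<^sup>2)) \<longlonglongrightarrow>
        0 + sqrt (2 * (norm (p t) + 2 * 0)\<^sup>2 - 2 * (norm (p t))\<^sup>2)"
      by (intro tendsto_intros e0)
    then have "(\<lambda>n. e n + sqrt (2 * (norm (p t) + 2 * e n)\<^sup>2 - 2 * (norm (p t))\<^sup>2)) \<longlonglongrightarrow> 0" by simp
    then have "(\<lambda>n. dist (f n t) (p t)) \<longlonglongrightarrow> 0"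
      by (rule tendsto_sandwich[OF _ _ tendsto_const, rotated 2]) (use bd in auto)
    then show "(\<lambda>n. f n t) \<longlonglongrightarrow> p t" using tendsto_dist_iff by blast
  qed
qed

section \<open>Measures of noncompactness\<close>

text \<open>\<open>sgn\<close> maps 0 to 0, so a vector that depends linearly on its predecessors
  yields a zero entry instead of being skipped. Indices stay aligned with the generating sequence,
  and the system is orthonormal up to zeros.\<close>

fun gram_schmidt :: "(nat \<Rightarrow> 'a::real_inner) \<Rightarrow> nat \<Rightarrow> 'a" where
  "gram_schmidt y i = sgn (y i - (\<Sum>j<i. (y i \<bullet> gram_schmidt y j) *\<^sub>R gram_schmidt y j))"

declare gram_schmidt.simps [simp del]

lemma gram_schmidt_inner_self:
  "gram_schmidt y i = 0 \<or> gram_schmidt y i \<bullet> gram_schmidt y i = 1"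
proof (cases "gram_schmidt y i = 0")
  case False
  then have "norm (gram_schmidt y i) = 1"
    by (subst (asm) gram_schmidt.simps, subst gram_schmidt.simps) (auto simp: norm_sgn)
  then show ?thesis by (simp add: norm_eq_sqrt_inner)
qed auto

lemma gram_schmidt_orthogonal_less: "j < i \<Longrightarrow> gram_schmidt y i \<bullet> gram_schmidt y j = 0"
proof (induction i arbitrary: j rule: less_induct)
  case (less i)
  let ?e = "gram_schmidt y"
  have orth: "?e k \<bullet> ?e j = 0" if "k < i" "k \<noteq> j" for k
    using less.IH[of k j] less.IH[of j k] less.prems that by (metis inner_commute linorder_neqE_nat)
  have "(\<Sum>k<i. (y i \<bullet> ?e k) * (?e k \<bullet> ?e j)) = (\<Sum>k<i. if k = j then (y i \<bullet> ?e j) * (?e j \<bullet> ?e j) else 0)"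
    using orth by (intro sum.cong) auto
  also have "\<dots> = (y i \<bullet> ?e j) * (?e j \<bullet> ?e j)" using less.prems by simp
  also have "\<dots> = y i \<bullet> ?e j" using gram_schmidt_inner_self[of y j] by auto
  finally have "(y i - (\<Sum>k<i. (y i \<bullet> ?e k) *\<^sub>R ?e k)) \<bullet> ?e j = 0"
    by (simp add: inner_diff_left inner_sum_left)
  then show ?case by (subst gram_schmidt.simps) (simp add: sgn_div_norm)
qed

lemma gram_schmidt_orthogonal: "j \<noteq> i \<Longrightarrow> gram_schmidt y i \<bullet> gram_schmidt y j = 0"
  by (metis gram_schmidt_orthogonal_less inner_commute linorder_neqE_nat)

text \<open>The orthogonal projection onto the complement of the span of the first \<open>m\<close>
  vectors.\<close>

definition gs_tail :: "(nat \<Rightarrow> 'a::real_inner) \<Rightarrow> nat \<Rightarrow> 'a \<Rightarrow> 'a" where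
  "gs_tail y m x = x - (\<Sum>j<m. (x \<bullet> gram_schmidt y j) *\<^sub>R gram_schmidt y j)"

lemma gs_tail_Suc: "gs_tail y (Suc m) x = gs_tail y m x - (x \<bullet> gram_schmidt y m) *\<^sub>R gram_schmidt y m"
  by (simp add: gs_tail_def)

lemma gs_tail_inner: "gs_tail y m x \<bullet> gram_schmidt y m = x \<bullet> gram_schmidt y m"
proof -
  have "(\<Sum>j<m. (x \<bullet> gram_schmidt y j) * (gram_schmidt y j \<bullet> gram_schmidt y m)) = 0"
  proof (intro sum.neutral ballI)
    fix j assume "j \<in> {..<m}"
    then have "gram_schmidt y j \<bullet> gram_schmidt y m = 0" by (intro gram_schmidt_orthogonal) simp
    then show "(x \<bullet> gram_schmidt y j) * (gram_schmidt y j \<bullet> gram_schmidt y m) = 0" by simp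
  qed
  then show ?thesis by (simp add: gs_tail_def inner_diff_left inner_sum_left)
qed

text \<open>Pythagoras: removing the component along a unit vector subtracts the square of its
  coefficient, and a zero entry changes nothing.\<close>

lemma norm_gs_tail_Suc: "norm (gs_tail y (Suc m) x) \<le> norm (gs_tail y m x)"
proof -
  let ?e = "gram_schmidt y m" and ?q = "gs_tail y m x"
  have "(norm (?q - (x \<bullet> ?e) *\<^sub>R ?e))\<^sup>2 = (norm ?q)\<^sup>2 - 2 * (x \<bullet> ?e) * (?q \<bullet> ?e) + (x \<bullet> ?e)\<^sup>2 * (?e \<bullet> ?e)"
    unfolding power2_norm_eq_inner by (simp add: inner_diff_left inner_diff_right inner_commute power2_eq_square algebra_simps)
  then have "(norm (gs_tail y (Suc m) x))\<^sup>2 = (norm ?q)\<^sup>2 - 2 * (x \<bullet> ?e)\<^sup>2 + (x \<bullet> ?e)\<^sup>2 * (?e \<bullet> ?e)"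
    by (simp add: gs_tail_Suc gs_tail_inner power2_eq_square)
  also have "\<dots> \<le> (norm ?q)\<^sup>2" using gram_schmidt_inner_self[of y m] by auto
  finally show ?thesis using power2_le_imp_le by (metis norm_ge_zero)
qed

lemma norm_gs_tail_mono: "m \<le> n \<Longrightarrow> norm (gs_tail y n x) \<le> norm (gs_tail y m x)"
  by (rule lift_Suc_antimono_le[of "\<lambda>m. norm (gs_tail y m x)"]) (auto simp: norm_gs_tail_Suc)

lemma norm_gs_tail_le: "norm (gs_tail y m x) \<le> norm x"
  using norm_gs_tail_mono[of 0 m y x] by (simp add: gs_tail_def)

lemma gs_tail_bounded_linear: "bounded_linear (gs_tail y m)"
  unfolding gs_tail_def
  by (intro bounded_linear_sub bounded_linear_ident bounded_linear_sum
      bounded_linear_scaleR_const bounded_linear_inner_left)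

text \<open>\<open>gram_schmidt y i\<close> is the direction of what its predecessors leave over of
  \<open>y i\<close>, so one more step removes the remainder.\<close>

lemma gs_tail_generator:
  assumes "i < m" shows "gs_tail y m (y i) = 0"
proof -
  let ?e = "gram_schmidt y i" and ?z = "gs_tail y i (y i)"
  have e: "?e = sgn ?z" by (subst gram_schmidt.simps) (simp add: gs_tail_def)
  have "y i \<bullet> ?e = ?z \<bullet> sgn ?z" using gs_tail_inner[of y i "y i"] e by simp
  also have "\<dots> = norm ?z"
    by (cases "?z = 0") (simp_all add: sgn_div_norm power2_norm_eq_inner[symmetric] power2_eq_square)
  finally have "gs_tail y (Suc i) (y i) = ?z - norm ?z *\<^sub>R sgn ?z"
    by (simp add: gs_tail_Suc e)
  also have "\<dots> = 0" by (cases "?z = 0") (simp_all add: sgn_div_norm)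
  finally show ?thesis using norm_gs_tail_mono[of "Suc i" m y "y i"] assms by simp
qed

text \<open>The complementary projection has finite-dimensional range. Its bounded part is enclosed
  in a sum of segments, one more for each induction step.\<close>

lemma gs_tail_complement_compact:
  "\<exists>K. compact K \<and> (\<forall>x. norm x \<le> R \<longrightarrow> x - gs_tail y m x \<in> K)"
proof (induction m)
  case 0
  show ?case by (rule exI[of _ "{0}"]) (simp add: gs_tail_def)
next
  case (Suc m)
  let ?e = "gram_schmidt y m"
  obtain K where K: "compact K" "\<And>x. norm x \<le> R \<Longrightarrow> x - gs_tail y m x \<in> K" using Suc by blast
  have "compact ((\<lambda>c. c *\<^sub>R ?e) ` {-R..R})"
    by (intro compact_continuous_image continuous_intros) auto
  with K(1) have "compact {a + b |a b. a \<in> K \<and> b \<in> (\<lambda>c. c *\<^sub>R ?e) ` {-R..R}}" by (rule compact_sums)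
  moreover have "x - gs_tail y (Suc m) x \<in> {a + b |a b. a \<in> K \<and> b \<in> (\<lambda>c. c *\<^sub>R ?e) ` {-R..R}}"
    if "norm x \<le> R" for x
  proof -
    have "norm ?e \<le> 1" using gram_schmidt_inner_self[of y m] by (auto simp: norm_eq_sqrt_inner)
    then have "\<bar>x \<bullet> ?e\<bar> \<le> R"
      using Cauchy_Schwarz_ineq2[of x ?e] that
      by (smt (verit) mult_left_le norm_ge_zero)
    then have "x \<bullet> ?e \<in> {-R..R}" by auto
    moreover have "x - gs_tail y (Suc m) x = (x - gs_tail y m x) + (x \<bullet> ?e) *\<^sub>R ?e"
      by (simp add: gs_tail_Suc)
    ultimately show ?thesis using K(2)[OF that] by blast
  qed
  ultimately show ?case by blast
qed

text \<open>The interface to the rest of the proof. Pointwise convergence follows from density,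
  because the tail of index \<open>m\<close> annihilates \<open>y j\<close> once
  \<open>j < m\<close> and never increases the norm.\<close>

lemma tail_projections:
  obtains Q :: "nat \<Rightarrow> 'a \<Rightarrow> 'a::{real_inner,second_countable_topology}"
  where "\<And>m. bounded_linear (Q m)" "\<And>m x. norm (Q m x) \<le> norm x"
    "\<And>m n x. m \<le> n \<Longrightarrow> norm (Q n x) \<le> norm (Q m x)" "\<And>x. (\<lambda>m. Q m x) \<longlonglongrightarrow> 0"
    "\<And>m R. \<exists>K. compact K \<and> (\<forall>x. norm x \<le> R \<longrightarrow> x - Q m x \<in> K)"
proof -
  obtain Y :: "'a set" where Y: "countable Y" "\<And>X. open X \<Longrightarrow> X \<noteq> {} \<Longrightarrow> \<exists>d\<in>Y. d \<in> X"
    by (erule countable_dense_setE)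
  define y where "y = from_nat_into Y"
  have dense: "\<exists>j. y j \<in> X" if "open X" "X \<noteq> {}" for X
    using Y(2)[OF that] from_nat_into_surj[OF Y(1)] unfolding y_def by metis
  have lim: "(\<lambda>m. gs_tail y m x) \<longlonglongrightarrow> 0" for x
  proof (rule LIMSEQ_I)
    fix r :: real assume "0 < r"
    then obtain j where j: "y j \<in> ball x r" using dense[of "ball x r"] by auto
    have "norm (gs_tail y m x - 0) < r" if "Suc j \<le> m" for m
    proof -
      have "gs_tail y m x = gs_tail y m (x - y j)"
        using gs_tail_generator[of j m y] that
        by (simp add: linear_diff bounded_linear.linear[OF gs_tail_bounded_linear])
      then show ?thesis using norm_gs_tail_le[of y m "x - y j"] j by (simp add: dist_norm)
    qed
    then show "\<exists>no. \<forall>n\<ge>no. norm (gs_tail y n x - 0) < r" by blast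
  qed
  show thesis
    by (rule that[of "gs_tail y"])
      (auto intro: gs_tail_bounded_linear norm_gs_tail_le norm_gs_tail_mono lim gs_tail_complement_compact)
qed

section \<open>Calculus of the Hausdorff and Kuratowski measures\<close>

lemma hausdorff_mnc_leI:
  assumes "\<And>\<epsilon>. \<epsilon> > 0 \<Longrightarrow> \<exists>X. finite X \<and> A \<subseteq> (\<Union>x\<in>X. cball x (b + \<epsilon>))" "0 \<le> b"
  shows "hausdorff_mnc A \<le> ereal b"
proof (rule ereal_le_epsilon2)
  fix \<epsilon> :: real assume "0 < \<epsilon>"
  then show "hausdorff_mnc A \<le> ereal b + ereal \<epsilon>"
    unfolding hausdorff_mnc_def plus_ereal.simps using assms(1)[of \<epsilon>] assms(2)
    by (intro Inf_lower) auto
qed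

lemma hausdorff_mnc_leD:
  assumes "hausdorff_mnc A \<le> ereal b" "\<epsilon> > 0"
  obtains X where "finite X" "\<And>a. a \<in> A \<Longrightarrow> \<exists>x\<in>X. dist x a \<le> b + \<epsilon>"
proof -
  have "hausdorff_mnc A < ereal (b + \<epsilon>)" using assms
    by (metis ereal_less_eq(3) less_add_same_cancel1 linorder_not_le order_trans)
  then obtain r X where "r < b + \<epsilon>" "finite X" "A \<subseteq> (\<Union>x\<in>X. cball x r)"
    unfolding hausdorff_mnc_def Inf_less_iff by auto
  moreover have "\<exists>x\<in>X. dist x a \<le> b + \<epsilon>" if "a \<in> A" for a
  proof -
    obtain x where "x \<in> X" "dist x a \<le> r" using \<open>A \<subseteq> (\<Union>x\<in>X. cball x r)\<close> \<open>a \<in> A\<close> by auto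
    then show ?thesis using \<open>r < b + \<epsilon>\<close> by force
  qed
  ultimately show thesis using that by blast
qed

lemma kuratowski_mnc_leD:
  assumes "kuratowski_mnc A \<le> ereal b" "\<epsilon> > 0"
  obtains C where "finite C" "A \<subseteq> \<Union>C" "\<And>S x y. S \<in> C \<Longrightarrow> x \<in> S \<Longrightarrow> y \<in> S \<Longrightarrow> dist x y \<le> b + \<epsilon>"
proof -
  have "kuratowski_mnc A < ereal (b + \<epsilon>)" using assms
    by (metis ereal_less_eq(3) less_add_same_cancel1 linorder_not_le order_trans)
  then obtain r C where "r < b + \<epsilon>" "finite C" "A \<subseteq> \<Union>C" "\<forall>S\<in>C. \<forall>x\<in>S. \<forall>y\<in>S. dist x y \<le> r"
    unfolding kuratowski_mnc_def Inf_less_iff by auto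
  then show thesis using that[of C] by force
qed

lemma hausdorff_mnc_mono: "A \<subseteq> B \<Longrightarrow> hausdorff_mnc A \<le> hausdorff_mnc B"
  unfolding hausdorff_mnc_def by (intro Inf_superset_mono) blast

text \<open>A set of diameter at most \<open>d\<close> lies in the ball of radius \<open>d\<close>
  around any of its members.\<close>

lemma hausdorff_le_kuratowski:
  assumes "kuratowski_mnc A \<le> ereal b" "0 \<le> b"
  shows "hausdorff_mnc A \<le> ereal b"
proof (rule hausdorff_mnc_leI)
  fix \<epsilon> :: real assume "0 < \<epsilon>"
  obtain C where C: "finite C" "A \<subseteq> \<Union>C" "\<And>S x y. S \<in> C \<Longrightarrow> x \<in> S \<Longrightarrow> y \<in> S \<Longrightarrow> dist x y \<le> b + \<epsilon>"
    using kuratowski_mnc_leD[OF assms(1) \<open>0 < \<epsilon>\<close>] by blast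
  define p where "p S = (SOME x. x \<in> S)" for S :: "'a set"
  have p: "p S \<in> S" if "x \<in> S" for x S unfolding p_def using that by (rule someI)
  have "A \<subseteq> (\<Union>x\<in>p ` C. cball x (b + \<epsilon>))"
  proof
    fix x assume "x \<in> A"
    then obtain S where S: "S \<in> C" "x \<in> S" using C(2) by auto
    then have "x \<in> cball (p S) (b + \<epsilon>)" using C(3)[OF S(1) p[OF S(2)] S(2)] by simp
    then show "x \<in> (\<Union>x\<in>p ` C. cball x (b + \<epsilon>))" using S(1) by blast
  qed
  then show "\<exists>X. finite X \<and> A \<subseteq> (\<Union>x\<in>X. cball x (b + \<epsilon>))" using C(1) by blast
qed fact

text \<open>The diameter of a ball is at most twice its radius. This is the origin of the factor 2
  in front of \<open>k\<close> in the locale below.\<close>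

lemma kuratowski_le_hausdorff:
  assumes "hausdorff_mnc A \<le> ereal b" "0 \<le> b"
  shows "kuratowski_mnc A \<le> ereal (2 * b)"
proof (rule ereal_le_epsilon2)
  fix \<epsilon> :: real assume "0 < \<epsilon>"
  then have e: "0 < \<epsilon> / 2" by simp
  obtain X where X: "finite X" "\<And>z. z \<in> A \<Longrightarrow> \<exists>x\<in>X. dist x z \<le> b + \<epsilon> / 2"
    by (rule hausdorff_mnc_leD[OF assms(1) e]) blast
  let ?C = "(\<lambda>x. cball x (b + \<epsilon> / 2)) ` X"
  have "dist u v \<le> 2 * b + \<epsilon>" if "S \<in> ?C" "u \<in> S" "v \<in> S" for S u v
  proof -
    obtain x where "dist x u \<le> b + \<epsilon> / 2" "dist x v \<le> b + \<epsilon> / 2" using \<open>S \<in> ?C\<close> \<open>u \<in> S\<close> \<open>v \<in> S\<close> by force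
    then show ?thesis using dist_triangle3[of u v x] by simp
  qed
  then have "\<exists>C. finite C \<and> A \<subseteq> \<Union>C \<and> (\<forall>S\<in>C. \<forall>x\<in>S. \<forall>y\<in>S. dist x y \<le> 2 * b + \<epsilon>)"
    using X by (intro exI[of _ ?C]) (auto 0 3)
  then show "kuratowski_mnc A \<le> ereal (2 * b) + ereal \<epsilon>"
    unfolding kuratowski_mnc_def plus_ereal.simps using \<open>0 < \<epsilon>\<close> assms(2)
    by (intro Inf_lower) auto
qed

lemma hausdorff_mnc_range_add:
  fixes u v :: "'i \<Rightarrow> 'a::real_normed_vector"
  assumes "hausdorff_mnc (range u) \<le> ereal a" "hausdorff_mnc (range v) \<le> ereal b" "0 \<le> a" "0 \<le> b"
  shows "hausdorff_mnc (range (\<lambda>n. u n + v n)) \<le> ereal (a + b)"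
proof (rule hausdorff_mnc_leI)
  fix \<epsilon> :: real assume "0 < \<epsilon>"
  then have e: "0 < \<epsilon> / 2" by simp
  obtain X where X: "finite X" "\<And>z. z \<in> range u \<Longrightarrow> \<exists>x\<in>X. dist x z \<le> a + \<epsilon>/2"
    by (rule hausdorff_mnc_leD[OF assms(1) e]) blast
  obtain Y where Y: "finite Y" "\<And>z. z \<in> range v \<Longrightarrow> \<exists>x\<in>Y. dist x z \<le> b + \<epsilon>/2"
    by (rule hausdorff_mnc_leD[OF assms(2) e]) blast
  have "u n + v n \<in> (\<Union>x\<in>(\<lambda>(x, y). x + y) ` (X \<times> Y). cball x (a + b + \<epsilon>))" for n
  proof -
    obtain x y where "x \<in> X" "y \<in> Y" and xy: "dist x (u n) \<le> a + \<epsilon>/2" "dist y (v n) \<le> b + \<epsilon>/2"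
      using X(2)[of "u n"] Y(2)[of "v n"] by auto
    have "dist (x + y) (u n + v n) \<le> a + b + \<epsilon>"
      using dist_triangle_add[of x y "u n" "v n"] xy by (simp add: field_sum_of_halves)
    then show ?thesis using \<open>x \<in> X\<close> \<open>y \<in> Y\<close> by force
  qed
  then show "\<exists>Z. finite Z \<and> range (\<lambda>n. u n + v n) \<subseteq> (\<Union>x\<in>Z. cball x (a + b + \<epsilon>))"
    using X(1) Y(1) by (intro exI[of _ "(\<lambda>(x, y). x + y) ` (X \<times> Y)"] conjI image_subsetI) simp_all
qed (use assms in auto)

text \<open>The finitely many terms that are not yet close are added as centres. This carries
  estimates from the polygons to the lagged states at which \<open>F\<close> and \<open>g\<close>
  are evaluated.\<close>

lemma hausdorff_mnc_range_asymptotic: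
  fixes u v :: "nat \<Rightarrow> 'a::real_normed_vector"
  assumes "hausdorff_mnc (range u) \<le> ereal b" "0 \<le> b" "(\<lambda>n. v n - u n) \<longlonglongrightarrow> 0"
  shows "hausdorff_mnc (range v) \<le> ereal b"
proof (rule hausdorff_mnc_leI)
  fix \<epsilon> :: real assume "0 < \<epsilon>"
  then have e: "0 < \<epsilon> / 2" by simp
  obtain X where X: "finite X" "\<And>z. z \<in> range u \<Longrightarrow> \<exists>x\<in>X. dist x z \<le> b + \<epsilon>/2"
    by (rule hausdorff_mnc_leD[OF assms(1) e]) blast
  obtain N where N: "\<And>n. n \<ge> N \<Longrightarrow> norm (v n - u n) < \<epsilon> / 2"
    using LIMSEQ_D[OF assms(3) e] by auto
  have "v n \<in> (\<Union>x\<in>X \<union> v ` {..<N}. cball x (b + \<epsilon>))" for n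
  proof (cases "n < N")
    case True
    then have "v n \<in> X \<union> v ` {..<N}" by blast
    moreover have "v n \<in> cball (v n) (b + \<epsilon>)" using \<open>0 < \<epsilon>\<close> assms(2) by simp
    ultimately show ?thesis by blast
  next
    case False
    obtain x where x: "x \<in> X" "dist x (u n) \<le> b + \<epsilon>/2" using X(2)[of "u n"] by auto
    have "dist x (v n) \<le> b + \<epsilon>"
      using dist_triangle[of x "v n" "u n"] x N[of n] False by (simp add: dist_norm norm_minus_commute)
    then show ?thesis using x(1) by auto
  qed
  then show "\<exists>Z. finite Z \<and> range v \<subseteq> (\<Union>x\<in>Z. cball x (b + \<epsilon>))"
    using X(1) by (intro exI[of _ "X \<union> v ` {..<N}"] conjI image_subsetI) simp_all
qed fact

text \<open>The Lipschitz bound is available only between values of \<open>u\<close>, whereas the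
  centres of covering balls may lie elsewhere. Recentring each ball at a value inside it doubles the
  radius, hence the factor 2.\<close>

lemma hausdorff_mnc_Lipschitz_range:
  fixes u :: "'i \<Rightarrow> 'a::metric_space" and f :: "'a \<Rightarrow> 'b::metric_space"
  assumes "hausdorff_mnc (range u) \<le> ereal b" "0 \<le> b" "0 \<le> L"
    and lip: "\<And>m n. dist (f (u m)) (f (u n)) \<le> L * dist (u m) (u n)"
  shows "hausdorff_mnc (range (\<lambda>n. f (u n))) \<le> ereal (2 * L * b)"
proof (rule hausdorff_mnc_leI)
  fix \<epsilon> :: real assume "0 < \<epsilon>"
  \<comment> \<open>The summand 1 covers the case \<open>L = 0\<close>.\<close>
  define e where "e = \<epsilon> / (2 * L + 1)"
  have e: "0 < e" "2 * L * e \<le> \<epsilon>" using \<open>0 < \<epsilon>\<close> assms(3) by (auto simp: e_def field_simps)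
  obtain X where X: "finite X" "\<And>z. z \<in> range u \<Longrightarrow> \<exists>x\<in>X. dist x z \<le> b + e"
    by (rule hausdorff_mnc_leD[OF assms(1) e(1)]) blast
  define p where "p x = (SOME n. u n \<in> cball x (b + e))" for x
  have p: "u (p x) \<in> cball x (b + e)" if "u n \<in> cball x (b + e)" for x n
    unfolding p_def using that by (rule someI)
  have "f (u n) \<in> (\<Union>y\<in>(\<lambda>x. f (u (p x))) ` X. cball y (2 * L * b + \<epsilon>))" for n
  proof -
    obtain x where x: "x \<in> X" "u n \<in> cball x (b + e)" using X(2)[of "u n"] by auto
    have "dist (u (p x)) (u n) \<le> 2 * (b + e)"
      using dist_triangle3[of "u (p x)" "u n" x] x p[OF x(2)] by (simp add: dist_commute)
    then have "dist (f (u (p x))) (f (u n)) \<le> L * (2 * (b + e))"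
      using lip assms(3) by (meson mult_left_mono order_trans)
    also have "\<dots> \<le> 2 * L * b + \<epsilon>" using e(2) by (simp add: algebra_simps)
    finally show ?thesis using x(1) by auto
  qed
  then show "\<exists>Z. finite Z \<and> range (\<lambda>n. f (u n)) \<subseteq> (\<Union>x\<in>Z. cball x (2 * L * b + \<epsilon>))"
    using X(1) by (intro exI[of _ "(\<lambda>x. f (u (p x))) ` X"] conjI image_subsetI) simp_all
qed (use assms in auto)

text \<open>The centres of a finite net have uniformly small tails and tails do not increase
  distances, which gives one direction. Conversely, the parts complementary to the tails lie in a
  compact set, and a finite net of it serves \<open>u\<close> up to the size of the tail.\<close>

lemma hausdorff_mnc_range_iff_tails:
  fixes Q :: "nat \<Rightarrow> 'a \<Rightarrow> 'a::real_normed_vector" and u :: "'i \<Rightarrow> 'a"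
  assumes Q: "\<And>m. bounded_linear (Q m)" "\<And>m x. norm (Q m x) \<le> norm x"
    "\<And>x. (\<lambda>m. Q m x) \<longlonglongrightarrow> 0"
    "\<And>m R. \<exists>K. compact K \<and> (\<forall>x. norm x \<le> R \<longrightarrow> x - Q m x \<in> K)"
    and u: "\<And>n. norm (u n) \<le> R" and b: "0 \<le> b"
  shows "hausdorff_mnc (range u) \<le> ereal b \<longleftrightarrow>
    (\<forall>\<epsilon>>0. \<exists>M. \<forall>m\<ge>M. \<forall>n. norm (Q m (u n)) \<le> b + \<epsilon>)"
proof
  assume h: "hausdorff_mnc (range u) \<le> ereal b"
  show "\<forall>\<epsilon>>0. \<exists>M. \<forall>m\<ge>M. \<forall>n. norm (Q m (u n)) \<le> b + \<epsilon>"
  proof (intro allI impI)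
    fix \<epsilon> :: real assume "0 < \<epsilon>"
    then have e: "0 < \<epsilon> / 2" by simp
    obtain X where X: "finite X" "\<And>z. z \<in> range u \<Longrightarrow> \<exists>x\<in>X. dist x z \<le> b + \<epsilon>/2"
      by (rule hausdorff_mnc_leD[OF h e]) blast
    have "\<forall>\<^sub>F m in sequentially. \<forall>x\<in>X. norm (Q m x) < \<epsilon> / 2"
    proof (rule eventually_ball_finite[OF X(1)], rule ballI)
      fix x
      show "\<forall>\<^sub>F m in sequentially. norm (Q m x) < \<epsilon> / 2"
        using order_tendstoD(2)[OF tendsto_norm_zero[OF Q(3)] e] .
    qed
    then obtain M where M: "\<And>m x. m \<ge> M \<Longrightarrow> x \<in> X \<Longrightarrow> norm (Q m x) < \<epsilon> / 2"
      unfolding eventually_sequentially by blast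
    have "norm (Q m (u n)) \<le> b + \<epsilon>" if "m \<ge> M" for m n
    proof -
      obtain x where x: "x \<in> X" "dist x (u n) \<le> b + \<epsilon>/2" using X(2)[of "u n"] by auto
      have "Q m (u n) = Q m (u n - x) + Q m x"
        by (simp add: linear_diff bounded_linear.linear[OF Q(1)])
      then have "norm (Q m (u n)) \<le> norm (Q m (u n - x)) + norm (Q m x)"
        using norm_triangle_ineq by metis
      also have "\<dots> \<le> norm (u n - x) + \<epsilon> / 2"
        using Q(2)[of m "u n - x"] M[OF that x(1)] by linarith
      also have "\<dots> \<le> b + \<epsilon>" using x(2) by (simp add: dist_norm norm_minus_commute)
      finally show ?thesis .
    qed
    then show "\<exists>M. \<forall>m\<ge>M. \<forall>n. norm (Q m (u n)) \<le> b + \<epsilon>" by blast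
  qed
next
  assume *: "\<forall>\<epsilon>>0. \<exists>M. \<forall>m\<ge>M. \<forall>n. norm (Q m (u n)) \<le> b + \<epsilon>"
  show "hausdorff_mnc (range u) \<le> ereal b"
  proof (rule hausdorff_mnc_leI)
    fix \<epsilon> :: real assume "0 < \<epsilon>"
    then have e: "0 < \<epsilon> / 2" by simp
    then obtain m where m: "\<And>n. norm (Q m (u n)) \<le> b + \<epsilon>/2" using * by blast
    obtain K where K: "compact K" "\<And>x. norm x \<le> R \<Longrightarrow> x - Q m x \<in> K" using Q(4) by blast
    obtain X where X: "finite X" "K \<subseteq> (\<Union>x\<in>X. ball x (\<epsilon>/2))"
      using compactE_image[OF K(1), of K "\<lambda>x. ball x (\<epsilon>/2)"] e by (metis UN_I centre_in_ball open_ball subsetI)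
    have "u n \<in> (\<Union>x\<in>X. cball x (b + \<epsilon>))" for n
    proof -
      obtain x where x: "x \<in> X" "dist x (u n - Q m (u n)) < \<epsilon>/2" using X(2) K(2)[OF u[of n]] by (auto dest!: subsetD)
      have "dist x (u n) \<le> dist x (u n - Q m (u n)) + norm (Q m (u n))"
        using dist_triangle[of x "u n" "u n - Q m (u n)"] by (simp add: dist_norm)
      also have "\<dots> \<le> b + \<epsilon>" using x(2) m[of n] by simp
      finally show ?thesis using x(1) by auto
    qed
    then show "\<exists>X. finite X \<and> range u \<subseteq> (\<Union>x\<in>X. cball x (b + \<epsilon>))" using X(1) by blast
  qed fact
qed

text \<open>The supremum over the sequence of the norms of the tails dominates all the integrands at once,
  so dominated convergence in the tail index exchanges the measure of noncompactness and the integral.\<close>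

lemma hausdorff_mnc_integral_le:
  fixes u :: "nat \<Rightarrow> 'b \<Rightarrow> 'a::{real_inner,banach,second_countable_topology}"
  assumes u: "\<And>n. u n \<in> borel_measurable M" "\<And>n. AE t in M. norm (u n t) \<le> w t"
    and w: "integrable M w" and b: "integrable M b" "AE t in M. 0 \<le> b t"
    and h: "AE t in M. hausdorff_mnc (range (\<lambda>n. u n t)) \<le> ereal (b t)"
  shows "hausdorff_mnc (range (\<lambda>n. integral\<^sup>L M (u n))) \<le> ereal (integral\<^sup>L M b)"
proof -
  obtain Q :: "nat \<Rightarrow> 'a \<Rightarrow> 'a" where Q: "\<And>m. bounded_linear (Q m)" "\<And>m x. norm (Q m x) \<le> norm x"
    "\<And>m n x. m \<le> n \<Longrightarrow> norm (Q n x) \<le> norm (Q m x)" "\<And>x. (\<lambda>m. Q m x) \<longlonglongrightarrow> 0"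
    "\<And>m R. \<exists>K. compact K \<and> (\<forall>x. norm x \<le> R \<longrightarrow> x - Q m x \<in> K)"
    by (rule tail_projections) blast
  have uw: "AE t in M. \<forall>n. norm (u n t) \<le> w t" using u(2) by (simp add: AE_all_countable)
  have int: "integrable M (u n)" for n
  proof (rule Bochner_Integration.integrable_bound[OF w u(1)])
    show "AE t in M. norm (u n t) \<le> norm (w t)" using u(2)[of n] by eventually_elim auto
  qed
  have [measurable]: "Q m \<in> borel_measurable borel" for m
    using Q(1) by (intro borel_measurable_continuous_onI) (simp add: linear_continuous_on)
  note [measurable] = u(1)
  have [measurable]: "w \<in> borel_measurable M" "b \<in> borel_measurable M" using w b by auto
  \<comment> \<open>Truncation by \<open>w\<close> keeps the supremum finite everywhere, also on the
    null set where the bound on \<open>u\<close> fails. The maximum with \<open>b\<close> turns an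
    upper estimate of the limit into convergence to \<open>b\<close>, as dominated convergence
    requires.\<close>
  define s where "s m t = max (b t) (SUP n. min (norm (Q m (u n t))) (w t))" for m t
  have bdd: "bdd_above (range (\<lambda>n. min (norm (Q m (u n t))) (w t)))" for m t
    by (intro bdd_aboveI[of _ "w t"]) auto
  have [measurable]: "s m \<in> borel_measurable M" for m
    unfolding s_def using bdd by (intro borel_measurable_max borel_measurable_cSUP) auto
  have Qs: "AE t in M. \<forall>n. norm (Q m (u n t)) \<le> s m t" for m
    using uw
  proof eventually_elim
    case (elim t)
    have "norm (Q m (u n t)) \<le> (SUP n. min (norm (Q m (u n t))) (w t))" for n
    proof -
      have "norm (Q m (u n t)) = min (norm (Q m (u n t))) (w t)"
        using Q(2)[of m "u n t"] elim by (smt (verit))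
      also have "\<dots> \<le> (SUP n. min (norm (Q m (u n t))) (w t))" by (rule cSUP_upper[OF _ bdd]) auto
      finally show ?thesis .
    qed
    then show ?case by (auto simp: s_def max.coboundedI2)
  qed
  have s_bound: "AE t in M. norm (s m t) \<le> b t + w t" for m
    using uw b(2)
  proof eventually_elim
    case (elim t)
    then have w0: "0 \<le> w t" using norm_ge_zero order_trans by blast
    have "(SUP n. min (norm (Q m (u n t))) (w t)) \<le> w t" by (rule cSUP_least) auto
    then have "s m t \<le> b t + w t" "0 \<le> s m t" using elim w0 by (auto simp: s_def)
    then show ?case by simp
  qed
  have s_lim: "AE t in M. (\<lambda>m. s m t) \<longlonglongrightarrow> b t"
    using uw b(2) h
  proof eventually_elim
    case (elim t)
    have tails: "\<forall>\<epsilon>>0. \<exists>M. \<forall>m\<ge>M. \<forall>n. norm (Q m (u n t)) \<le> b t + \<epsilon>"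
      using hausdorff_mnc_range_iff_tails[OF Q(1,2,4,5), of "\<lambda>n. u n t" "w t" "b t"] elim by auto
    show ?case
    proof (rule LIMSEQ_I)
      fix r :: real assume "0 < r"
      then obtain M where M: "\<And>m n. m \<ge> M \<Longrightarrow> norm (Q m (u n t)) \<le> b t + r / 2"
        using tails by (meson half_gt_zero)
      have "norm (s m t - b t) < r" if "m \<ge> M" for m
      proof -
        have "(SUP n. min (norm (Q m (u n t))) (w t)) \<le> b t + r / 2"
          using M[OF that] by (intro cSUP_least) (auto simp: min.coboundedI1)
        then show ?thesis using \<open>0 < r\<close> by (auto simp: s_def)
      qed
      then show "\<exists>no. \<forall>m\<ge>no. norm (s m t - b t) < r" by blast
    qed
  qed
  have s_int: "integrable M (s m)" for m
  proof (rule Bochner_Integration.integrable_bound[of M "\<lambda>t. b t + w t"])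
    show "AE t in M. norm (s m t) \<le> norm (b t + w t)" using s_bound[of m] by eventually_elim auto
  qed (use b(1) w in auto)
  have conv: "(\<lambda>m. integral\<^sup>L M (s m)) \<longlonglongrightarrow> integral\<^sup>L M b"
    using s_bound s_lim b(1) w by (intro integral_dominated_convergence[where w="\<lambda>t. b t + w t"]) auto
  have Qint: "norm (Q m (integral\<^sup>L M (u n))) \<le> integral\<^sup>L M (s m)" for m n
  proof -
    have "norm (Q m (integral\<^sup>L M (u n))) = norm (integral\<^sup>L M (\<lambda>t. Q m (u n t)))"
      by (simp add: integral_bounded_linear[OF Q(1) int])
    also have "\<dots> \<le> integral\<^sup>L M (\<lambda>t. norm (Q m (u n t)))" by simp
    also have "\<dots> \<le> integral\<^sup>L M (s m)"
      using Qs[of m] s_int integrable_bounded_linear[OF Q(1) int]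
      by (intro integral_mono_AE) (auto elim!: AE_mp)
    finally show ?thesis .
  qed
  have bound: "norm (integral\<^sup>L M (u n)) \<le> integral\<^sup>L M w" for n
  proof -
    have "norm (integral\<^sup>L M (u n)) \<le> integral\<^sup>L M (\<lambda>t. norm (u n t))" by simp
    also have "\<dots> \<le> integral\<^sup>L M w" using u(2) w int by (intro integral_mono_AE) auto
    finally show ?thesis .
  qed
  have b0: "0 \<le> integral\<^sup>L M b" using b(2) by (rule integral_nonneg_AE)
  show ?thesis
  proof (subst hausdorff_mnc_range_iff_tails[OF Q(1,2,4,5) bound b0], intro allI impI)
    fix \<epsilon> :: real assume "0 < \<epsilon>"
    then have "\<forall>\<^sub>F m in sequentially. integral\<^sup>L M (s m) < integral\<^sup>L M b + \<epsilon>"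
      by (intro order_tendstoD(2)[OF conv]) auto
    then show "\<exists>N. \<forall>m\<ge>N. \<forall>n. norm (Q m (integral\<^sup>L M (u n))) \<le> integral\<^sup>L M b + \<epsilon>"
      unfolding eventually_sequentially using Qint by (meson less_imp_le order_trans)
  qed
qed

section \<open>Lebesgue integrals over intervals\<close>

lemma integrable_lebesgue_on_iff:
  fixes f :: "'a::euclidean_space \<Rightarrow> 'b::{banach,second_countable_topology}"
  assumes "S \<in> sets lebesgue"
  shows "integrable (lebesgue_on S) f \<longleftrightarrow> integrable lebesgue (\<lambda>x. indicator S x *\<^sub>R f x)"
  using assms by (intro integrable_restrict_space) auto

lemma integral_lebesgue_on_eq:
  fixes f :: "'a::euclidean_space \<Rightarrow> 'b::{banach,second_countable_topology}"
  assumes "S \<in> sets lebesgue"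
  shows "integral\<^sup>L (lebesgue_on S) f = integral\<^sup>L lebesgue (\<lambda>x. indicator S x *\<^sub>R f x)"
  using assms by (intro integral_restrict_space) auto

lemma integrable_lebesgue_on_subset:
  fixes f :: "'a::euclidean_space \<Rightarrow> 'b::{banach,second_countable_topology}"
  assumes "integrable (lebesgue_on S) f" "R \<subseteq> S" "R \<in> sets lebesgue" "S \<in> sets lebesgue"
  shows "integrable (lebesgue_on R) f"
proof -
  have "integrable lebesgue (\<lambda>x. indicator R x *\<^sub>R (indicator S x *\<^sub>R f x))"
    using assms by (intro integrable_mult_indicator[OF assms(3)]) (simp add: integrable_lebesgue_on_iff)
  also have "(\<lambda>x. indicator R x *\<^sub>R (indicator S x *\<^sub>R f x)) = (\<lambda>x. indicator R x *\<^sub>R f x)"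
    using assms(2) by (intro ext) (auto simp: indicator_def)
  finally show ?thesis using assms(3) by (simp add: integrable_lebesgue_on_iff)
qed

lemma integral_lebesgue_on_split:
  fixes f :: "real \<Rightarrow> 'b::{banach,second_countable_topology}"
  assumes f: "integrable (lebesgue_on {a..b}) f" and "a \<le> c" "c \<le> b"
  shows "integral\<^sup>L (lebesgue_on {a..b}) f = integral\<^sup>L (lebesgue_on {a..c}) f + integral\<^sup>L (lebesgue_on {c..b}) f"
proof -
  have 1: "integrable lebesgue (\<lambda>x. indicator {a..c} x *\<^sub>R f x)" and 2: "integrable lebesgue (\<lambda>x. indicator {c..b} x *\<^sub>R f x)"
    using integrable_lebesgue_on_subset[OF f, of "{a..c}"] integrable_lebesgue_on_subset[OF f, of "{c..b}"] assms
    by (auto simp: integrable_lebesgue_on_iff)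
  have "integral\<^sup>L lebesgue (\<lambda>x. indicator {a..b} x *\<^sub>R f x) =
      integral\<^sup>L lebesgue (\<lambda>x. indicator {a..c} x *\<^sub>R f x + indicator {c..b} x *\<^sub>R f x)"
  proof (rule integral_cong_AE)
    \<comment> \<open>The right-hand side counts the point \<open>c\<close> twice, on a null
      set.\<close>
    show "AE x in lebesgue. indicator {a..b} x *\<^sub>R f x = indicator {a..c} x *\<^sub>R f x + indicator {c..b} x *\<^sub>R f x"
      by (rule AE_I'[of "{c}"]) (use assms in \<open>auto simp: indicator_def\<close>)
  qed (use f 1 2 in \<open>auto simp: integrable_lebesgue_on_iff\<close>)
  then show ?thesis using 1 2 by (simp add: integral_lebesgue_on_eq)
qed

lemma AE_lebesgue_on_subset:
  assumes "AE x in lebesgue_on S. P x" "R \<subseteq> S" "R \<in> sets lebesgue" "S \<in> sets lebesgue"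
  shows "AE x in lebesgue_on R. P x"
  using assms by (auto simp: AE_restrict_space_iff elim!: AE_mp)

lemma integral_lebesgue_on_mono_set:
  fixes f :: "'a::euclidean_space \<Rightarrow> real"
  assumes "integrable (lebesgue_on S) f" "R \<subseteq> S" "R \<in> sets lebesgue" "S \<in> sets lebesgue"
    and "\<And>x. x \<in> S \<Longrightarrow> 0 \<le> f x"
  shows "integral\<^sup>L (lebesgue_on R) f \<le> integral\<^sup>L (lebesgue_on S) f"
  using assms by (intro integral_mono_lebesgue_on_AE) (auto intro!: AE_I2)

text \<open>The majorant alone carries integrability: a non-integrable \<open>f\<close> has integral
  0 by convention, and the integral of the a.e. nonnegative \<open>w\<close> dominates that
  too.\<close>

lemma norm_integral_le_AE:
  fixes f :: "'a \<Rightarrow> 'b::{banach,second_countable_topology}"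
  assumes "integrable M w" "AE x in M. norm (f x) \<le> w x"
  shows "norm (integral\<^sup>L M f) \<le> integral\<^sup>L M w"
proof (cases "integrable M f")
  case True
  have "norm (integral\<^sup>L M f) \<le> integral\<^sup>L M (\<lambda>x. norm (f x))" by simp
  also have "\<dots> \<le> integral\<^sup>L M w" using True assms by (intro integral_mono_AE) auto
  finally show ?thesis .
next
  case False
  have "AE x in M. 0 \<le> w x" using assms(2) by eventually_elim (meson norm_ge_zero order_trans)
  then have "0 \<le> integral\<^sup>L M w" by (rule integral_nonneg_AE)
  then show ?thesis using False by (simp add: not_integrable_integral_eq)
qed

lemma norm_primitive_diff_le:
  fixes v :: "real \<Rightarrow> 'b::{banach,second_countable_topology}"
  assumes v: "integrable (lebesgue_on {0..T}) v" and w: "integrable (lebesgue_on {0..T}) w"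
    and vw: "AE t in lebesgue_on {0..T}. norm (v t) \<le> w t" and ab: "0 \<le> a" "a \<le> b" "b \<le> T"
  shows "norm (integral\<^sup>L (lebesgue_on {0..b}) v - integral\<^sup>L (lebesgue_on {0..a}) v) \<le> integral\<^sup>L (lebesgue_on {a..b}) w"
proof -
  have vb: "integrable (lebesgue_on {0..b}) v"
    using integrable_lebesgue_on_subset[OF v, of "{0..b}"] ab by auto
  have "integral\<^sup>L (lebesgue_on {0..b}) v - integral\<^sup>L (lebesgue_on {0..a}) v = integral\<^sup>L (lebesgue_on {a..b}) v"
    using integral_lebesgue_on_split[OF vb, of a] ab by simp
  also have "norm \<dots> \<le> integral\<^sup>L (lebesgue_on {a..b}) w"
    using integrable_lebesgue_on_subset[OF w, of "{a..b}"] AE_lebesgue_on_subset[OF vw, of "{a..b}"] ab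
    by (intro norm_integral_le_AE) auto
  finally show ?thesis .
qed

section \<open>Absolute continuity and differentiation of the integral\<close>

text \<open>Split \<open>norm (w x)\<close> at height \<open>n\<close>: the excess has small
  integral over the whole space, and the part below \<open>n\<close> contributes at most
  \<open>n\<close> times the measure of \<open>A\<close>.\<close>

lemma integral_absolute_continuity:
  fixes w :: "'a \<Rightarrow> 'b::{banach,second_countable_topology}"
  assumes w: "integrable M w" and "0 < \<epsilon>"
  obtains \<delta> where "0 < \<delta>" "\<And>A. A \<in> sets M \<Longrightarrow> emeasure M A < ennreal \<delta> \<Longrightarrow> (\<integral>x. indicator A x * norm (w x) \<partial>M) < \<epsilon>"
proof -
  have "(\<lambda>n. \<integral>x. max (norm (w x) - real n) 0 \<partial>M) \<longlonglongrightarrow> (\<integral>x. 0 \<partial>M)"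
  proof (rule integral_dominated_convergence[where w="\<lambda>x. norm (w x)"])
    show "AE x in M. (\<lambda>n. max (norm (w x) - real n) 0) \<longlonglongrightarrow> 0"
    proof (rule AE_I2)
      fix x
      obtain N :: nat where "norm (w x) \<le> real N" using real_arch_simple by blast
      then have "\<forall>\<^sub>F n in sequentially. max (norm (w x) - real n) 0 = 0"
        by (intro eventually_sequentiallyI[of N]) auto
      then show "(\<lambda>n. max (norm (w x) - real n) 0) \<longlonglongrightarrow> 0" by (rule tendsto_eventually)
    qed
  qed (use w in auto)
  then have "\<forall>\<^sub>F n in sequentially. (\<integral>x. max (norm (w x) - real n) 0 \<partial>M) < \<epsilon> / 2"
    using assms(2) by (intro order_tendstoD(2)) auto
  then obtain n where n: "(\<integral>x. max (norm (w x) - real n) 0 \<partial>M) < \<epsilon> / 2"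
    by (auto simp: eventually_sequentially)
  have int: "integrable M (\<lambda>x. max (norm (w x) - real n) 0)"
    by (rule Bochner_Integration.integrable_bound[OF integrable_norm[OF w]]) (use w in auto)
  show thesis
  proof (rule that[of "\<epsilon> / (2 * (real n + 1))"])
    fix A assume A: "A \<in> sets M" "emeasure M A < ennreal (\<epsilon> / (2 * (real n + 1)))"
    then have Af: "emeasure M A < \<infinity>" by (simp add: order.strict_trans[OF A(2)])
    have mA: "measure M A < \<epsilon> / (2 * (real n + 1))"
      using A(2) Af assms(2) by (simp add: emeasure_eq_ennreal_measure ennreal_less_iff)
    have iA: "integrable M (\<lambda>x. real n * indicator A x)" using A(1) Af by simp
    have "(\<integral>x. indicator A x * norm (w x) \<partial>M) \<le> (\<integral>x. max (norm (w x) - real n) 0 + real n * indicator A x \<partial>M)"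
      using int iA w A integrable_mult_indicator[OF A(1) integrable_norm[OF w]]
      by (intro integral_mono) (auto simp: indicator_def)
    also have "\<dots> = (\<integral>x. max (norm (w x) - real n) 0 \<partial>M) + real n * measure M A"
      using int iA A by (subst Bochner_Integration.integral_add) auto
    also have "\<dots> < \<epsilon>/2 + (real n + 1) * (\<epsilon> / (2 * (real n + 1)))"
      using n mA by (intro add_less_le_mono mult_mono) auto
    also have "\<dots> = \<epsilon>" by (simp add: field_simps)
    finally show "(\<integral>x. indicator A x * norm (w x) \<partial>M) < \<epsilon>" .
  qed (use assms in auto)
qed

text \<open>An open set that exceeds \<open>A\<close> only slightly carries little of the integral
  of \<open>u\<close>. Exceptional points are centres of intervals inside it on which
  \<open>u\<close> has a large integral, and a disjoint Vitali subfamily bounds the total length by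
  the integral over the open set. The estimate is for outer measure, so measurability of the
  exceptional set never arises.\<close>

lemma averages_vanish_on_zero_set:
  fixes u :: "real \<Rightarrow> real"
  assumes u: "integrable lebesgue u" "\<And>x. 0 \<le> u x" and A: "A \<in> sets lebesgue" "\<And>x. x \<in> A \<Longrightarrow> u x = 0"
    and "0 < \<eta>"
  shows "negligible {t\<in>A. \<forall>\<delta>>0. \<exists>h. 0 < h \<and> h < \<delta> \<and> \<eta> * h < integral\<^sup>L (lebesgue_on {t-h..t+h}) u}" (is "negligible ?B")
  unfolding negligible_outer_le
proof (intro allI impI)
  fix e :: real assume "0 < e"
  \<comment> \<open>The 10 is the length of an interval of radius 1 after the fivefold enlargement
    in the Vitali lemma.\<close>
  then have "0 < e * \<eta> / 10" using assms by simp
  from integral_absolute_continuity[OF u(1) this] obtain \<delta> where \<delta>: "0 < \<delta>"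
    "\<And>A. A \<in> sets lebesgue \<Longrightarrow> emeasure lebesgue A < ennreal \<delta> \<Longrightarrow> (\<integral>x. indicator A x * norm (u x) \<partial>lebesgue) < e * \<eta> / 10"
    by blast
  obtain U where U: "open U" "A \<subseteq> U" "U - A \<in> lmeasurable" "emeasure lebesgue (U - A) < ennreal \<delta>"
    using sets_lebesgue_outer_open[OF A(1) \<delta>(1)] by blast
  have "(\<integral>x. indicator U x * u x \<partial>lebesgue) = (\<integral>x. indicator (U - A) x * norm (u x) \<partial>lebesgue)"
    using A(2) u(2) by (intro Bochner_Integration.integral_cong) (auto simp: indicator_def)
  also have "\<dots> < e * \<eta> / 10" using U by (intro \<delta>(2)) auto
  finally have IU: "(\<integral>x. indicator U x * u x \<partial>lebesgue) < e * \<eta> / 10" .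
  define K where "K = {(t, h). 0 < h \<and> h \<le> 1 \<and> cball t h \<subseteq> U \<and> \<eta> * h < integral\<^sup>L (lebesgue_on (cball t h)) u}"
  have BK: "?B \<subseteq> (\<Union>i\<in>K. cball (fst i) (snd i))"
  proof
    fix t assume t: "t \<in> ?B"
    then have "t \<in> U" using U by auto
    then obtain r where r: "0 < r" "ball t r \<subseteq> U" using U(1) by (meson openE)
    then have "0 < min r 1" by auto
    then obtain h where h: "0 < h" "h < min r 1" "\<eta> * h < integral\<^sup>L (lebesgue_on {t-h..t+h}) u"
      using t by blast
    then have "cball t h \<subseteq> U" using r by auto
    then have "(t, h) \<in> K" using h by (auto simp: K_def cball_eq_atLeastAtMost)
    then show "t \<in> (\<Union>i\<in>K. cball (fst i) (snd i))" using h by force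
  qed
  have Kr: "0 < snd i \<and> snd i \<le> 1" if "i \<in> K" for i using that by (auto simp: K_def)
  obtain C where C: "countable C" "C \<subseteq> K" "pairwise (\<lambda>i j. disjnt (cball (fst i) (snd i)) (cball (fst j) (snd j))) C"
     "?B \<subseteq> (\<Union>i\<in>C. cball (fst i) (5 * snd i))"
    by (rule Vitali_covering_lemma_cballs[OF BK Kr]) blast
  have fin: "measure lebesgue (\<Union>i\<in>F. cball (fst i) (5 * snd i)) \<le> e" if F: "F \<subseteq> C" "finite F" for F
  proof -
    have FK: "F \<subseteq> K" using F C by auto
    have "measure lebesgue (\<Union>i\<in>F. cball (fst i) (5 * snd i)) \<le> (\<Sum>i\<in>F. measure lebesgue (cball (fst i) (5 * snd i)))"
      using F by (intro measure_UNION_le) auto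
    also have "\<dots> = (\<Sum>i\<in>F. 10 * snd i)"
      using FK by (intro sum.cong) (auto simp: K_def cball_eq_atLeastAtMost)
    also have "\<dots> = 10 / \<eta> * (\<Sum>i\<in>F. \<eta> * snd i)" using assms by (simp add: sum_distrib_left)
    also have "(\<Sum>i\<in>F. \<eta> * snd i) \<le> (\<Sum>i\<in>F. \<integral>x. indicator (cball (fst i) (snd i)) x * u x \<partial>lebesgue)"
      using FK by (intro sum_mono) (auto simp: K_def integral_lebesgue_on_eq)
    also have "\<dots> = (\<integral>x. (\<Sum>i\<in>F. indicator (cball (fst i) (snd i)) x * u x) \<partial>lebesgue)"
      using u integrable_mult_indicator[OF _ u(1)] by (subst Bochner_Integration.integral_sum) auto
    also have "\<dots> \<le> (\<integral>x. indicator U x * u x \<partial>lebesgue)"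
    proof (rule integral_mono)
      show "integrable lebesgue (\<lambda>x. \<Sum>i\<in>F. indicator (cball (fst i) (snd i)) x * u x)"
        using integrable_mult_indicator[OF _ u(1)] by (intro Bochner_Integration.integrable_sum) auto
      show "integrable lebesgue (\<lambda>x. indicator U x * u x)"
        using integrable_mult_indicator[OF _ u(1), of U] U(1) by auto
      fix x
      have "disjoint_family_on (\<lambda>i. cball (fst i) (snd i)) F"
        using C(3) F unfolding disjoint_family_on_def pairwise_def disjnt_def by blast
      then have "(\<Sum>i\<in>F. indicator (cball (fst i) (snd i)) x * u x) = indicator (\<Union>i\<in>F. cball (fst i) (snd i)) x * u x"
        using F by (simp add: indicator_UN_disjoint sum_distrib_right)
      also have "\<dots> \<le> indicator U x * u x"
      proof -
        have "cball (fst i) (snd i) \<subseteq> U" if "i \<in> F" for i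
          using subsetD[OF FK that] by (simp add: K_def case_prod_beta)
        then have "(\<Union>i\<in>F. cball (fst i) (snd i)) \<subseteq> U" by blast
        moreover have "indicator W x * u x \<le> indicator U x * u x" if "W \<subseteq> U" for W
          using that u(2) by (intro mult_right_mono) (auto simp: indicator_def)
        ultimately show ?thesis by blast
      qed
      finally show "(\<Sum>i\<in>F. indicator (cball (fst i) (snd i)) x * u x) \<le> indicator U x * u x" .
    qed
    also have "10 / \<eta> * (\<integral>x. indicator U x * u x \<partial>lebesgue) \<le> 10 / \<eta> * (e * \<eta> / 10)"
      using IU assms by (intro mult_left_mono) auto
    also have "\<dots> = e" using assms by simp
    finally show ?thesis using assms by (simp add: divide_right_mono)
  qed
  show "\<exists>T. ?B \<subseteq> T \<and> T \<in> lmeasurable \<and> measure lebesgue T \<le> e"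
  proof (intro exI conjI)
    show "?B \<subseteq> (\<Union>i\<in>C. cball (fst i) (5 * snd i))" by (rule C(4))
    show "(\<Union>i\<in>C. cball (fst i) (5 * snd i)) \<in> lmeasurable"
      by (rule fmeasurable_UN_bound[OF C(1) _ fin]) auto
    show "measure lebesgue (\<Union>i\<in>C. cball (fst i) (5 * snd i)) \<le> e"
      by (rule measure_UN_bound[OF C(1) _ fin]) auto
  qed
qed

text \<open>Approximating \<open>v t\<close> by points \<open>q\<close> of a countable dense set at
  countably many scales leaves only countably many exceptional sets. The excess of
  \<open>norm (v x - q)\<close> over the scale vanishes on \<open>A q n\<close>, so the preceding
  lemma applies to it.\<close>

lemma lebesgue_points:
  fixes v :: "real \<Rightarrow> 'b::{banach,second_countable_topology}"
  assumes v: "integrable lebesgue v"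
  shows "AE t in lebesgue. t \<in> {a<..<b} \<longrightarrow>
    (\<forall>\<epsilon>>0. \<exists>\<delta>>0. \<forall>h. 0 < h \<and> h < \<delta> \<longrightarrow> integral\<^sup>L (lebesgue_on {t-h..t+h}) (\<lambda>x. norm (v x - v t)) \<le> \<epsilon> * h)"
proof -
  obtain Y :: "'b set" where Y: "countable Y" "\<And>X. open X \<Longrightarrow> X \<noteq> {} \<Longrightarrow> \<exists>d\<in>Y. d \<in> X"
    by (erule countable_dense_setE)
  have [measurable]: "v \<in> borel_measurable lebesgue" using v by auto
  define \<rho> where "\<rho> n = 1 / real (Suc n)" for n
  have \<rho>: "0 < \<rho> n" for n by (simp add: \<rho>_def)
  define A where "A q n = {t\<in>{a<..<b}. norm (v t - q) \<le> \<rho> n}" for q n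
  define u where "u q n x = indicator {a<..<b} x * max (norm (v x - q) - \<rho> n) 0" for q n x
  have ab: "integrable lebesgue (indicator {a<..<b} :: real \<Rightarrow> real)"
    by (rule integrable_real_indicator) (use emeasure_bounded_finite[of "{a<..<b}"] in auto)
  have uint: "integrable lebesgue (u q n)" for q n
  proof (rule Bochner_Integration.integrable_bound[of lebesgue "\<lambda>x. norm (v x) + norm q * indicator {a<..<b} x"])
    show "integrable lebesgue (\<lambda>x. norm (v x) + norm q * indicator {a<..<b} x)"
      using v ab by auto
    have "(\<lambda>x. max (norm (v x - q) - \<rho> n) 0) \<in> borel_measurable lebesgue"
      by (intro borel_measurable_max borel_measurable_diff borel_measurable_norm) auto
    moreover have "(indicator {a<..<b} :: real \<Rightarrow> real) \<in> borel_measurable lebesgue" using ab by blast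
    ultimately show "u q n \<in> borel_measurable lebesgue" unfolding u_def by (intro borel_measurable_times)
    show "AE x in lebesgue. norm (u q n x) \<le> norm (norm (v x) + norm q * indicator {a<..<b} x)"
    proof (rule AE_I2)
      fix x
      have "norm (v x - q) \<le> norm (v x) + norm q" by (rule norm_triangle_ineq4)
      then show "norm (u q n x) \<le> norm (norm (v x) + norm q * indicator {a<..<b} x)"
        using \<rho>[of n] by (auto simp: u_def indicator_def)
    qed
  qed
  define B where "B q n = {t\<in>A q n. \<forall>\<delta>>0. \<exists>h. 0 < h \<and> h < \<delta> \<and> \<rho> n * h < integral\<^sup>L (lebesgue_on {t-h..t+h}) (u q n)}" for q n
  have "negligible (B q n)" for q n
    unfolding B_def
  proof (rule averages_vanish_on_zero_set[OF uint])
    have "{t\<in>space lebesgue. norm (v t - q) \<le> \<rho> n} \<in> sets lebesgue"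
      by (intro borel_measurable_le borel_measurable_norm borel_measurable_diff) auto
    then have "{a<..<b} \<inter> {t\<in>space lebesgue. norm (v t - q) \<le> \<rho> n} \<in> sets lebesgue" by (intro sets.Int) auto
    moreover have "A q n = {a<..<b} \<inter> {t\<in>space lebesgue. norm (v t - q) \<le> \<rho> n}" by (auto simp: A_def)
    ultimately show "A q n \<in> sets lebesgue" by simp
  qed (auto simp: u_def A_def \<rho>)
  then have "AE t in lebesgue. t \<notin> B q n" for q n
    by (simp add: negligible_iff_null_sets AE_not_in)
  then have "AE t in lebesgue. \<forall>n. \<forall>q\<in>Y. t \<notin> B q n"
    by (simp add: AE_all_countable AE_ball_countable[OF Y(1)])
  then show ?thesis
  proof eventually_elim
    case (elim t)
    show ?case
    proof (intro impI allI)
      fix \<epsilon> :: real assume t: "t \<in> {a<..<b}" and "0 < \<epsilon>"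
      \<comment> \<open>Of the five units of \<open>\<rho> n * h\<close>, one bounds the integral of
        \<open>u q n\<close> and four come from the constant \<open>2 * \<rho> n\<close> on an
        interval of length \<open>2 * h\<close>.\<close>
      obtain n where n: "\<rho> n < \<epsilon> / 5" using \<open>0 < \<epsilon>\<close> nat_approx_posE[of "\<epsilon> / 5"] by (auto simp: \<rho>_def)
      obtain q where q: "q \<in> Y" "q \<in> ball (v t) (\<rho> n)" using Y(2)[of "ball (v t) (\<rho> n)"] \<rho>[of n] by auto
      then have tA: "t \<in> A q n" using t by (auto simp: A_def dist_norm)
      have "t \<notin> B q n" using elim q by blast
      then obtain \<delta> where \<delta>: "0 < \<delta>" "\<And>h. 0 < h \<Longrightarrow> h < \<delta> \<Longrightarrow> integral\<^sup>L (lebesgue_on {t-h..t+h}) (u q n) \<le> \<rho> n * h"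
        using tA unfolding B_def mem_Collect_eq by (meson not_le)
      define \<delta>' where "\<delta>' = Min {\<delta>, t - a, b - t}"
      have \<delta>': "0 < \<delta>'" "\<delta>' \<le> \<delta>" "\<delta>' \<le> t - a" "\<delta>' \<le> b - t" using \<delta>(1) t by (auto simp: \<delta>'_def)
      have "integral\<^sup>L (lebesgue_on {t-h..t+h}) (\<lambda>x. norm (v x - v t)) \<le> \<epsilon> * h" if h: "0 < h" "h < \<delta>'" for h
      proof -
        have int1: "integrable (lebesgue_on {t-h..t+h}) (u q n)" "integrable (lebesgue_on {t-h..t+h}) v"
          using integrable_mult_indicator[OF _ uint] integrable_mult_indicator[OF _ v]
          by (auto simp: integrable_lebesgue_on_iff)
        have int2: "integrable (lebesgue_on {t-h..t+h}) (\<lambda>x. 2 * \<rho> n)" by simp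
        have "integral\<^sup>L (lebesgue_on {t-h..t+h}) (\<lambda>x. norm (v x - v t)) \<le>
            integral\<^sup>L (lebesgue_on {t-h..t+h}) (\<lambda>x. u q n x + 2 * \<rho> n)"
        proof (rule integral_mono)
          show "integrable (lebesgue_on {t-h..t+h}) (\<lambda>x. norm (v x - v t))"
            using int1(2) by (intro integrable_norm Bochner_Integration.integrable_diff) (auto simp: integrable_const_ivl)
          show "integrable (lebesgue_on {t-h..t+h}) (\<lambda>x. u q n x + 2 * \<rho> n)"
            using int1 int2 by (intro Bochner_Integration.integrable_add)
          fix x assume "x \<in> space (lebesgue_on {t-h..t+h})"
          then have "x \<in> {a<..<b}" using h \<delta>' by auto
          moreover have "norm (v x - v t) \<le> norm (v x - q) + norm (q - v t)"
            by (metis diff_add_cancel norm_triangle_ineq add_diff_eq)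
          moreover have "norm (q - v t) < \<rho> n" using q by (auto simp: dist_norm norm_minus_commute)
          ultimately show "norm (v x - v t) \<le> u q n x + 2 * \<rho> n" by (auto simp: u_def)
        qed
        also have "\<dots> = integral\<^sup>L (lebesgue_on {t-h..t+h}) (u q n) + 4 * \<rho> n * h"
          using int1(1) int2 h by (subst Bochner_Integration.integral_add) (auto simp: measure_restrict_space)
        also have "\<dots> \<le> 5 * \<rho> n * h" using \<delta>(2)[of h] h \<delta>' by (auto simp: mult.commute)
        also have "\<dots> \<le> \<epsilon> * h" using n h by (intro mult_right_mono) auto
        finally show ?thesis .
      qed
      then show "\<exists>\<delta>>0. \<forall>h. 0 < h \<and> h < \<delta> \<longrightarrow> integral\<^sup>L (lebesgue_on {t-h..t+h}) (\<lambda>x. norm (v x - v t)) \<le> \<epsilon> * h"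
        using \<delta>'(1) by blast
    qed
  qed
qed

text \<open>At a Lebesgue point the increment over a subinterval of \<open>{t-h..t+h}\<close>
  differs from the linear one by at most the integral of \<open>norm (V x - V t)\<close> over the
  symmetric interval. Extension by zero makes the result for the whole line applicable.\<close>

theorem primitive_has_vector_derivative_AE:
  fixes v :: "real \<Rightarrow> 'b::{banach,second_countable_topology}"
  assumes v: "integrable (lebesgue_on {0..T}) v"
  shows "AE t in lebesgue. t \<in> {0..T} \<longrightarrow>
    ((\<lambda>t. x0 + integral\<^sup>L (lebesgue_on {0..t}) v) has_vector_derivative v t) (at t within {0..T})"
proof -
  define V where "V x = indicator {0..T} x *\<^sub>R v x" for x
  have V: "integrable lebesgue V" using v unfolding V_def by (simp add: integrable_lebesgue_on_iff)
  \<comment> \<open>Inside the interval a small symmetric interval around \<open>t\<close> fits,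
    which fails at the endpoints.\<close>
  have "AE t in lebesgue. t \<noteq> 0 \<and> t \<noteq> T"
    by (rule AE_I'[of "{0, T}"]) auto
  with lebesgue_points[OF V, of 0 T] show ?thesis
  proof eventually_elim
    case (elim t)
    show ?case
    proof
      assume "t \<in> {0..T}"
      then have t: "0 < t" "t < T" using elim by auto
      let ?x = "\<lambda>t. x0 + integral\<^sup>L (lebesgue_on {0..t}) v"
      show "(?x has_vector_derivative v t) (at t within {0..T})"
        unfolding has_vector_derivative_def has_derivative_within_alt
      proof (intro conjI allI impI)
        show "bounded_linear (\<lambda>h. h *\<^sub>R v t)" by (rule bounded_linear_scaleR_left)
        fix e :: real assume "0 < e"
        then obtain \<delta> where \<delta>: "0 < \<delta>"
          "\<And>h. 0 < h \<Longrightarrow> h < \<delta> \<Longrightarrow> integral\<^sup>L (lebesgue_on {t-h..t+h}) (\<lambda>x. norm (V x - V t)) \<le> e * h"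
          using elim t by auto
        define \<delta>' where "\<delta>' = Min {\<delta>, t, T - t}"
        have \<delta>': "0 < \<delta>'" "\<delta>' \<le> \<delta>" "\<delta>' \<le> t" "\<delta>' \<le> T - t" using \<delta>(1) t by (auto simp: \<delta>'_def)
        \<comment> \<open>Stated for an ordered pair, so that one estimate serves increments on
          either side of \<open>t\<close>.\<close>
        have diff: "norm (?x q - ?x p - (q - p) *\<^sub>R v t) \<le> e * h"
          if "p \<le> q" "{p..q} \<subseteq> {t-h..t+h}" "0 < h" "h < \<delta>'" "p \<in> {0..T}" "q \<in> {0..T}" for p q h
        proof -
          have vq: "integrable (lebesgue_on {0..q}) v" "integrable (lebesgue_on {p..q}) v"
            using integrable_lebesgue_on_subset[OF v, of "{0..q}"] integrable_lebesgue_on_subset[OF v, of "{p..q}"] that by auto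
          have pq: "0 \<le> p" "p \<le> q" using that by auto
          have Vi: "integrable (lebesgue_on {t-h..t+h}) (\<lambda>x. norm (V x - V t))"
            using integrable_mult_indicator[OF _ V, of "{t-h..t+h}"]
            by (intro integrable_norm Bochner_Integration.integrable_diff) (auto simp: integrable_lebesgue_on_iff integrable_const_ivl)
          have "?x q - ?x p = integral\<^sup>L (lebesgue_on {p..q}) v"
            using integral_lebesgue_on_split[OF vq(1) pq] by simp
          moreover have "integral\<^sup>L (lebesgue_on {p..q}) (\<lambda>x. v x - v t) = integral\<^sup>L (lebesgue_on {p..q}) v - (q - p) *\<^sub>R v t"
            using vq pq by (subst Bochner_Integration.integral_diff) (auto simp: measure_restrict_space)
          ultimately have "?x q - ?x p - (q - p) *\<^sub>R v t = integral\<^sup>L (lebesgue_on {p..q}) (\<lambda>x. v x - v t)"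
            by simp
          also have "norm \<dots> \<le> integral\<^sup>L (lebesgue_on {p..q}) (\<lambda>x. norm (V x - V t))"
          proof (rule norm_integral_le_AE)
            show "integrable (lebesgue_on {p..q}) (\<lambda>x. norm (V x - V t))"
              using that by (intro integrable_lebesgue_on_subset[OF Vi]) auto
            show "AE x in lebesgue_on {p..q}. norm (v x - v t) \<le> norm (V x - V t)"
              using that t by (intro AE_I2) (auto simp: V_def)
          qed
          also have "\<dots> \<le> integral\<^sup>L (lebesgue_on {t-h..t+h}) (\<lambda>x. norm (V x - V t))"
            using that by (intro integral_lebesgue_on_mono_set[OF Vi]) auto
          also have "\<dots> \<le> e * h" using that \<delta>' by (intro \<delta>(2)) auto
          finally show ?thesis .
        qed
        have "norm (?x y - ?x t - (y - t) *\<^sub>R v t) \<le> e * norm (y - t)" if y: "y \<in> {0..T}" "norm (y - t) < \<delta>'" for y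
        proof (cases "y = t")
          case False
          show ?thesis
          proof (cases "t < y")
            case True
            then have "norm (?x y - ?x t - (y - t) *\<^sub>R v t) \<le> e * (y - t)"
              using y t by (intro diff) auto
            then show ?thesis using True by simp
          next
            case False
            then have "norm (?x t - ?x y - (t - y) *\<^sub>R v t) \<le> e * (t - y)"
              using y t \<open>y \<noteq> t\<close> by (intro diff) auto
            moreover have "?x y - ?x t - (y - t) *\<^sub>R v t = - (?x t - ?x y - (t - y) *\<^sub>R v t)"
              by (simp add: algebra_simps)
            moreover have "norm (y - t) = t - y" using False by simp
            ultimately show ?thesis by (simp only: norm_minus_cancel)
          qed
        qed auto
        then show "\<exists>d>0. \<forall>y\<in>{0..T}. norm (y - t) < d \<longrightarrow> norm (?x y - ?x t - (y - t) *\<^sub>R v t) \<le> e * norm (y - t)"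
          using \<delta>'(1) by blast
      qed
    qed
  qed
qed

lemma primitive_abs_continuous:
  fixes v :: "real \<Rightarrow> 'b::{banach,second_countable_topology}"
  assumes v: "integrable (lebesgue_on {0..T}) v"
  shows "abs_continuous_on 0 T (\<lambda>t. x0 + integral\<^sup>L (lebesgue_on {0..t}) v)" (is "abs_continuous_on 0 T ?x")
  unfolding abs_continuous_on_def
proof (intro allI impI)
  fix \<epsilon> :: real assume "0 < \<epsilon>"
  define V where "V x = indicator {0..T} x *\<^sub>R v x" for x
  have V: "integrable lebesgue V" using v unfolding V_def by (simp add: integrable_lebesgue_on_iff)
  from integral_absolute_continuity[OF V \<open>0 < \<epsilon>\<close>] obtain \<delta> where \<delta>: "0 < \<delta>"
    "\<And>A. A \<in> sets lebesgue \<Longrightarrow> emeasure lebesgue A < ennreal \<delta> \<Longrightarrow> (\<integral>x. indicator A x * norm (V x) \<partial>lebesgue) < \<epsilon>"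
    by blast
  have key: "(\<Sum>i<n. norm (?x (u i) - ?x (l i))) < \<epsilon>"
    if 1: "\<And>i. i < n \<Longrightarrow> 0 \<le> l i \<and> l i \<le> u i \<and> u i \<le> T"
      and 2: "\<And>i j. i < n \<Longrightarrow> j < n \<Longrightarrow> i \<noteq> j \<Longrightarrow> u i \<le> l j \<or> u j \<le> l i"
      and 3: "(\<Sum>i<n. u i - l i) < \<delta>" for n and l u :: "nat \<Rightarrow> real"
  proof -
    \<comment> \<open>Left-open intervals make neighbours with a common endpoint disjoint, so that
      their indicators add up to the indicator of the union.\<close>
    have iV: "integrable lebesgue (\<lambda>x. indicator {p<..q} x * norm (V x))" for p q :: real
      using integrable_mult_indicator[OF _ integrable_norm[OF V], of "{p<..q}"] by simp
    have "norm (?x (u i) - ?x (l i)) \<le> (\<integral>x. indicator {l i<..u i} x * norm (V x) \<partial>lebesgue)" if "i < n" for i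
    proof -
      have "norm (?x (u i) - ?x (l i)) \<le> integral\<^sup>L (lebesgue_on {l i..u i}) (\<lambda>x. norm (v x))"
        using norm_primitive_diff_le[OF v integrable_norm[OF v], of "l i" "u i"] 1[OF that] by auto
      also have "\<dots> = (\<integral>x. indicator {l i..u i} x * norm (v x) \<partial>lebesgue)" by (simp add: integral_lebesgue_on_eq)
      also have "\<dots> = (\<integral>x. indicator {l i<..u i} x * norm (V x) \<partial>lebesgue)"
      proof (rule integral_cong_AE)
        have "integrable (lebesgue_on {l i..u i}) (\<lambda>x. norm (v x))"
          using 1[OF that] by (intro integrable_norm integrable_lebesgue_on_subset[OF v]) auto
        then show "(\<lambda>x. indicator {l i..u i} x * norm (v x)) \<in> borel_measurable lebesgue"
          by (simp add: integrable_lebesgue_on_iff borel_measurable_integrable)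
        show "AE x in lebesgue. indicator {l i..u i} x * norm (v x) = indicator {l i<..u i} x * norm (V x)"
          by (rule AE_I'[of "{l i}"]) (use 1[OF that] in \<open>auto simp: indicator_def V_def\<close>)
      qed (use iV in auto)
      finally show ?thesis .
    qed
    then have "(\<Sum>i<n. norm (?x (u i) - ?x (l i))) \<le> (\<Sum>i<n. \<integral>x. indicator {l i<..u i} x * norm (V x) \<partial>lebesgue)"
      by (intro sum_mono) auto
    also have "\<dots> = (\<integral>x. (\<Sum>i<n. indicator {l i<..u i} x * norm (V x)) \<partial>lebesgue)"
      using iV by (subst Bochner_Integration.integral_sum) auto
    also have "\<dots> = (\<integral>x. indicator (\<Union>i<n. {l i<..u i}) x * norm (V x) \<partial>lebesgue)"
    proof (rule Bochner_Integration.integral_cong)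
      fix x
      have "disjoint_family_on (\<lambda>i. {l i<..u i}) {..<n}"
        unfolding disjoint_family_on_def
      proof (intro ballI impI)
        fix i j assume "i \<in> {..<n}" "j \<in> {..<n}" "i \<noteq> j"
        then show "{l i<..u i} \<inter> {l j<..u j} = {}" using 2[of i j] by auto
      qed
      then show "(\<Sum>i<n. indicator {l i<..u i} x * norm (V x)) = indicator (\<Union>i<n. {l i<..u i}) x * norm (V x)"
        by (simp add: indicator_UN_disjoint sum_distrib_right)
    qed auto
    also have "\<dots> < \<epsilon>"
    proof (rule \<delta>(2))
      have "emeasure lebesgue (\<Union>i<n. {l i<..u i}) \<le> (\<Sum>i<n. emeasure lebesgue {l i<..u i})"
        by (intro emeasure_subadditive_finite) auto
      also have "\<dots> = (\<Sum>i<n. ennreal (u i - l i))" using 1 by (intro sum.cong) auto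
      also have "\<dots> = ennreal (\<Sum>i<n. u i - l i)" using 1 by (intro sum_ennreal) auto
      also have "\<dots> < ennreal \<delta>" using 3 \<delta>(1) by (intro ennreal_lessI) auto
      finally show "emeasure lebesgue (\<Union>i<n. {l i<..u i}) < ennreal \<delta>" .
    qed auto
    finally show ?thesis .
  qed
  show "\<exists>\<delta>>0. \<forall>(n::nat) (l::nat \<Rightarrow> real) (u::nat \<Rightarrow> real). (\<forall>i<n. 0 \<le> l i \<and> l i \<le> u i \<and> u i \<le> T) \<and>
      (\<forall>i<n. \<forall>j<n. i \<noteq> j \<longrightarrow> u i \<le> l j \<or> u j \<le> l i) \<and> (\<Sum>i<n. u i - l i) < \<delta> \<longrightarrow>
      (\<Sum>i<n. norm (?x (u i) - ?x (l i))) < \<epsilon>"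
  proof (intro exI[of _ \<delta>] conjI allI impI \<delta>(1))
    fix n and l u :: "nat \<Rightarrow> real"
    assume *: "(\<forall>i<n. 0 \<le> l i \<and> l i \<le> u i \<and> u i \<le> T) \<and>
      (\<forall>i<n. \<forall>j<n. i \<noteq> j \<longrightarrow> u i \<le> l j \<or> u j \<le> l i) \<and> (\<Sum>i<n. u i - l i) < \<delta>"
    show "(\<Sum>i<n. norm (?x (u i) - ?x (l i))) < \<epsilon>"
      by (rule key) (use * in auto)
  qed
qed

section \<open>Integration over a triangle\<close>

text \<open>Fubini is applied to the product of two copies of \<open>lborel\<close>, whereas
  \<open>lebesgue\<close> on the plane is the completion of that product. A Borel representative
  bridges the two.\<close>

lemma completion_ex_borel_measurable_banach:
  fixes f :: "'a \<Rightarrow> 'b::{banach,second_countable_topology}"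
  assumes "f \<in> borel_measurable (completion M)"
  obtains f' where "f' \<in> borel_measurable M" "AE x in M. f x = f' x"
proof -
  from borel_measurable_implies_sequence_metric[OF assms, of 0] obtain s where
    s: "\<And>i. simple_function (completion M) (s i)" "\<And>x. x \<in> space M \<Longrightarrow> (\<lambda>i. s i x) \<longlonglongrightarrow> f x"
    by auto
  from s(1)[THEN completion_ex_simple_function] obtain s' where
    s': "\<And>i. simple_function M (s' i)" "\<And>i. AE x in M. s i x = s' i x" by metis
  show thesis
  proof (rule that[of "\<lambda>x. lim (\<lambda>i. s' i x)"])
    show "(\<lambda>x. lim (\<lambda>i. s' i x)) \<in> borel_measurable M"
      using s'(1) by (intro borel_measurable_lim_metric borel_measurable_simple_function)
    have "AE x in M. \<forall>i. s i x = s' i x" using s'(2) by (simp add: AE_all_countable)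
    with AE_space show "AE x in M. f x = lim (\<lambda>i. s' i x)"
    proof eventually_elim
      case (elim x)
      then have "(\<lambda>i. s' i x) \<longlonglongrightarrow> f x" using s(2)[of x] by simp
      then show ?case by (simp add: limI)
    qed
  qed
qed

lemma measurable_completion_cong_AE:
  assumes f: "f \<in> measurable (completion M) N" and "AE x in completion M. f x = g x"
    and "\<And>x. x \<in> space M \<Longrightarrow> g x \<in> space N"
  shows "g \<in> measurable (completion M) N"
proof (rule measurableI)
  fix A assume A: "A \<in> sets N"
  show "g -` A \<inter> space (completion M) \<in> sets (completion M)"
  proof (rule completion.in_sets_AE)
    show "AE x in completion M. (x \<in> f -` A \<inter> space (completion M)) = (x \<in> g -` A \<inter> space (completion M))"
      using assms(2) by eventually_elim auto
  qed (use measurable_sets[OF f A] in auto)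
qed (use assms in auto)

lemma lebesgue_AE_eq_borel:
  fixes f f' :: "real \<Rightarrow> 'b::{banach,second_countable_topology}"
  assumes f': "f' \<in> borel_measurable borel" and eq: "AE x in lborel. f x = f' x"
  shows "integrable lebesgue f \<longleftrightarrow> integrable lborel f'" "integral\<^sup>L lebesgue f = integral\<^sup>L lborel f'"
proof -
  have eq': "AE x in lebesgue. f x = f' x" using eq by (rule AE_completion)
  have m': "f' \<in> borel_measurable lebesgue" using f' by (simp add: measurable_completion)
  have m: "f \<in> borel_measurable lebesgue"
  proof (rule measurable_completion_cong_AE[OF m'])
    show "AE x in lebesgue. f' x = f x" using eq' by eventually_elim simp
  qed simp
  show "integrable lebesgue f \<longleftrightarrow> integrable lborel f'"
    using integrable_cong_AE[OF m m' eq'] integrable_completion[of f' lborel] f' by simp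
  show "integral\<^sup>L lebesgue f = integral\<^sup>L lborel f'"
    using integral_cong_AE[OF m m' eq'] integral_completion[of f' lborel] f' by simp
qed

text \<open>A section of a Lebesgue measurable function on the plane is known to be Lebesgue
  measurable only for almost every \<open>t\<close>. The sections are therefore taken of the Borel
  representative, and the result is carried back along the a.e. equality of the sections.\<close>

lemma lebesgue_Fubini:
  fixes u :: "real \<times> real \<Rightarrow> 'b::{banach,second_countable_topology}"
  assumes u: "integrable lebesgue u"
  shows "AE t in lebesgue. integrable lebesgue (\<lambda>s. u (t, s))"
    and "integrable lebesgue (\<lambda>t. integral\<^sup>L lebesgue (\<lambda>s. u (t, s)))"
proof -
  obtain u' where u': "u' \<in> borel_measurable lborel" and eq: "AE z in lborel. u z = u' z"
    using completion_ex_borel_measurable_banach[OF borel_measurable_integrable[OF u]] by blast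
  have [measurable]: "u' \<in> borel_measurable borel" using u' by simp
  have m': "u' \<in> borel_measurable lebesgue" using u' by (rule measurable_completion)
  have "integrable lebesgue u'"
    using integrable_cong_AE[OF borel_measurable_integrable[OF u] m' AE_completion[OF eq]] u by simp
  then have "integrable lborel u'" using integrable_completion[OF u'] by simp
  then have int: "integrable (lborel \<Otimes>\<^sub>M lborel) (u' :: real \<times> real \<Rightarrow> 'b)" by (simp add: lborel_prod)
  have "AE z in lborel \<Otimes>\<^sub>M lborel. u z = u' z" by (subst lborel_prod) (rule eq)
  then have eq2: "AE t in lborel. AE s in lborel. u (t, s) = u' (t, s)" by (rule lborel_pair.AE_pair)
  have sec: "(\<lambda>s. u' (t, s)) \<in> borel_measurable borel" for t by measurable
  have "AE t in lborel. integrable lborel (\<lambda>s. u' (t, s))" by (rule lborel_pair.AE_integrable_fst'[OF int])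
  with eq2 have "AE t in lborel. integrable lebesgue (\<lambda>s. u (t, s))"
    by eventually_elim (simp add: lebesgue_AE_eq_borel[OF sec])
  then show "AE t in lebesgue. integrable lebesgue (\<lambda>s. u (t, s))" by (rule AE_completion)
  have int2: "integrable lborel (\<lambda>t. integral\<^sup>L lborel (\<lambda>s. u' (t, s)))" by (rule lborel_pair.integrable_fst'[OF int])
  have "AE t in lborel. integral\<^sup>L lebesgue (\<lambda>s. u (t, s)) = integral\<^sup>L lborel (\<lambda>s. u' (t, s))"
    using eq2 by eventually_elim (simp add: lebesgue_AE_eq_borel[OF sec])
  then show "integrable lebesgue (\<lambda>t. integral\<^sup>L lebesgue (\<lambda>s. u (t, s)))"
    using int2 borel_measurable_integrable[OF int2] by (subst lebesgue_AE_eq_borel(1)) auto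
qed

lemma triangle_in_sets_lebesgue:
  "{(t, s). t \<in> {0..T} \<and> s \<in> {0..T} \<and> s \<le> t} \<in> sets (lebesgue :: (real \<times> real) measure)"
proof -
  have "closed {z :: real \<times> real. 0 \<le> fst z \<and> fst z \<le> T \<and> 0 \<le> snd z \<and> snd z \<le> T \<and> snd z \<le> fst z}"
    by (intro closed_Collect_conj closed_Collect_le continuous_intros)
  moreover have "{(t, s). t \<in> {0..T} \<and> s \<in> {0..T} \<and> s \<le> t} =
      {z. 0 \<le> fst z \<and> fst z \<le> T \<and> 0 \<le> snd z \<and> snd z \<le> T \<and> snd z \<le> fst z}"
    by auto
  ultimately show ?thesis by (auto intro: lebesgue_closedin)
qed

lemma triangle_Fubini:
  fixes u :: "real \<Rightarrow> real \<Rightarrow> 'b::{banach,second_countable_topology}" and T :: real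
  defines "D \<equiv> {(t, s). t \<in> {0..T} \<and> s \<in> {0..T} \<and> s \<le> t}"
  assumes u: "integrable (lebesgue_on D) (\<lambda>(t, s). u t s)"
  shows "AE t in lebesgue_on {0..T}. integrable (lebesgue_on {0..t}) (u t)"
    and "integrable (lebesgue_on {0..T}) (\<lambda>t. integral\<^sup>L (lebesgue_on {0..t}) (u t))"
proof -
  have D: "D \<in> sets lebesgue" unfolding D_def by (rule triangle_in_sets_lebesgue)
  let ?U = "\<lambda>z. indicator D z *\<^sub>R (case z of (t, s) \<Rightarrow> u t s)"
  have U: "integrable lebesgue ?U" using u D by (simp add: integrable_lebesgue_on_iff)
  have sec: "?U (t, s) = indicator {0..t} s *\<^sub>R u t s" if "t \<in> {0..T}" for t s
    using that by (auto simp: D_def indicator_def)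
  show "AE t in lebesgue_on {0..T}. integrable (lebesgue_on {0..t}) (u t)"
  proof -
    have "AE t in lebesgue. t \<in> {0..T} \<longrightarrow> integrable (lebesgue_on {0..t}) (u t)"
      using lebesgue_Fubini(1)[OF U]
    proof eventually_elim
      case (elim t)
      show ?case
      proof
        assume "t \<in> {0..T}"
        then show "integrable (lebesgue_on {0..t}) (u t)"
          using elim by (simp only: sec integrable_lebesgue_on_iff lmeasurable_interval fmeasurableD)
      qed
    qed
    then show ?thesis by (simp add: AE_restrict_space_iff)
  qed
  have "integrable lebesgue (\<lambda>t. indicator {0..T} t *\<^sub>R integral\<^sup>L lebesgue (\<lambda>s. ?U (t, s)))"
    using lebesgue_Fubini(2)[OF U] by (intro integrable_mult_indicator) auto
  also have "(\<lambda>t. indicator {0..T} t *\<^sub>R integral\<^sup>L lebesgue (\<lambda>s. ?U (t, s))) =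
      (\<lambda>t. indicator {0..T} t *\<^sub>R integral\<^sup>L (lebesgue_on {0..t}) (u t))"
  proof
    fix t show "indicator {0..T} t *\<^sub>R integral\<^sup>L lebesgue (\<lambda>s. ?U (t, s)) = indicator {0..T} t *\<^sub>R integral\<^sup>L (lebesgue_on {0..t}) (u t)"
    proof (cases "t \<in> {0..T}")
      case True
      then show ?thesis by (simp only: sec integral_lebesgue_on_eq lmeasurable_interval fmeasurableD)
    qed simp
  qed
  finally show "integrable (lebesgue_on {0..T}) (\<lambda>t. integral\<^sup>L (lebesgue_on {0..t}) (u t))"
    by (simp add: integrable_lebesgue_on_iff)
qed

section \<open>Convex combinations of integrably bounded sequences\<close>

text \<open>A dyadic substitute for the convex hull of the tail from \<open>n\<close> on: the
  parallelogram law needs only midpoints, and whatever passes to midpoints follows by rule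
  induction.\<close>

inductive_set midpoints :: "(nat \<Rightarrow> 'b \<Rightarrow> 'a::real_vector) \<Rightarrow> nat \<Rightarrow> ('b \<Rightarrow> 'a) set"
  for f n where
  base: "n \<le> k \<Longrightarrow> f k \<in> midpoints f n"
| mid: "u \<in> midpoints f n \<Longrightarrow> v \<in> midpoints f n \<Longrightarrow> (\<lambda>t. (1/2) *\<^sub>R u t + (1/2) *\<^sub>R v t) \<in> midpoints f n"

lemma midpoints_antimono:
  assumes "u \<in> midpoints f n" "m \<le> n" shows "u \<in> midpoints f m"
  using assms by induction (auto intro: midpoints.intros)

lemma midpoints_in_convex:
  assumes "u \<in> midpoints f n" "convex W" "\<And>k. n \<le> k \<Longrightarrow> f k t \<in> W"
  shows "u t \<in> W"
  using assms(1)
proof induction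
  case (mid u v)
  then show ?case using assms(2) by (intro convexD) auto
qed (use assms in auto)

text \<open>With a ball as \<open>W\<close> this carries the limit of the integrals over to the
  combinations; with \<open>UNIV\<close> it yields integrability.\<close>

lemma midpoints_integral_in_convex:
  fixes f :: "nat \<Rightarrow> 'b \<Rightarrow> 'a::{banach,second_countable_topology}"
  assumes "u \<in> midpoints f n" "convex W" "\<And>k. n \<le> k \<Longrightarrow> integrable M (f k)"
    "\<And>k. n \<le> k \<Longrightarrow> integral\<^sup>L M (f k) \<in> W"
  shows "integrable M u \<and> integral\<^sup>L M u \<in> W"
  using assms(1)
proof induction
  case (mid u v)
  then have "(1/2) *\<^sub>R integral\<^sup>L M u + (1/2) *\<^sub>R integral\<^sup>L M v \<in> W"
    using assms(2) by (intro convexD) auto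
  then show ?case using mid by simp
qed (use assms in auto)

text \<open>The weight forces the steps below a constant multiple of
  \<open>(1 / sqrt 2) ^ j\<close>, which is summable.\<close>

lemma summable_geometric_steps_convergent:
  fixes x :: "nat \<Rightarrow> 'a::banach"
  assumes "summable (\<lambda>j. 2 ^ j * (norm (x (Suc j) - x j))\<^sup>2)"
  shows "convergent x"
proof -
  have "Bseq (\<lambda>j. 2 ^ j * (norm (x (Suc j) - x j))\<^sup>2)"
    using summable_LIMSEQ_zero[OF assms] convergentI convergent_imp_Bseq by blast
  then obtain K where K: "0 < K" "\<And>j. norm (2 ^ j * (norm (x (Suc j) - x j))\<^sup>2) \<le> K"
    by (auto elim: BseqE)
  have le: "norm (x (Suc j) - x j) \<le> sqrt K * (1 / sqrt 2) ^ j" for j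
  proof -
    have "2 ^ j * (norm (x (Suc j) - x j))\<^sup>2 \<le> K" using K(2)[of j] by simp
    then have "(norm (x (Suc j) - x j))\<^sup>2 \<le> K / 2 ^ j" by (simp add: field_simps)
    then have "norm (x (Suc j) - x j) \<le> sqrt (K / 2 ^ j)" by (rule real_le_rsqrt)
    also have "\<dots> = sqrt K * (1 / sqrt 2) ^ j" by (simp add: real_sqrt_divide real_sqrt_power power_one_over)
    finally show ?thesis .
  qed
  have "summable (\<lambda>j. sqrt K * (1 / sqrt 2) ^ j)"
    by (intro summable_mult summable_geometric) (simp add: real_less_lsqrt)
  then have "summable (\<lambda>j. x (Suc j) - x j)"
    by (rule summable_comparison_test'[of _ 0]) (use le in simp)
  then have "convergent (\<lambda>n. \<Sum>j<n. x (Suc j) - x j)" by (simp add: summable_iff_convergent)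
  then have "convergent (\<lambda>n. x n - x 0)" by (simp add: sum_lessThan_telescope)
  then have "convergent (\<lambda>n. (x n - x 0) + x 0)" by (intro convergent_add convergent_const)
  then show ?thesis by simp
qed

text \<open>Almost minimising a weighted square norm over the decreasing convex sets generated by the tails
  makes the minimisers a Cauchy sequence, by the parallelogram law.\<close>

theorem midpoints_converge_AE:
  fixes f :: "nat \<Rightarrow> 'b \<Rightarrow> 'a::{real_inner,banach,second_countable_topology}"
  assumes f: "\<And>k. f k \<in> borel_measurable M" "\<And>k. AE t in M. norm (f k t) \<le> w t"
    and w: "integrable M w" "\<And>t. t \<in> space M \<Longrightarrow> 0 < w t"
  obtains h l where "\<And>j. h j \<in> midpoints f j" "AE t in M. (\<lambda>j. h j t) \<longlonglongrightarrow> l t" "l \<in> borel_measurable M"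
proof -
  have [measurable]: "w \<in> borel_measurable M" using w by auto
  \<comment> \<open>Dividing by \<open>w\<close> keeps the functional finite: the combinations
    satisfy \<open>norm (u t) \<le> w t\<close> a.e., so the integrand is at most
    \<open>w t\<close>, while the plain square need not be integrable.\<close>
  define N where "N u = (\<integral>t. (norm (u t))\<^sup>2 / w t \<partial>M)" for u :: "'b \<Rightarrow> 'a"
  have mp: "u \<in> borel_measurable M \<and> (AE t in M. norm (u t) \<le> w t)" if "u \<in> midpoints f n" for u n
    using that
  proof induction
    case (mid u v)
    then have [measurable]: "u \<in> borel_measurable M" "v \<in> borel_measurable M" by auto
    have "AE t in M. norm (u t) \<le> w t" "AE t in M. norm (v t) \<le> w t" using mid by auto
    then have "AE t in M. norm ((1/2) *\<^sub>R u t + (1/2) *\<^sub>R v t) \<le> w t"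
    proof eventually_elim
      case (elim t)
      then show ?case using norm_triangle_ineq[of "(1/2) *\<^sub>R u t" "(1/2) *\<^sub>R v t"] by simp
    qed
    then show ?case by simp
  qed (use f in auto)
  have le_w: "AE t in M. (norm (u t))\<^sup>2 / w t \<le> w t" if "u \<in> midpoints f n" for u n
  proof -
    have "AE t in M. norm (u t) \<le> w t" using mp[OF that] by simp
    with AE_space show ?thesis
    proof eventually_elim
      case (elim t)
      then have "(norm (u t))\<^sup>2 \<le> (w t)\<^sup>2" by (intro power_mono) auto
      then show ?case using w(2)[OF elim(1)] by (simp add: divide_le_eq power2_eq_square)
    qed
  qed
  have Nint: "integrable M (\<lambda>t. (norm (u t))\<^sup>2 / w t)" if "u \<in> midpoints f n" for u n
  proof (rule Bochner_Integration.integrable_bound[OF w(1)])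
    have [measurable]: "u \<in> borel_measurable M" using mp[OF that] by simp
    show "(\<lambda>t. (norm (u t))\<^sup>2 / w t) \<in> borel_measurable M" by measurable
    show "AE t in M. norm ((norm (u t))\<^sup>2 / w t) \<le> norm (w t)"
      using le_w[OF that] AE_space by eventually_elim (use w(2) in \<open>simp add: less_imp_le\<close>)
  qed
  have N0: "0 \<le> N u" for u
    unfolding N_def using w(2) by (intro integral_nonneg_AE AE_I2 divide_nonneg_nonneg) (auto intro: less_imp_le)
  have Nw: "N u \<le> integral\<^sup>L M w" if "u \<in> midpoints f n" for u n
    unfolding N_def by (rule integral_mono_AE[OF Nint[OF that] w(1) le_w[OF that]])
  have par: "integrable M (\<lambda>t. (norm (u t - v t))\<^sup>2 / w t) \<and> (\<integral>t. (norm (u t - v t))\<^sup>2 / w t \<partial>M) =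
      2 * N u + 2 * N v - 4 * N (\<lambda>t. (1/2) *\<^sub>R u t + (1/2) *\<^sub>R v t)"
    if u: "u \<in> midpoints f n" and v: "v \<in> midpoints f n" for u v n
  proof -
    have eq: "(norm (u t - v t))\<^sup>2 / w t = 2 * ((norm (u t))\<^sup>2 / w t) + 2 * ((norm (v t))\<^sup>2 / w t)
        - 4 * ((norm ((1/2) *\<^sub>R u t + (1/2) *\<^sub>R v t))\<^sup>2 / w t)" for t
    proof -
      have "(norm (u t - v t))\<^sup>2 = 2 * (norm (u t))\<^sup>2 + 2 * (norm (v t))\<^sup>2 - 4 * (norm ((1/2) *\<^sub>R u t + (1/2) *\<^sub>R v t))\<^sup>2"
        unfolding power2_norm_eq_inner by (simp add: inner_add_left inner_add_right inner_diff_left inner_diff_right inner_commute)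
      then show ?thesis by (simp add: add_divide_distrib diff_divide_distrib)
    qed
    define A B C where "A = (\<lambda>t. (norm (u t))\<^sup>2 / w t)" "B = (\<lambda>t. (norm (v t))\<^sup>2 / w t)"
      "C = (\<lambda>t. (norm ((1/2) *\<^sub>R u t + (1/2) *\<^sub>R v t))\<^sup>2 / w t)"
    have "integrable M A" "integrable M B" "integrable M C"
      unfolding A_B_C_def using Nint[OF u] Nint[OF v] Nint[OF midpoints.mid[OF u v]] by auto
    then have "integrable M (\<lambda>t. 2 * A t + 2 * B t - 4 * C t)"
      "(\<integral>t. 2 * A t + 2 * B t - 4 * C t \<partial>M) = 2 * integral\<^sup>L M A + 2 * integral\<^sup>L M B - 4 * integral\<^sup>L M C"
      by simp_all
    then show ?thesis unfolding eq N_def A_B_C_def by blast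
  qed
  define \<delta> where "\<delta> n = (INF u\<in>midpoints f n. N u)" for n
  have ne: "midpoints f n \<noteq> {}" for n using midpoints.base[of n n f] by auto
  have bddN: "bdd_below (N ` S)" for S using N0 by (intro bdd_belowI2[of _ 0])
  have \<delta>le: "\<delta> n \<le> N u" if "u \<in> midpoints f n" for u n
    unfolding \<delta>_def using that bddN by (intro cINF_lower) auto
  have \<delta>mono: "\<delta> m \<le> \<delta> n" if "m \<le> n" for m n
    unfolding \<delta>_def using ne bddN midpoints_antimono[OF _ that] by (intro cINF_superset_mono) auto
  have \<delta>w: "\<delta> n \<le> integral\<^sup>L M w" for n
    using \<delta>le[OF midpoints.base[of n n]] Nw[OF midpoints.base[of n n]] by force
  define \<Delta> where "\<Delta> = (SUP n. \<delta> n)"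
  have bddd: "bdd_above (range \<delta>)" using \<delta>w by (intro bdd_aboveI2[of _ _ "integral\<^sup>L M w"])
  have \<delta>\<Delta>: "\<delta> n \<le> \<Delta>" for n unfolding \<Delta>_def using bddd by (intro cSUP_upper) auto
  \<comment> \<open>The rate \<open>(1/4) ^ j\<close> still leaves \<open>(1/2) ^ j\<close> after
    multiplication by the weight \<open>2 ^ j\<close> in \<open>g\<close>.\<close>
  have "\<exists>n\<ge>j. \<Delta> - (1/4) ^ j < \<delta> n" for j
  proof -
    have "\<Delta> - (1/4) ^ j < \<Delta>" by simp
    then obtain n where "\<Delta> - (1/4) ^ j < \<delta> n" unfolding \<Delta>_def using bddd by (subst (asm) less_cSUP_iff) auto
    then show ?thesis using \<delta>mono[of n "max n j"] by (intro exI[of _ "max n j"]) auto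
  qed
  then obtain n where n: "\<And>j. j \<le> n j" "\<And>j. \<Delta> - (1/4) ^ j < \<delta> (n j)" by metis
  have "\<exists>u\<in>midpoints f (n j). N u < \<Delta> + (1/4) ^ j" for j
  proof -
    have "\<delta> (n j) < \<Delta> + (1/4) ^ j" by (rule le_less_trans[OF \<delta>\<Delta>]) simp
    then show ?thesis unfolding \<delta>_def using ne bddN by (subst (asm) cINF_less_iff) auto
  qed
  then obtain h where h: "\<And>j. h j \<in> midpoints f (n j)" "\<And>j. N (h j) < \<Delta> + (1/4) ^ j" by metis
  have hm[measurable]: "h j \<in> borel_measurable M" for j using mp[OF h(1)] by simp
  define g where "g j t = 2 ^ j * ((norm (h (Suc j) t - h j t))\<^sup>2 / w t)" for j t
  \<comment> \<open>The parallelogram law gives at most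
    \<open>4 * (\<Delta> + (1/4) ^ j) - 4 * (\<Delta> - (1/4) ^ j)\<close>, hence the 8.\<close>
  have step: "integrable M (\<lambda>t. (norm (h (Suc j) t - h j t))\<^sup>2 / w t) \<and> (\<integral>t. (norm (h (Suc j) t - h j t))\<^sup>2 / w t \<partial>M) \<le> 8 * (1/4) ^ j" for j
  proof -
    \<comment> \<open>The indices \<open>n j\<close> need not increase, so both functions are
      compared in the larger of their two sets.\<close>
    define m where "m = min (n j) (n (Suc j))"
    have m: "h j \<in> midpoints f m" "h (Suc j) \<in> midpoints f m"
      using midpoints_antimono[OF h(1)] by (auto simp: m_def)
    have "(1/4) ^ Suc j \<le> ((1/4) ^ j :: real)" by simp
    then have "\<Delta> - (1/4) ^ j \<le> \<delta> (n j)" "\<Delta> - (1/4) ^ j \<le> \<delta> (n (Suc j))" "N (h (Suc j)) < \<Delta> + (1/4) ^ j"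
      using n(2)[of j] n(2)[of "Suc j"] h(2)[of "Suc j"] by linarith+
    then have "\<Delta> - (1/4) ^ j \<le> \<delta> m" "N (h (Suc j)) < \<Delta> + (1/4) ^ j" by (auto simp: m_def min_def)
    moreover have "\<delta> m \<le> N (\<lambda>t. (1/2) *\<^sub>R h (Suc j) t + (1/2) *\<^sub>R h j t)" by (intro \<delta>le midpoints.mid m)
    ultimately show ?thesis using par[OF m(2,1)] h(2)[of j] by linarith
  qed
  have gint: "integrable M (g j)" "integral\<^sup>L M (g j) \<le> 8 * (1/2) ^ j" for j
  proof -
    have gj: "g j = (\<lambda>t. 2 ^ j * ((norm (h (Suc j) t - h j t))\<^sup>2 / w t))" by (rule ext) (simp only: g_def)
    show "integrable M (g j)" unfolding gj using step[of j] by (intro integrable_mult_right) auto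
    have "integral\<^sup>L M (g j) \<le> 2 ^ j * (8 * (1/4) ^ j)"
      unfolding gj Bochner_Integration.integral_mult_right_zero using step[of j] by (intro mult_left_mono) auto
    also have "\<dots> = 8 * (2 * (1/4)) ^ j" unfolding power_mult_distrib by (simp only: mult_ac)
    finally show "integral\<^sup>L M (g j) \<le> 8 * (1/2) ^ j" by simp
  qed
  have g0: "0 \<le> g j t" if "t \<in> space M" for j t using w(2)[OF that] by (simp add: g_def)
  have nn: "(\<integral>\<^sup>+t. ennreal (g j t) \<partial>M) \<le> ennreal (8 * (1/2) ^ j)" for j
    using gint[of j] g0 by (subst nn_integral_eq_integral) (auto intro: ennreal_leI)
  have "(\<integral>\<^sup>+t. (\<Sum>j. ennreal (g j t)) \<partial>M) = (\<Sum>j. \<integral>\<^sup>+t. ennreal (g j t) \<partial>M)"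
    using gint(1) by (intro nn_integral_suminf) auto
  also have "\<dots> \<le> (\<Sum>j. ennreal (8 * (1/2) ^ j))" using nn by (intro suminf_le) auto
  also have "\<dots> = ennreal (\<Sum>j. 8 * (1/2) ^ j)" by (intro suminf_ennreal2 summable_mult summable_geometric) auto
  also have "\<dots> < \<infinity>" by simp
  finally have fin: "(\<integral>\<^sup>+t. (\<Sum>j. ennreal (g j t)) \<partial>M) \<noteq> \<infinity>" by simp
  have "AE t in M. (\<Sum>j. ennreal (g j t)) \<noteq> \<infinity>"
    using gint(1) by (intro nn_integral_PInf_AE[OF _ fin]) auto
  with AE_space have conv: "AE t in M. convergent (\<lambda>j. h j t)"
  proof eventually_elim
    case (elim t)
    then have "summable (\<lambda>j. g j t)" using g0 by (intro summable_suminf_not_top) auto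
    then have "summable (\<lambda>j. w t * g j t)" by (rule summable_mult)
    then have "summable (\<lambda>j. 2 ^ j * (norm (h (Suc j) t - h j t))\<^sup>2)"
      using w(2)[OF elim(1)] by (simp add: g_def mult.left_commute)
    then show ?case by (rule summable_geometric_steps_convergent)
  qed
  show thesis
  proof (rule that[of h "\<lambda>t. lim (\<lambda>j. h j t)"])
    show "h j \<in> midpoints f j" for j using midpoints_antimono[OF h(1) n(1)] .
    show "AE t in M. (\<lambda>j. h j t) \<longlonglongrightarrow> lim (\<lambda>j. h j t)"
      using conv by eventually_elim (simp add: convergent_LIMSEQ_iff)
    show "(\<lambda>t. lim (\<lambda>j. h j t)) \<in> borel_measurable M" by measurable
  qed
qed

section \<open>A linear integral inequality\<close>

lemma integral_lebesgue_on_point: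
  fixes f :: "real \<Rightarrow> 'b::{banach,second_countable_topology}"
  shows "integral\<^sup>L (lebesgue_on {a..a}) f = 0"
  by (subst integral_lebesgue_on_eq, simp, rule integral_eq_zero_AE, rule AE_I'[of "{a}"])
    (auto simp: indicator_def split: if_splits)

text \<open>On a fine partition the sum of the products is at most \<epsilon> times the total
  increase of the monotone \<open>r\<close>, where \<epsilon> bounds the oscillation of the
  continuous \<open>P\<close>. This replaces differentiation when integral expressions are compared
  by their increments.\<close>

lemma increment_nonneg_of_small_products:
  fixes P r D :: "real \<Rightarrow> real"
  assumes P: "continuous_on {0..t} P" and "0 \<le> t"
    and mono: "\<And>a b. 0 \<le> a \<Longrightarrow> a \<le> b \<Longrightarrow> b \<le> t \<Longrightarrow> r a \<le> r b"
    and D: "\<And>a b. 0 \<le> a \<Longrightarrow> a \<le> b \<Longrightarrow> b \<le> t \<Longrightarrow> - ((P b - P a) * (r b - r a)) \<le> D b - D a"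
  shows "D 0 \<le> D t"
proof -
  have "D 0 - D t \<le> \<epsilon> * (r t - r 0)" if "0 < \<epsilon>" for \<epsilon>
  proof -
    have "uniformly_continuous_on {0..t} P" using P compact_uniformly_continuous by blast
    then obtain \<delta> where \<delta>: "0 < \<delta>" "\<And>a b. a \<in> {0..t} \<Longrightarrow> b \<in> {0..t} \<Longrightarrow> dist b a < \<delta> \<Longrightarrow> dist (P b) (P a) < \<epsilon>"
      unfolding uniformly_continuous_on_def using \<open>0 < \<epsilon>\<close> by metis
    obtain n :: nat where n: "t / \<delta> < real n" using reals_Archimedean2 by blast
    then have n0: "0 < real n" using \<open>0 \<le> t\<close> \<delta>(1) by (meson divide_nonneg_pos le_less_trans)
    define p where "p i = t * real i / real n" for i
    have p: "0 \<le> p i" "p i \<le> p (Suc i)" for i using n0 \<open>0 \<le> t\<close> by (auto simp: p_def field_simps)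
    have pt: "p i \<le> t" if "i \<le> n" for i
      using n0 \<open>0 \<le> t\<close> that by (simp add: p_def divide_le_eq mult_left_mono)
    have pd: "p (Suc i) - p i < \<delta>" for i
    proof -
      have "p (Suc i) - p i = t / real n" by (simp add: p_def diff_divide_distrib[symmetric] algebra_simps)
      also have "\<dots> < \<delta>" using n n0 \<delta>(1) by (simp add: field_simps)
      finally show ?thesis .
    qed
    have "D 0 - D t = (\<Sum>i<n. D (p i) - D (p (Suc i)))"
      using sum_lessThan_telescope[of "\<lambda>i. - D (p i)" n] n0 by (simp add: p_def)
    also have "\<dots> \<le> (\<Sum>i<n. \<epsilon> * (r (p (Suc i)) - r (p i)))"
    proof (rule sum_mono)
      fix i assume "i \<in> {..<n}"
      then have i: "p (Suc i) \<le> t" "p i \<le> t" using pt[of "Suc i"] pt[of i] by auto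
      have "D (p i) - D (p (Suc i)) \<le> (P (p (Suc i)) - P (p i)) * (r (p (Suc i)) - r (p i))"
        using D[of "p i" "p (Suc i)"] p i by force
      also have "\<dots> \<le> \<epsilon> * (r (p (Suc i)) - r (p i))"
      proof (rule mult_right_mono)
        have "dist (P (p (Suc i))) (P (p i)) < \<epsilon>"
          using p[of i] i pd[of i] order_trans[OF p] by (intro \<delta>(2)) (auto simp: dist_real_def)
        then show "P (p (Suc i)) - P (p i) \<le> \<epsilon>" by (simp add: dist_real_def)
        show "0 \<le> r (p (Suc i)) - r (p i)" using mono[of "p i" "p (Suc i)"] p i by auto
      qed
      finally show "D (p i) - D (p (Suc i)) \<le> \<epsilon> * (r (p (Suc i)) - r (p i))" .
    qed
    also have "\<dots> = \<epsilon> * (r t - r 0)"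
      using sum_lessThan_telescope[of "\<lambda>i. r (p i)" n] n0 by (simp add: p_def sum_distrib_left[symmetric])
    finally show ?thesis .
  qed
  moreover have "((\<lambda>\<epsilon>. \<epsilon> * (r t - r 0)) \<longlongrightarrow> 0 * (r t - r 0)) (at_right 0)"
    by (intro tendsto_intros)
  ultimately have "D 0 - D t \<le> 0 * (r t - r 0)"
    by (intro tendsto_lowerbound) (auto simp: eventually_at_filter)
  then show ?thesis by simp
qed

text \<open>\<open>r\<close> is the variation of constants formula for \<open>r' = p r + q\<close>.
  The supersolution property is read off from increments: those of \<open>r\<close> are bounded
  below through its value at the left end, those of the integral are bounded above through the value
  at the right end, and the two bounds differ by a product of increments.\<close>

lemma linear_integral_inequality:
  fixes p q :: "real \<Rightarrow> real"
  assumes p: "integrable (lebesgue_on {0..T}) p" "\<And>t. t \<in> {0..T} \<Longrightarrow> 0 \<le> p t"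
    and q: "integrable (lebesgue_on {0..T}) q" "\<And>t. t \<in> {0..T} \<Longrightarrow> 0 \<le> q t" and a: "0 \<le> a"
  defines "r \<equiv> \<lambda>t. a * exp (integral\<^sup>L (lebesgue_on {0..t}) p) +
      integral\<^sup>L (lebesgue_on {0..t}) (\<lambda>s. q s * exp (integral\<^sup>L (lebesgue_on {s..t}) p))"
  shows "continuous_on {0..T} r" "mono_on {0..T} r"
    "t \<in> {0..T} \<Longrightarrow> 0 \<le> r t"
    "integrable (lebesgue_on {0..T}) (\<lambda>s. p s * r s)"
    "t \<in> {0..T} \<Longrightarrow> a + integral\<^sup>L (lebesgue_on {0..t}) (\<lambda>s. p s * r s + q s) \<le> r t"
proof -
  define P where "P t = integral\<^sup>L (lebesgue_on {0..t}) p" for t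
  have Pc: "continuous_on {0..T} P" unfolding P_def by (rule indefinite_integral_continuous_real[OF p(1)])
  have split: "integral\<^sup>L (lebesgue_on {0..t}) f = integral\<^sup>L (lebesgue_on {0..s}) f + integral\<^sup>L (lebesgue_on {s..t}) f"
    if "integrable (lebesgue_on {0..T}) f" "0 \<le> s" "s \<le> t" "t \<le> T" for f :: "real \<Rightarrow> real" and s t
  proof (rule integral_lebesgue_on_split)
    show "integrable (lebesgue_on {0..t}) f" using that by (intro integrable_lebesgue_on_subset[OF that(1)]) auto
  qed (use that in auto)
  have sub: "integrable (lebesgue_on {s..t}) f" if "integrable (lebesgue_on {0..T}) f" "0 \<le> s" "t \<le> T" for f :: "real \<Rightarrow> real" and s t
    using that by (intro integrable_lebesgue_on_subset[OF that(1)]) auto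
  have nonneg: "0 \<le> integral\<^sup>L (lebesgue_on {s..t}) f" if "\<And>t. t \<in> {0..T} \<Longrightarrow> 0 \<le> f t" "0 \<le> s" "t \<le> T" for f :: "real \<Rightarrow> real" and s t
    using that by (intro integral_nonneg_AE AE_I2) auto
  have Pst: "integral\<^sup>L (lebesgue_on {s..t}) p = P t - P s" if "0 \<le> s" "s \<le> t" "t \<le> T" for s t
    using split[OF p(1) that] by (simp add: P_def)
  have Pmono: "P s \<le> P t" if "0 \<le> s" "s \<le> t" "t \<le> T" for s t
    using nonneg[of p s t] p(2) Pst[OF that] that by simp
  have mult: "integrable (lebesgue_on {0..T}) (\<lambda>s. f s * k s)" if f: "integrable (lebesgue_on {0..T}) f" and k: "continuous_on {0..T} k" for f k :: "real \<Rightarrow> real"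
  proof -
    obtain B where B: "\<And>s. s \<in> {0..T} \<Longrightarrow> norm (k s) \<le> B"
      using compact_imp_bounded[OF compact_continuous_image[OF k compact_Icc]] unfolding bounded_iff by blast
    have [measurable]: "k \<in> borel_measurable (lebesgue_on {0..T})" "f \<in> borel_measurable (lebesgue_on {0..T})"
      using f k by (auto intro: continuous_imp_measurable_on_sets_lebesgue)
    show ?thesis
    proof (rule Bochner_Integration.integrable_bound[of _ "\<lambda>s. B * norm (f s)"])
      show "integrable (lebesgue_on {0..T}) (\<lambda>s. B * norm (f s))" using f by auto
      show "AE s in lebesgue_on {0..T}. norm (f s * k s) \<le> norm (B * norm (f s))"
      proof (rule AE_I2)
        fix s assume "s \<in> space (lebesgue_on {0..T})"
        then have "norm (k s) \<le> B" using B by simp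
        then have "norm (k s) * norm (f s) \<le> \<bar>B\<bar> * norm (f s)" by (intro mult_right_mono) auto
        then show "norm (f s * k s) \<le> norm (B * norm (f s))" by (simp add: abs_mult mult.commute)
      qed
    qed measurable
  qed
  have qe: "integrable (lebesgue_on {0..T}) (\<lambda>s. q s * exp (- P s))"
    by (intro mult[OF q(1)] continuous_intros Pc)
  have qe0: "0 \<le> q s * exp (- P s)" if "s \<in> {0..T}" for s using q(2)[OF that] by simp
  \<comment> \<open>Separating \<open>t\<close> from the integration variable makes continuity
    visible and yields the recursion behind \<open>incr\<close>.\<close>
  have r_eq: "r t = exp (P t) * (a + integral\<^sup>L (lebesgue_on {0..t}) (\<lambda>s. q s * exp (- P s)))" if "t \<in> {0..T}" for t
  proof -
    have "integral\<^sup>L (lebesgue_on {0..t}) (\<lambda>s. q s * exp (integral\<^sup>L (lebesgue_on {s..t}) p)) =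
        integral\<^sup>L (lebesgue_on {0..t}) (\<lambda>s. exp (P t) * (q s * exp (- P s)))"
      using that by (intro Bochner_Integration.integral_cong) (auto simp: Pst exp_diff exp_minus field_simps)
    then show ?thesis by (simp add: r_def P_def distrib_left)
  qed
  have "continuous_on {0..T} (\<lambda>t. exp (P t) * (a + integral\<^sup>L (lebesgue_on {0..t}) (\<lambda>s. q s * exp (- P s))))"
    by (intro continuous_intros Pc indefinite_integral_continuous_real qe)
  then show rc: "continuous_on {0..T} r" by (rule continuous_on_eq) (simp add: r_eq)
  show r0: "0 \<le> r t" if "t \<in> {0..T}" for t
    unfolding r_eq[OF that] using a nonneg[of _ 0 t] qe0 that by (intro mult_nonneg_nonneg add_nonneg_nonneg) auto
  have incr: "(P t - P s) * r s + integral\<^sup>L (lebesgue_on {s..t}) q \<le> r t - r s" if st: "0 \<le> s" "s \<le> t" "t \<le> T" for s t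
  proof -
    have I: "integral\<^sup>L (lebesgue_on {s..t}) (\<lambda>\<tau>. exp (P t) * (q \<tau> * exp (- P \<tau>))) =
        exp (P t) * integral\<^sup>L (lebesgue_on {s..t}) (\<lambda>\<tau>. q \<tau> * exp (- P \<tau>))"
      by (rule Bochner_Integration.integral_mult_right_zero)
    have "r t = exp (P t - P s) * r s + integral\<^sup>L (lebesgue_on {s..t}) (\<lambda>\<tau>. exp (P t) * (q \<tau> * exp (- P \<tau>)))"
      unfolding I using st split[OF qe st] by (simp add: r_eq exp_diff field_simps)
    moreover have "integral\<^sup>L (lebesgue_on {s..t}) q \<le> integral\<^sup>L (lebesgue_on {s..t}) (\<lambda>\<tau>. exp (P t) * (q \<tau> * exp (- P \<tau>)))"
    proof (rule integral_mono)
      show "integrable (lebesgue_on {s..t}) q" using sub[OF q(1)] st by auto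
      show "integrable (lebesgue_on {s..t}) (\<lambda>\<tau>. exp (P t) * (q \<tau> * exp (- P \<tau>)))" using sub[OF qe] st by auto
      fix \<tau> assume "\<tau> \<in> space (lebesgue_on {s..t})"
      then have \<tau>: "0 \<le> \<tau>" "\<tau> \<le> t" "\<tau> \<in> {0..T}" using st by auto
      have "q \<tau> * 1 \<le> q \<tau> * exp (P t - P \<tau>)"
        using Pmono[OF \<tau>(1,2) st(3)] q(2)[OF \<tau>(3)] by (intro mult_left_mono) auto
      then show "q \<tau> \<le> exp (P t) * (q \<tau> * exp (- P \<tau>))" by (simp add: exp_diff exp_minus field_simps)
    qed
    moreover have "(1 + (P t - P s)) * r s \<le> exp (P t - P s) * r s"
      using r0[of s] st by (intro mult_right_mono exp_ge_add_one_self) auto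
    ultimately show ?thesis by (simp add: algebra_simps)
  qed
  have rmono: "r s \<le> r t" if st: "0 \<le> s" "s \<le> t" "t \<le> T" for s t
  proof -
    have "0 \<le> (P t - P s) * r s" using Pmono[OF st] r0[of s] st by (intro mult_nonneg_nonneg) auto
    moreover have "0 \<le> integral\<^sup>L (lebesgue_on {s..t}) q" using nonneg[of q s t] q(2) st by auto
    ultimately show ?thesis using incr[OF st] by linarith
  qed
  then show "mono_on {0..T} r" by (auto simp: mono_on_def)
  show pr: "integrable (lebesgue_on {0..T}) (\<lambda>s. p s * r s)" by (rule mult[OF p(1) rc])
  define J where "J t = integral\<^sup>L (lebesgue_on {0..t}) (\<lambda>s. p s * r s + q s)" for t
  have prq: "integrable (lebesgue_on {0..T}) (\<lambda>s. p s * r s + q s)" using pr q(1) by simp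
  have Jincr: "J t - J s \<le> (P t - P s) * r t + integral\<^sup>L (lebesgue_on {s..t}) q" if st: "0 \<le> s" "s \<le> t" "t \<le> T" for s t
  proof -
    have "J t - J s = integral\<^sup>L (lebesgue_on {s..t}) (\<lambda>\<tau>. p \<tau> * r \<tau> + q \<tau>)"
      using split[OF prq st] by (simp add: J_def)
    also have "\<dots> \<le> integral\<^sup>L (lebesgue_on {s..t}) (\<lambda>\<tau>. p \<tau> * r t + q \<tau>)"
    proof (rule integral_mono)
      show "integrable (lebesgue_on {s..t}) (\<lambda>\<tau>. p \<tau> * r \<tau> + q \<tau>)" using sub[OF prq] st by auto
      show "integrable (lebesgue_on {s..t}) (\<lambda>\<tau>. p \<tau> * r t + q \<tau>)" using sub[OF p(1)] sub[OF q(1)] st by auto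
      fix \<tau> assume "\<tau> \<in> space (lebesgue_on {s..t})"
      then show "p \<tau> * r \<tau> + q \<tau> \<le> p \<tau> * r t + q \<tau>" using st p(2)[of \<tau>] rmono[of \<tau> t] by (auto intro!: mult_left_mono)
    qed
    also have "\<dots> = (P t - P s) * r t + integral\<^sup>L (lebesgue_on {s..t}) q"
      using sub[OF p(1)] sub[OF q(1)] st Pst[OF st] by simp
    finally show ?thesis .
  qed
  show "a + J t \<le> r t" if t: "t \<in> {0..T}"
  proof -
    have "r 0 - J 0 \<le> r t - J t"
    proof (rule increment_nonneg_of_small_products[where P=P and r=r])
      show "continuous_on {0..t} P" using t by (intro continuous_on_subset[OF Pc]) auto
      fix x y assume xy: "0 \<le> x" "x \<le> y" "y \<le> t"
      then have "y \<le> T" using t by auto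
      show "r x \<le> r y" using rmono xy \<open>y \<le> T\<close> by auto
      show "- ((P y - P x) * (r y - r x)) \<le> r y - J y - (r x - J x)"
        using incr[OF xy(1,2) \<open>y \<le> T\<close>] Jincr[OF xy(1,2) \<open>y \<le> T\<close>] by (simp add: algebra_simps)
    qed (use t in auto)
    moreover have "J 0 = 0" "P 0 = 0" "integral\<^sup>L (lebesgue_on {0..0}) (\<lambda>s. q s * exp (- P s)) = 0"
      by (simp_all only: J_def P_def integral_lebesgue_on_point)
    ultimately show ?thesis using t r_eq[of 0] by simp
  qed
qed

section \<open>Compactness of approximations\<close>

lemma hausdorff_mnc_zero_imp_convergent_subsequence:
  fixes u :: "nat \<Rightarrow> 'a::banach"
  assumes "hausdorff_mnc (range u) \<le> 0"
  obtains \<rho> where "strict_mono \<rho>" "convergent (u \<circ> \<rho>)"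
proof -
  have "compact (closure (range u))"
    unfolding compact_eq_totally_bounded
  proof (intro conjI allI impI)
    show "complete (closure (range u))" by (simp add: complete_eq_closed)
    fix e :: real assume "0 < e"
    then have e: "0 < e / 2" by simp
    have h0: "hausdorff_mnc (range u) \<le> ereal 0" using assms by (simp add: zero_ereal_def)
    obtain X where X: "finite X" "\<And>a. a \<in> range u \<Longrightarrow> \<exists>x\<in>X. dist x a \<le> 0 + e / 2"
      by (rule hausdorff_mnc_leD[OF h0 e]) blast
    have "range u \<subseteq> (\<Union>x\<in>X. cball x (e / 2))" using X(2) by fastforce
    moreover have "closed (\<Union>x\<in>X. cball x (e / 2))" using X(1) by (intro closed_UN) auto
    ultimately have "closure (range u) \<subseteq> (\<Union>x\<in>X. cball x (e / 2))" by (rule closure_minimal)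
    also have "\<dots> \<subseteq> (\<Union>x\<in>X. ball x e)" using \<open>0 < e\<close> by (intro UN_mono) auto
    finally show "\<exists>k. finite k \<and> closure (range u) \<subseteq> (\<Union>x\<in>k. ball x e)" using X(1) by blast
  qed
  then have "seq_compact (closure (range u))" by (rule compact_imp_seq_compact)
  moreover have "\<forall>n. u n \<in> closure (range u)" by (intro allI subsetD[OF closure_subset]) simp
  ultimately obtain l \<rho> where "strict_mono \<rho>" "(u \<circ> \<rho>) \<longlonglongrightarrow> l" by (rule seq_compactE)
  then show thesis using that convergentI by blast
qed

text \<open>A diagonal argument settles convergence at the rational times; the common modulus of
  continuity \<Psi> then carries the Cauchy property to every other time, as in the Arzela-Ascoli
  theorem.\<close>

lemma pointwise_convergent_subsequence:
  fixes X :: "nat \<Rightarrow> real \<Rightarrow> 'a::banach"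
  assumes "0 < T" and \<Psi>: "continuous_on {0..T} \<Psi>"
    and equi: "\<And>n s t. s \<in> {0..T} \<Longrightarrow> t \<in> {0..T} \<Longrightarrow> norm (X n t - X n s) \<le> \<bar>\<Psi> t - \<Psi> s\<bar>"
    and mnc: "\<And>t. t \<in> {0..T} \<Longrightarrow> hausdorff_mnc (range (\<lambda>n. X n t)) \<le> 0"
  obtains \<rho> where "strict_mono \<rho>" "\<And>t. t \<in> {0..T} \<Longrightarrow> convergent (\<lambda>n. X (\<rho> n) t)"
proof -
  define q where "q = from_nat_into (\<rat> \<inter> {0..T})"
  have QT: "countable (\<rat> \<inter> {0..T})" "\<rat> \<inter> {0..T} \<noteq> {}"
    using \<open>0 < T\<close> countable_rat by (auto intro!: exI[of _ 0])
  have qT: "q n \<in> {0..T}" for n using from_nat_into[OF QT(2), of n] by (simp add: q_def)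
  interpret subseqs "\<lambda>n s. convergent (\<lambda>i. X (s i) (q n))"
  proof
    fix n and s :: "nat \<Rightarrow> nat"
    have "hausdorff_mnc (range (\<lambda>i. X (s i) (q n))) \<le> hausdorff_mnc (range (\<lambda>n'. X n' (q n)))"
      by (rule hausdorff_mnc_mono) auto
    then have "hausdorff_mnc (range (\<lambda>i. X (s i) (q n))) \<le> 0" using mnc[OF qT, of n] by (rule order_trans)
    then show "\<exists>r'. strict_mono r' \<and> convergent (\<lambda>i. X ((s \<circ> r') i) (q n))"
      using hausdorff_mnc_zero_imp_convergent_subsequence[of "\<lambda>i. X (s i) (q n)"] by (auto simp: o_def)
  qed
  have conv: "convergent (\<lambda>i. X (diagseq i) (q n))" for n
  proof -
    \<comment> \<open>The diagonal sequence is compared with the stage that treats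
      \<open>q n\<close> only from index \<open>n + 1\<close> on, hence the shift.\<close>
    have "convergent (\<lambda>i. X ((diagseq \<circ> (+) (Suc n)) i) (q n))"
    proof (rule diagseq_holds)
      fix \<rho>' s and m :: nat assume "strict_mono (\<rho>' :: nat \<Rightarrow> nat)" "convergent (\<lambda>i. X (s i) (q m))"
      then show "convergent (\<lambda>i. X ((s \<circ> \<rho>') i) (q m))"
        using convergent_subseq_convergent[of "\<lambda>i. X (s i) (q m)" \<rho>'] by (simp add: o_def)
    qed
    then have "convergent (\<lambda>i. X (diagseq (i + Suc n)) (q n))" by (simp add: o_def add.commute)
    then show ?thesis using convergent_ignore_initial_segment[of "\<lambda>i. X (diagseq i) (q n)" "Suc n"] by simp
  qed
  show thesis
  proof (rule that[OF subseq_diagseq])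
    fix t assume t: "t \<in> {0..T}"
    have "Cauchy (\<lambda>n. X (diagseq n) t)"
    proof (rule CauchyI)
      fix e :: real assume "0 < e"
      then have e3: "0 < e / 3" by simp
      then obtain \<delta> where \<delta>: "0 < \<delta>" "\<And>s. s \<in> {0..T} \<Longrightarrow> dist s t < \<delta> \<Longrightarrow> dist (\<Psi> s) (\<Psi> t) < e / 3"
        using \<Psi> t unfolding continuous_on_iff by metis
      have "max 0 (t - \<delta>) < min T (t + \<delta>)" using t \<delta>(1) \<open>0 < T\<close> by auto
      then obtain s where s: "s \<in> \<rat>" "max 0 (t - \<delta>) < s" "s < min T (t + \<delta>)" using Rats_dense_in_real by blast
      then have "s \<in> \<rat> \<inter> {0..T}" by auto
      then obtain m where m: "q m = s" using from_nat_into_surj[OF QT(1)] unfolding q_def by blast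
      have near: "norm (X n t - X n s) < e / 3" for n
      proof -
        have "dist s t < \<delta>" using s by (auto simp: dist_real_def)
        then have "dist (\<Psi> s) (\<Psi> t) < e / 3" using \<delta>(2)[of s] s by auto
        then show ?thesis using equi[of s t n] s t by (auto simp: dist_real_def abs_minus_commute)
      qed
      have "Cauchy (\<lambda>n. X (diagseq n) s)" using conv[of m] m by (simp add: Cauchy_convergent_iff)
      then obtain N where N: "\<And>i j. i \<ge> N \<Longrightarrow> j \<ge> N \<Longrightarrow> norm (X (diagseq i) s - X (diagseq j) s) < e / 3"
        using e3 CauchyD by blast
      have "norm (X (diagseq i) t - X (diagseq j) t) < e" if "i \<ge> N" "j \<ge> N" for i j
      proof -
        let ?A = "X (diagseq i) t - X (diagseq i) s" and ?B = "X (diagseq i) s - X (diagseq j) s"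
          and ?C = "X (diagseq j) t - X (diagseq j) s"
        have "X (diagseq i) t - X (diagseq j) t = ?A + ?B - ?C" by simp
        also have "norm \<dots> \<le> norm ?A + norm ?B + norm ?C"
          using norm_triangle_ineq4[of "?A + ?B" ?C] norm_triangle_ineq[of ?A ?B] by linarith
        also have "\<dots> < e" using near[of "diagseq i"] near[of "diagseq j"] N[OF that] by linarith
        finally show ?thesis .
      qed
      then show "\<exists>M. \<forall>m\<ge>M. \<forall>n\<ge>M. norm (X (diagseq m) t - X (diagseq n) t) < e" by blast
    qed
    then show "convergent (\<lambda>n. X (diagseq n) t)" by (simp add: Cauchy_convergent_iff)
  qed
qed

section \<open>Approximate solutions and their limit\<close>

text \<open>The memory term makes each node value depend on all earlier ones, so the scheme is posed
  as a fixed point of an operator on whole sequences that looks only at earlier entries.\<close>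

lemma course_of_values_fixpoint:
  fixes \<Phi> :: "nat \<Rightarrow> (nat \<Rightarrow> 'a) \<Rightarrow> 'a"
  assumes "\<And>i a b. (\<And>j. j < i \<Longrightarrow> a j = b j) \<Longrightarrow> \<Phi> i a = \<Phi> i b"
  obtains a where "\<And>i. a i = \<Phi> i a"
proof -
  let ?H = "\<lambda>a i. \<Phi> i a"
  have "adm_wf less_than ?H"
    unfolding adm_wf_def
  proof (intro allI impI)
    fix f h :: "nat \<Rightarrow> 'a" and i assume "\<forall>z. (z, i) \<in> less_than \<longrightarrow> f z = h z"
    then show "\<Phi> i f = \<Phi> i h" by (intro assms) simp
  qed
  then have "wfrec less_than ?H = ?H (wfrec less_than ?H)" by (intro wfrec_fixpoint) auto
  from fun_cong[OF this] show thesis by (rule that)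
qed

text \<open>\<open>F4\<close> is the common consequence of the two alternatives for \<gamma>: an
  estimate of the Hausdorff measure alone, where the factor 2 is the price of a passage through the
  Kuratowski measure.\<close>

locale volterra_inclusion =
  fixes T :: real and x0 :: "'a::{real_inner,banach,second_countable_topology}"
    and F :: "real \<Rightarrow> 'a \<Rightarrow> 'a set"
    and c d k :: "real \<Rightarrow> real"
    and g :: "real \<Rightarrow> real \<Rightarrow> 'a \<Rightarrow> 'a"
    and \<sigma> :: "real \<Rightarrow> real \<Rightarrow> real"
    and D :: "(real \<times> real) set"
  assumes D_def: "D = {(t, s). t \<in> {0..T} \<and> s \<in> {0..T} \<and> s \<le> t}"
    and T_pos: "T > 0"
    and F_values: "\<And>t v. t \<in> {0..T} \<Longrightarrow> F t v \<noteq> {} \<and> closed (F t v) \<and> convex (F t v)"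
    and F1: "\<And>v. measurable_multimap T (\<lambda>t. F t v)"
    and F2: "AE t in lebesgue_on {0..T}. usc_into_weak (F t)"
    and F3: "integrable (lebesgue_on {0..T}) c" "integrable (lebesgue_on {0..T}) d"
            "\<And>t. t \<in> {0..T} \<Longrightarrow> 0 \<le> c t" "\<And>t. t \<in> {0..T} \<Longrightarrow> 0 \<le> d t"
            "AE t in lebesgue_on {0..T}. \<forall>v. (INF w\<in>F t v. norm w) \<le> c t * norm v + d t"
    and F4: "integrable (lebesgue_on {0..T}) k" "\<And>t. t \<in> {0..T} \<Longrightarrow> 0 \<le> k t"
            "AE t in lebesgue_on {0..T}. \<forall>A b. bounded A \<longrightarrow> 0 \<le> b \<longrightarrow> hausdorff_mnc A \<le> ereal b \<longrightarrow>
                hausdorff_mnc (\<Union>a\<in>A. F t a) \<le> ereal (2 * k t * b)"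
    and g1: "\<And>v. (\<lambda>(t, s). g t s v) \<in> borel_measurable (lebesgue_on ({0..T} \<times> {0..T}))"
    and g2: "\<And>\<rho>. \<rho> > 0 \<Longrightarrow> \<exists>\<mu>. integrable (lebesgue_on {0..T}) \<mu> \<and> (\<forall>t\<in>{0..T}. \<mu> t \<ge> 0) \<and>
               (\<forall>t s x y. (t, s) \<in> D \<and> norm x \<le> \<rho> \<and> norm y \<le> \<rho> \<longrightarrow>
                  norm (g t s x - g t s y) \<le> \<mu> t * norm (x - y))"
    and g3: "integrable (lebesgue_on D) (\<lambda>(t, s). \<sigma> t s)"
            "\<And>t s. (t, s) \<in> D \<Longrightarrow> 0 \<le> \<sigma> t s"
            "\<And>t s x. (t, s) \<in> D \<Longrightarrow> norm (g t s x) \<le> \<sigma> t s * (1 + norm x)"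
begin

abbreviation "r \<equiv> r_fun x0 c d \<sigma>"
abbreviation "\<psi> \<equiv> psi_fun x0 c d \<sigma>"
abbreviation "L \<equiv> lebesgue_on {0..T}"

definition "\<sigma>bar t = integral\<^sup>L (lebesgue_on {0..t}) (\<sigma> t)"
definition "\<sigma>r t = integral\<^sup>L (lebesgue_on {0..t}) (\<lambda>s. \<sigma> t s * r s)"

lemma D_sets: "D \<in> sets lebesgue"
  unfolding D_def by (rule triangle_in_sets_lebesgue)

lemma D_iff: "t \<in> {0..T} \<Longrightarrow> (t, s) \<in> D \<longleftrightarrow> s \<in> {0..t}"
  by (auto simp: D_def)

lemma Fubini_D:
  fixes u :: "real \<Rightarrow> real \<Rightarrow> 'c::{banach,second_countable_topology}"
  assumes "integrable (lebesgue_on D) (\<lambda>(t, s). u t s)"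
  shows "AE t in L. integrable (lebesgue_on {0..t}) (u t)"
    and "integrable L (\<lambda>t. integral\<^sup>L (lebesgue_on {0..t}) (u t))"
  using triangle_Fubini[of T u] assms by (auto simp: D_def)

lemma \<sigma>_section: "AE t in L. integrable (lebesgue_on {0..t}) (\<sigma> t)"
  and \<sigma>bar_integrable: "integrable L \<sigma>bar"
  using Fubini_D[OF g3(1)] by (auto simp: \<sigma>bar_def[abs_def])

lemma \<sigma>bar_nonneg: "t \<in> {0..T} \<Longrightarrow> 0 \<le> \<sigma>bar t"
  unfolding \<sigma>bar_def using g3(2) D_iff by (intro integral_nonneg_AE AE_I2) auto

lemma r_eq: "r = (\<lambda>t. norm x0 * exp (integral\<^sup>L (lebesgue_on {0..t}) (\<lambda>s. c s + \<sigma>bar s)) +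
      integral\<^sup>L (lebesgue_on {0..t}) (\<lambda>s. (d s + \<sigma>bar s) * exp (integral\<^sup>L (lebesgue_on {s..t}) (\<lambda>s. c s + \<sigma>bar s))))"
  by (rule ext) (simp add: r_fun_def e_fun_def \<sigma>bar_def)

lemma r_continuous: "continuous_on {0..T} r"
  and r_mono: "\<And>s t. 0 \<le> s \<Longrightarrow> s \<le> t \<Longrightarrow> t \<le> T \<Longrightarrow> r s \<le> r t"
  and r_nonneg: "\<And>t. t \<in> {0..T} \<Longrightarrow> 0 \<le> r t"
  and pr_integrable: "integrable L (\<lambda>s. (c s + \<sigma>bar s) * r s)"
  and r_ineq: "\<And>t. t \<in> {0..T} \<Longrightarrow>
    norm x0 + integral\<^sup>L (lebesgue_on {0..t}) (\<lambda>s. (c s + \<sigma>bar s) * r s + (d s + \<sigma>bar s)) \<le> r t"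
proof -
  have p: "integrable L (\<lambda>s. c s + \<sigma>bar s)" "\<And>t. t \<in> {0..T} \<Longrightarrow> 0 \<le> c t + \<sigma>bar t"
    and q: "integrable L (\<lambda>s. d s + \<sigma>bar s)" "\<And>t. t \<in> {0..T} \<Longrightarrow> 0 \<le> d t + \<sigma>bar t"
    using F3 \<sigma>bar_integrable \<sigma>bar_nonneg by auto
  show "continuous_on {0..T} r" unfolding r_eq by (rule linear_integral_inequality(1)[OF p(1) _ q(1)]) (use p q in auto)
  have "mono_on {0..T} r" unfolding r_eq by (rule linear_integral_inequality(2)[OF p(1) _ q(1)]) (use p q in auto)
  then show "r s \<le> r t" if "0 \<le> s" "s \<le> t" "t \<le> T" for s t
    using that by (auto simp: mono_on_def)
  show "0 \<le> r t" if "t \<in> {0..T}" for t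
    unfolding r_eq by (rule linear_integral_inequality(3)[OF p(1) _ q(1)]) (use p q that in auto)
  show "integrable L (\<lambda>s. (c s + \<sigma>bar s) * r s)"
    unfolding r_eq by (rule linear_integral_inequality(4)[OF p(1) _ q(1)]) (use p q in auto)
  show "norm x0 + integral\<^sup>L (lebesgue_on {0..t}) (\<lambda>s. (c s + \<sigma>bar s) * r s + (d s + \<sigma>bar s)) \<le> r t"
    if "t \<in> {0..T}" for t
    unfolding r_eq by (rule linear_integral_inequality(5)[OF p(1) _ q(1)]) (use p q that in auto)
qed

lemma r_le_rT: "t \<in> {0..T} \<Longrightarrow> r t \<le> r T"
  by (rule r_mono) auto

lemma norm_x0_le_r: "t \<in> {0..T} \<Longrightarrow> norm x0 \<le> r t"
proof -
  assume t: "t \<in> {0..T}"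
  have "0 \<le> integral\<^sup>L (lebesgue_on {0..t}) (\<lambda>s. (c s + \<sigma>bar s) * r s + (d s + \<sigma>bar s))"
    using F3 \<sigma>bar_nonneg r_nonneg t
    by (intro integral_nonneg_AE AE_I2 add_nonneg_nonneg mult_nonneg_nonneg) auto
  then show ?thesis using r_ineq[OF t] by linarith
qed

lemma r_measurable: "r \<in> borel_measurable L"
  using r_continuous by (rule continuous_imp_measurable_on_sets_lebesgue) auto

lemma \<sigma>_times_r_integrable: "integrable (lebesgue_on D) (\<lambda>(t, s). \<sigma> t s * r s)"
proof (rule Bochner_Integration.integrable_bound[of _ "\<lambda>z. r T * (case z of (t, s) \<Rightarrow> \<sigma> t s)"])
  show "integrable (lebesgue_on D) (\<lambda>z. r T * (case z of (t, s) \<Rightarrow> \<sigma> t s))" using g3(1) by simp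
  have "continuous_on D (\<lambda>z. r (snd z))"
    by (rule continuous_on_compose2[OF r_continuous]) (auto simp: D_def intro!: continuous_intros)
  then have "(\<lambda>z. r (snd z)) \<in> borel_measurable (lebesgue_on D)"
    using D_sets by (rule continuous_imp_measurable_on_sets_lebesgue)
  then have "(\<lambda>z. (case z of (t, s) \<Rightarrow> \<sigma> t s) * r (snd z)) \<in> borel_measurable (lebesgue_on D)"
    using g3(1) by (intro borel_measurable_times) auto
  then show "(\<lambda>(t, s). \<sigma> t s * r s) \<in> borel_measurable (lebesgue_on D)" by (simp add: case_prod_beta')
  show "AE z in lebesgue_on D. norm (case z of (t, s) \<Rightarrow> \<sigma> t s * r s) \<le> norm (r T * (case z of (t, s) \<Rightarrow> \<sigma> t s))"
  proof (rule AE_I2)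
    fix z assume "z \<in> space (lebesgue_on D)"
    then obtain t s where z: "z = (t, s)" "(t, s) \<in> D" by (cases z) auto
    then have s: "s \<in> {0..T}" by (auto simp: D_def)
    have "\<sigma> t s * r s \<le> \<sigma> t s * r T" using g3(2)[OF z(2)] r_le_rT[OF s] by (rule mult_left_mono[rotated])
    then show "norm (case z of (t, s) \<Rightarrow> \<sigma> t s * r s) \<le> norm (r T * (case z of (t, s) \<Rightarrow> \<sigma> t s))"
      using g3(2)[OF z(2)] r_nonneg[OF s] r_nonneg[of T] T_pos by (simp add: z abs_mult mult.commute)
  qed
qed

lemma \<sigma>r_section: "AE t in L. integrable (lebesgue_on {0..t}) (\<lambda>s. \<sigma> t s * r s)"
  and \<sigma>r_integrable: "integrable L \<sigma>r"
  using Fubini_D[OF \<sigma>_times_r_integrable] by (auto simp: \<sigma>r_def[abs_def])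

lemma \<sigma>r_nonneg: "t \<in> {0..T} \<Longrightarrow> 0 \<le> \<sigma>r t"
  unfolding \<sigma>r_def using g3(2) D_iff r_nonneg by (intro integral_nonneg_AE AE_I2 mult_nonneg_nonneg) auto

lemma \<psi>_eq: "\<psi> t = c t * r t + d t + \<sigma>bar t + \<sigma>r t"
  by (simp add: psi_fun_def \<sigma>bar_def \<sigma>r_def)

lemma cr_integrable: "integrable L (\<lambda>t. c t * r t)"
proof (rule Bochner_Integration.integrable_bound[OF pr_integrable])
  show "(\<lambda>t. c t * r t) \<in> borel_measurable L" using F3(1) r_measurable by (intro borel_measurable_times) auto
  show "AE t in L. norm (c t * r t) \<le> norm ((c t + \<sigma>bar t) * r t)"
    using F3(3) \<sigma>bar_nonneg r_nonneg by (intro AE_I2) (auto simp: abs_mult intro!: mult_right_mono)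
qed

lemma \<psi>_integrable: "integrable L \<psi>"
  unfolding \<psi>_eq[abs_def] using cr_integrable F3(2) \<sigma>bar_integrable \<sigma>r_integrable by auto

lemma \<psi>_nonneg: "t \<in> {0..T} \<Longrightarrow> 0 \<le> \<psi> t"
  unfolding \<psi>_eq using F3(3,4) r_nonneg \<sigma>bar_nonneg \<sigma>r_nonneg by simp

text \<open>Since \<open>r\<close> increases, the memory term at time \<open>s\<close> is at most
  \<open>\<sigma>bar s * r s\<close>, so \<psi> is dominated by the expression for which
  \<open>r\<close> is a supersolution. This closes the a priori estimate: a speed bounded by \<psi>
  keeps the state below \<open>r\<close>.\<close>

lemma \<psi>_integral_le_r:
  assumes t: "t \<in> {0..T}"
  shows "norm x0 + integral\<^sup>L (lebesgue_on {0..t}) \<psi> \<le> r t"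
proof -
  have "AE s in L. \<psi> s \<le> (c s + \<sigma>bar s) * r s + (d s + \<sigma>bar s)"
    using \<sigma>_section \<sigma>r_section AE_space
  proof eventually_elim
    case (elim s)
    then have s: "s \<in> {0..T}" by simp
    have "\<sigma>r s \<le> integral\<^sup>L (lebesgue_on {0..s}) (\<lambda>\<tau>. \<sigma> s \<tau> * r s)"
      unfolding \<sigma>r_def
    proof (rule integral_mono[OF elim(2)])
      show "integrable (lebesgue_on {0..s}) (\<lambda>\<tau>. \<sigma> s \<tau> * r s)" using elim(1) by simp
      fix \<tau> assume "\<tau> \<in> space (lebesgue_on {0..s})"
      then show "\<sigma> s \<tau> * r \<tau> \<le> \<sigma> s \<tau> * r s"
        using g3(2)[of s \<tau>] D_iff[OF s] r_mono[of \<tau> s] s by (intro mult_left_mono) auto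
    qed
    then have "\<sigma>r s \<le> \<sigma>bar s * r s" by (simp add: \<sigma>bar_def)
    then show ?case by (simp add: \<psi>_eq algebra_simps)
  qed
  then have "AE s in lebesgue_on {0..t}. \<psi> s \<le> (c s + \<sigma>bar s) * r s + (d s + \<sigma>bar s)"
    by (rule AE_lebesgue_on_subset) (use t in auto)
  moreover have "integrable L (\<lambda>s. (c s + \<sigma>bar s) * r s + (d s + \<sigma>bar s))"
    using pr_integrable F3(2) \<sigma>bar_integrable by auto
  then have "integrable (lebesgue_on {0..t}) (\<lambda>s. (c s + \<sigma>bar s) * r s + (d s + \<sigma>bar s))"
    by (rule integrable_lebesgue_on_subset) (use t in auto)
  moreover have "integrable (lebesgue_on {0..t}) \<psi>"
    by (rule integrable_lebesgue_on_subset[OF \<psi>_integrable]) (use t in auto)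
  ultimately have "integral\<^sup>L (lebesgue_on {0..t}) \<psi> \<le> integral\<^sup>L (lebesgue_on {0..t}) (\<lambda>s. (c s + \<sigma>bar s) * r s + (d s + \<sigma>bar s))"
    by (intro integral_mono_AE)
  then show ?thesis using r_ineq[OF t] by linarith
qed

text \<open>Measurability of the composed kernel is built in because \<open>g1\<close> grants it
  only for a fixed state. It holds for step functions by countably many cases, and it passes to
  pointwise limits by the Lipschitz condition on \<open>g\<close>.\<close>

definition admissible :: "(real \<Rightarrow> 'a) \<Rightarrow> bool" where
  "admissible z \<longleftrightarrow> (\<lambda>(t, s). g t s (z s)) \<in> borel_measurable (lebesgue_on D) \<and> (\<forall>s\<in>{0..T}. norm (z s) \<le> r s)"

definition "G z t = integral\<^sup>L (lebesgue_on {0..t}) (\<lambda>s. g t s (z s))"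

lemma norm_g_admissible:
  assumes "admissible z" "(t, s) \<in> D"
  shows "norm (g t s (z s)) \<le> \<sigma> t s + \<sigma> t s * r s"
proof -
  have "s \<in> {0..T}" using assms(2) by (auto simp: D_def)
  then have "\<sigma> t s * (1 + norm (z s)) \<le> \<sigma> t s * (1 + r s)"
    using assms g3(2)[OF assms(2)] by (intro mult_left_mono) (auto simp: admissible_def)
  then show ?thesis using g3(3)[OF assms(2), of "z s"] by (simp add: distrib_left)
qed

lemma
  assumes z: "admissible z"
  shows g_section: "AE t in L. integrable (lebesgue_on {0..t}) (\<lambda>s. g t s (z s))"
    and G_integrable: "integrable L (G z)"
    and norm_G_le: "AE t in L. norm (G z t) \<le> \<sigma>bar t + \<sigma>r t"
proof -
  have "integrable (lebesgue_on D) (\<lambda>(t, s). g t s (z s))"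
  proof (rule Bochner_Integration.integrable_bound[of _ "\<lambda>w. (case w of (t, s) \<Rightarrow> \<sigma> t s) + (case w of (t, s) \<Rightarrow> \<sigma> t s * r s)"])
    show "integrable (lebesgue_on D) (\<lambda>w. (case w of (t, s) \<Rightarrow> \<sigma> t s) + (case w of (t, s) \<Rightarrow> \<sigma> t s * r s))"
      using g3(1) \<sigma>_times_r_integrable by (rule Bochner_Integration.integrable_add)
    show "(\<lambda>(t, s). g t s (z s)) \<in> borel_measurable (lebesgue_on D)" using z by (simp add: admissible_def)
    show "AE w in lebesgue_on D. norm (case w of (t, s) \<Rightarrow> g t s (z s)) \<le>
        norm ((case w of (t, s) \<Rightarrow> \<sigma> t s) + (case w of (t, s) \<Rightarrow> \<sigma> t s * r s))"
      using norm_g_admissible[OF z] by (intro AE_I2) (force simp: case_prod_beta')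
  qed
  note * = Fubini_D[OF this]
  show "AE t in L. integrable (lebesgue_on {0..t}) (\<lambda>s. g t s (z s))" by (rule *(1))
  show "integrable L (G z)" using *(2) by (simp add: G_def[abs_def])
  show "AE t in L. norm (G z t) \<le> \<sigma>bar t + \<sigma>r t"
    using \<sigma>_section \<sigma>r_section AE_space
  proof eventually_elim
    case (elim t)
    then have t: "t \<in> {0..T}" by simp
    have "norm (G z t) \<le> integral\<^sup>L (lebesgue_on {0..t}) (\<lambda>s. \<sigma> t s + \<sigma> t s * r s)"
      unfolding G_def
    proof (rule norm_integral_le_AE)
      show "integrable (lebesgue_on {0..t}) (\<lambda>s. \<sigma> t s + \<sigma> t s * r s)" using elim by auto
      show "AE s in lebesgue_on {0..t}. norm (g t s (z s)) \<le> \<sigma> t s + \<sigma> t s * r s"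
        using norm_g_admissible[OF z] D_iff[OF t] by (intro AE_I2) auto
    qed
    then show ?case using elim by (simp add: \<sigma>bar_def \<sigma>r_def)
  qed
qed

lemma admissible_limit:
  assumes z: "\<And>n. admissible (z n)" and lim: "\<And>s. s \<in> {0..T} \<Longrightarrow> (\<lambda>n. z n s) \<longlonglongrightarrow> y s"
  shows "admissible y" and "(t, s) \<in> D \<Longrightarrow> (\<lambda>n. g t s (z n s)) \<longlonglongrightarrow> g t s (y s)"
proof -
  have zr: "norm (z n s) \<le> r s" if "s \<in> {0..T}" for n s using z that by (auto simp: admissible_def)
  have yr: "norm (y s) \<le> r s" if "s \<in> {0..T}" for s
    using tendsto_norm[OF lim[OF that]] zr[OF that] by (intro LIMSEQ_le_const2) auto
  \<comment> \<open>\<open>r T\<close> may be 0, whereas \<open>g2\<close> asks for a positive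
    radius.\<close>
  have "0 < r T + 1" using r_nonneg[of T] T_pos by simp
  then obtain \<mu> where \<mu>: "\<And>t s x y. (t, s) \<in> D \<Longrightarrow> norm x \<le> r T + 1 \<Longrightarrow> norm y \<le> r T + 1 \<Longrightarrow>
      norm (g t s x - g t s y) \<le> \<mu> t * norm (x - y)"
    using g2[of "r T + 1"] by metis
  have conv: "(\<lambda>n. g t s (z n s)) \<longlonglongrightarrow> g t s (y s)" if ts: "(t, s) \<in> D" for t s
  proof -
    have s: "s \<in> {0..T}" using ts by (auto simp: D_def)
    have "(\<lambda>n. \<mu> t * norm (z n s - y s)) \<longlonglongrightarrow> \<mu> t * norm (y s - y s)" by (intro tendsto_intros lim s)
    then have "(\<lambda>n. \<mu> t * norm (z n s - y s)) \<longlonglongrightarrow> 0" by simp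
    then have "(\<lambda>n. norm (g t s (z n s) - g t s (y s))) \<longlonglongrightarrow> 0"
    proof (rule tendsto_sandwich[OF _ _ tendsto_const, rotated 2])
      have "norm (g t s (z n s) - g t s (y s)) \<le> \<mu> t * norm (z n s - y s)" for n
        using zr[OF s, of n] yr[OF s] r_le_rT[OF s] by (intro \<mu>[OF ts]) auto
      then show "\<forall>\<^sub>F n in sequentially. norm (g t s (z n s) - g t s (y s)) \<le> \<mu> t * norm (z n s - y s)" by simp
    qed auto
    then show ?thesis using Lim_null tendsto_norm_zero_iff by blast
  qed
  then show "(t, s) \<in> D \<Longrightarrow> (\<lambda>n. g t s (z n s)) \<longlonglongrightarrow> g t s (y s)" .
  have "(\<lambda>w. case w of (t, s) \<Rightarrow> g t s (y s)) \<in> borel_measurable (lebesgue_on D)"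
    by (rule borel_measurable_LIMSEQ_metric[of "\<lambda>n w. case w of (t, s) \<Rightarrow> g t s (z n s)"])
      (use z conv in \<open>auto simp: admissible_def\<close>)
  then show "admissible y" using yr by (simp add: admissible_def)
qed

definition "sel t v = (SOME p. p \<in> F t v \<and> (\<forall>w\<in>F t v. norm p \<le> norm w))"

lemma sel: assumes "t \<in> {0..T}" shows "sel t v \<in> F t v" "w \<in> F t v \<Longrightarrow> norm (sel t v) \<le> norm w"
proof -
  have "\<exists>p. p \<in> F t v \<and> (\<forall>w\<in>F t v. norm p \<le> norm w)"
    using min_norm_exists[of "F t v"] F_values[OF assms, of v] by metis
  then have "sel t v \<in> F t v \<and> (\<forall>w\<in>F t v. norm (sel t v) \<le> norm w)" unfolding sel_def by (rule someI_ex)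
  then show "sel t v \<in> F t v" "w \<in> F t v \<Longrightarrow> norm (sel t v) \<le> norm w" by auto
qed

lemma sel_measurable: "(\<lambda>t. sel t v) \<in> borel_measurable L"
proof (rule min_norm_selection_measurable[of L "\<lambda>t. F t v"])
  show "open U \<Longrightarrow> {t \<in> space L. F t v \<inter> U \<noteq> {}} \<in> sets L" for U
    using F1[of v] by (simp add: measurable_multimap_def)
qed (use F_values sel in auto)

text \<open>The exceptional null set does not depend on \<open>v\<close>, which permits the
  insertion of states that vary with \<open>t\<close>.\<close>

lemma norm_sel_le: "AE t in L. \<forall>v. norm (sel t v) \<le> c t * norm v + d t"
  using F3(5) AE_space
proof eventually_elim
  case (elim t)
  show ?case
  proof
    fix v
    have t: "t \<in> {0..T}" using elim by simp
    have "norm (sel t v) \<le> (INF w\<in>F t v. norm w)"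
      using F_values[OF t, of v] sel(2)[OF t] by (intro cINF_greatest) auto
    then show "norm (sel t v) \<le> c t * norm v + d t" using elim(1) by (meson order_trans)
  qed
qed

end

context volterra_inclusion begin

section \<open>Uniform grids and Euler polygons\<close>

definition "node n i = real i * T / real (Suc n)"
text \<open>Cell \<open>i\<close> reaches from \<open>node n i\<close>, exclusive, to
  \<open>node n (Suc i)\<close>, inclusive; truncated subtraction puts \<open>s = 0\<close> into
  cell 0 as well.\<close>

definition "cell n s = nat \<lceil>s * real (Suc n) / T\<rceil> - 1"

lemma cell_node:
  assumes "0 \<le> s"
  shows "node n (cell n s) \<le> s" "s - node n (cell n s) \<le> T / real (Suc n)" "0 \<le> node n i"
    "0 < i \<Longrightarrow> s \<le> node n i \<Longrightarrow> cell n s < i"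
proof -
  define y where "y = s * real (Suc n) / T"
  have y: "0 \<le> y" "s = y * (T / real (Suc n))" using assms T_pos by (auto simp: y_def)
  have h: "0 < T / real (Suc n)" using T_pos by simp
  define m where "m = nat \<lceil>y\<rceil>"
  have m: "y \<le> real m" "real m < y + 1" using y(1) by (auto simp: m_def) linarith
  have cm: "cell n s = m - 1" by (simp add: cell_def m_def y_def)
  have nd: "node n j = real j * (T / real (Suc n))" for j by (simp add: node_def)
  have 1: "real (m - 1) \<le> y" "y - real (m - 1) \<le> 1" using m y(1) by (cases "m = 0"; simp; linarith)+
  have "real (m - 1) * (T / real (Suc n)) \<le> y * (T / real (Suc n))" using 1(1) h by (intro mult_right_mono) auto
  then show "node n (cell n s) \<le> s" unfolding cm nd using y(2) by simp
  have "s - node n (cell n s) = (y - real (m - 1)) * (T / real (Suc n))"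
    unfolding cm nd left_diff_distrib using y(2) by simp
  also have "\<dots> \<le> 1 * (T / real (Suc n))" using 1(2) h by (intro mult_right_mono) auto
  finally show "s - node n (cell n s) \<le> T / real (Suc n)" by simp
  show "0 \<le> node n i" using T_pos by (simp add: node_def)
  show "cell n s < i" if "0 < i" "s \<le> node n i"
  proof -
    have "y * (T / real (Suc n)) \<le> real i * (T / real (Suc n))" using that(2) y(2) unfolding nd by simp
    then have "y \<le> real i" using h by (rule mult_right_le_imp_le)
    then have "m \<le> i" unfolding m_def by (simp add: nat_le_iff ceiling_le_iff)
    then show ?thesis using cm that by simp
  qed
qed

lemma node_le: "i \<le> Suc n \<Longrightarrow> node n i \<in> {0..T}"
proof -
  assume "i \<le> Suc n"
  then have "real i * T \<le> real (Suc n) * T" using T_pos by (intro mult_right_mono) auto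
  then show ?thesis using T_pos by (simp add: node_def divide_le_eq mult.commute)
qed

lemma cell_le:
  assumes "s \<in> {0..T}" shows "cell n s \<le> n"
proof -
  have "s \<le> node n (Suc n)" using assms by (simp add: node_def)
  then show ?thesis using cell_node(4)[of s "Suc n" n] assms by auto
qed

lemma cell_measurable: "cell n \<in> measurable borel (count_space UNIV)"
proof -
  have "(\<lambda>s::real. \<lceil>s * real (Suc n) / T\<rceil>) \<in> measurable borel (count_space UNIV)" by measurable
  then show ?thesis unfolding cell_def by (rule measurable_compose) simp
qed

text \<open>On each cell the state is one frozen value, so \<open>sel_measurable\<close> applies
  there, and there are countably many cells.\<close>

lemma step_sel_measurable: "(\<lambda>t. sel t (a (cell n t))) \<in> borel_measurable L"
proof (rule measurable_compose_countable[where f="\<lambda>i t. sel t (a i)" and g="cell n"])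
  show "(\<lambda>t. sel t (a i)) \<in> borel_measurable L" for i by (rule sel_measurable)
  have "cell n \<in> measurable lebesgue (count_space UNIV)"
    using cell_measurable by (intro measurable_completion) simp
  then show "cell n \<in> measurable L (count_space UNIV)" by (rule measurable_restrict_space1)
qed

text \<open>The node belonging to \<open>s\<close> lies to its left and \<open>r\<close> increases,
  so bounds at the nodes extend to the cells.\<close>

lemma step_admissible:
  assumes "\<And>j. j \<le> n \<Longrightarrow> norm (a j) \<le> r (node n j)"
  shows "admissible (\<lambda>s. a (cell n s))"
  unfolding admissible_def
proof (intro conjI ballI)
  have "(\<lambda>w. (\<lambda>i w. g (fst w) (snd w) (a i)) (cell n (snd w)) w) \<in> borel_measurable (lebesgue_on D)"
  proof (rule measurable_compose_countable)
    fix i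
    have "(\<lambda>(t, s). g t s (a i)) \<in> borel_measurable (restrict_space (lebesgue_on ({0..T} \<times> {0..T})) D)"
      using g1[of "a i"] by (rule measurable_restrict_space1)
    also have "restrict_space (lebesgue_on ({0..T} \<times> {0..T})) D = lebesgue_on D"
    proof -
      have "{0..T} \<times> {0..T} \<in> sets (borel :: (real \<times> real) measure)" by (intro borel_closed closed_Times) auto
      then have "{0..T} \<times> {0..T} \<in> sets (lebesgue :: (real \<times> real) measure)" by simp
      moreover have "({0..T} \<times> {0..T}) \<inter> D = D" by (auto simp: D_def)
      ultimately show ?thesis using D_sets by (simp add: restrict_restrict_space)
    qed
    finally show "(\<lambda>w. g (fst w) (snd w) (a i)) \<in> borel_measurable (lebesgue_on D)" by (simp add: case_prod_beta')
  next
    have "(snd :: real \<times> real \<Rightarrow> real) \<in> measurable borel borel"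
      by (intro borel_measurable_continuous_onI continuous_intros)
    then have "(snd :: real \<times> real \<Rightarrow> real) \<in> measurable lebesgue borel" by (intro measurable_completion) simp
    then have "(\<lambda>w. cell n (snd w)) \<in> measurable (lebesgue :: (real \<times> real) measure) (count_space UNIV)"
      using cell_measurable by (rule measurable_compose)
    then show "(\<lambda>w. cell n (snd w)) \<in> measurable (lebesgue_on D) (count_space UNIV)" by (rule measurable_restrict_space1)
  qed
  then show "(\<lambda>(t, s). g t s (a (cell n s))) \<in> borel_measurable (lebesgue_on D)" by (simp add: case_prod_beta')
  fix s assume s: "s \<in> {0..T}"
  have "norm (a (cell n s)) \<le> r (node n (cell n s))" using assms cell_le[OF s] by blast
  also have "\<dots> \<le> r s" using cell_node[of s] s by (intro r_mono) auto
  finally show "norm (a (cell n s)) \<le> r s" .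
qed

lemma norm_rate_le:
  assumes z: "admissible z"
  shows "AE t in L. norm (sel t (z t)) \<le> c t * r t + d t"
    and "AE t in L. norm (sel t (z t) + G z t) \<le> \<psi> t"
proof -
  show *: "AE t in L. norm (sel t (z t)) \<le> c t * r t + d t"
    using norm_sel_le AE_space
  proof eventually_elim
    case (elim t)
    then have t: "t \<in> {0..T}" by simp
    have "norm (sel t (z t)) \<le> c t * norm (z t) + d t" using elim(1) by blast
    also have "\<dots> \<le> c t * r t + d t" using F3(3)[OF t] z t by (auto simp: admissible_def intro!: mult_left_mono)
    finally show ?case .
  qed
  show "AE t in L. norm (sel t (z t) + G z t) \<le> \<psi> t"
    using * norm_G_le[OF z]
  proof eventually_elim
    case (elim t)
    then show ?case using norm_triangle_ineq[of "sel t (z t)" "G z t"] by (simp add: \<psi>_eq)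
  qed
qed

lemma rate_integrable:
  assumes "admissible z" "(\<lambda>t. sel t (z t)) \<in> borel_measurable L"
  shows "integrable L (\<lambda>t. sel t (z t))" "integrable L (\<lambda>t. sel t (z t) + G z t)"
proof -
  show "integrable L (\<lambda>t. sel t (z t))"
  proof (rule Bochner_Integration.integrable_bound[of _ "\<lambda>t. c t * r t + d t"])
    show "AE t in L. norm (sel t (z t)) \<le> norm (c t * r t + d t)"
      using norm_rate_le(1)[OF assms(1)] by eventually_elim auto
  qed (use cr_integrable F3(2) assms(2) in auto)
  then show "integrable L (\<lambda>t. sel t (z t) + G z t)" using G_integrable[OF assms(1)] by (rule Bochner_Integration.integrable_add)
qed

text \<open>The value at a node depends only on earlier nodes since the cells are left-open intervals.\<close>

lemma euler_scheme:
  obtains a where "admissible (\<lambda>s. a (cell n s))"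
    "\<And>i. a i = x0 + integral\<^sup>L (lebesgue_on {0..node n i}) (\<lambda>t. sel t (a (cell n t)) + G (\<lambda>s. a (cell n s)) t)"
proof -
  define \<Phi> where "\<Phi> i a = x0 + integral\<^sup>L (lebesgue_on {0..node n i}) (\<lambda>t. sel t (a (cell n t)) + G (\<lambda>s. a (cell n s)) t)" for i and a :: "nat \<Rightarrow> 'a"
  have \<Phi>_cong: "\<Phi> i a = \<Phi> i b" if ab: "\<And>j. j < i \<Longrightarrow> a j = b j" for i a b
  \<comment> \<open>For \<open>i = 0\<close> the integral runs over a single point, whose cell has
    index 0 and is not below \<open>i\<close>.\<close>
  proof (cases "i = 0")
    case True
    then show ?thesis unfolding \<Phi>_def node_def by (simp only: of_nat_0 mult_zero_left div_0 integral_lebesgue_on_point)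
  next
    case False
    have eq: "a (cell n t) = b (cell n t)" if "0 \<le> t" "t \<le> node n i" for t
      using ab cell_node(4)[OF that(1) _ that(2)] False by simp
    have "G (\<lambda>s. a (cell n s)) t = G (\<lambda>s. b (cell n s)) t" if "0 \<le> t" "t \<le> node n i" for t
      unfolding G_def using eq that by (intro Bochner_Integration.integral_cong) auto
    then show ?thesis unfolding \<Phi>_def using eq by (intro arg_cong2[where f="(+)"] Bochner_Integration.integral_cong) auto
  qed
  obtain a where a: "\<And>i. a i = \<Phi> i a" using course_of_values_fixpoint[of \<Phi>] \<Phi>_cong by blast
  have bound: "norm (a i) \<le> r (node n i)" if "i \<le> Suc n" for i
    using that
  proof (induction i rule: less_induct)
    case (less i)
    \<comment> \<open>\<open>step_admissible\<close> asks for bounds at all nodes, but the induction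
      supplies only the earlier ones. The other values are replaced by \<open>x0\<close>, whose norm
      \<open>r\<close> dominates throughout and which \<open>\<Phi> i\<close> does not see.\<close>
    define b where "b j = (if j < i then a j else x0)" for j
    have "norm (b j) \<le> r (node n j)" if "j \<le> n" for j
      using less.IH[of j] less.prems norm_x0_le_r[OF node_le[of j n]] that by (auto simp: b_def)
    then have adm: "admissible (\<lambda>s. b (cell n s))" by (rule step_admissible)
    have "a i = \<Phi> i b" using a \<Phi>_cong[of i a b] by (simp add: b_def)
    then have "norm (a i) \<le> norm x0 + norm (integral\<^sup>L (lebesgue_on {0..node n i}) (\<lambda>t. sel t (b (cell n t)) + G (\<lambda>s. b (cell n s)) t))"
      unfolding \<Phi>_def by (simp add: norm_triangle_ineq)
    also have "\<dots> \<le> norm x0 + integral\<^sup>L (lebesgue_on {0..node n i}) \<psi>"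
    proof -
      have "norm (integral\<^sup>L (lebesgue_on {0..node n i}) (\<lambda>t. sel t (b (cell n t)) + G (\<lambda>s. b (cell n s)) t)) \<le> integral\<^sup>L (lebesgue_on {0..node n i}) \<psi>"
      proof (rule norm_integral_le_AE)
        show "integrable (lebesgue_on {0..node n i}) \<psi>"
          by (rule integrable_lebesgue_on_subset[OF \<psi>_integrable]) (use node_le[OF less.prems] in auto)
        show "AE t in lebesgue_on {0..node n i}. norm (sel t (b (cell n t)) + G (\<lambda>s. b (cell n s)) t) \<le> \<psi> t"
          by (rule AE_lebesgue_on_subset[OF norm_rate_le(2)[OF adm]]) (use node_le[OF less.prems] in auto)
      qed
      then show ?thesis by simp
    qed
    also have "\<dots> \<le> r (node n i)" by (rule \<psi>_integral_le_r[OF node_le[OF less.prems]])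
    finally show ?case .
  qed
  show thesis
  proof (rule that[of a])
    show "admissible (\<lambda>s. a (cell n s))" using bound by (intro step_admissible) auto
    show "a i = x0 + integral\<^sup>L (lebesgue_on {0..node n i}) (\<lambda>t. sel t (a (cell n t)) + G (\<lambda>s. a (cell n s)) t)" for i
      using a[of i] by (simp add: \<Phi>_def)
  qed
qed

text \<open>\<open>z\<close> is the step function of node values and lags behind the polygon
  \<open>X\<close> by at most one mesh width. The passage to the limit rests on these four
  properties.\<close>

lemma approximate_solutions:
  obtains X z :: "nat \<Rightarrow> real \<Rightarrow> 'a" where
    "\<And>n. admissible (z n)" "\<And>n. (\<lambda>t. sel t (z n t)) \<in> borel_measurable L"
    "\<And>n t. X n t = x0 + integral\<^sup>L (lebesgue_on {0..t}) (\<lambda>\<tau>. sel \<tau> (z n \<tau>) + G (z n) \<tau>)"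
    "\<And>n t. t \<in> {0..T} \<Longrightarrow> \<exists>s. 0 \<le> s \<and> s \<le> t \<and> t - s \<le> T / real (Suc n) \<and> z n t = X n s"
proof -
  have "\<exists>a. admissible (\<lambda>s. a (cell n s)) \<and>
    (\<forall>i. a i = x0 + integral\<^sup>L (lebesgue_on {0..node n i}) (\<lambda>t. sel t (a (cell n t)) + G (\<lambda>s. a (cell n s)) t))" for n
    using euler_scheme[of n] by metis
  then obtain a where a: "\<And>n. admissible (\<lambda>s. a n (cell n s))"
    "\<And>n i. a n i = x0 + integral\<^sup>L (lebesgue_on {0..node n i}) (\<lambda>t. sel t (a n (cell n t)) + G (\<lambda>s. a n (cell n s)) t)"
    by metis
  show thesis
  proof (rule that[of "\<lambda>n s. a n (cell n s)" "\<lambda>n t. x0 + integral\<^sup>L (lebesgue_on {0..t}) (\<lambda>\<tau>. sel \<tau> (a n (cell n \<tau>)) + G (\<lambda>s. a n (cell n s)) \<tau>)"])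
    show "\<exists>s. 0 \<le> s \<and> s \<le> t \<and> t - s \<le> T / real (Suc n) \<and> a n (cell n t) =
        x0 + integral\<^sup>L (lebesgue_on {0..s}) (\<lambda>\<tau>. sel \<tau> (a n (cell n \<tau>)) + G (\<lambda>s. a n (cell n s)) \<tau>)" if "t \<in> {0..T}" for n t
      by (intro exI[of _ "node n (cell n t)"] conjI a(2)) (use cell_node[of t n] that in auto)
  qed (use a(1) step_sel_measurable in auto)
qed

end

context volterra_inclusion begin

section \<open>Compactness and the limit of the polygons\<close>

text \<open>The source of a modulus of continuity shared by all polygons.\<close>

definition "\<Psi> t = integral\<^sup>L (lebesgue_on {0..t}) \<psi>"

lemma \<Psi>_continuous: "continuous_on {0..T} \<Psi>"
  unfolding \<Psi>_def by (rule indefinite_integral_continuous_real[OF \<psi>_integrable])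

lemma \<Psi>_diff:
  assumes "0 \<le> s" "s \<le> t" "t \<le> T"
  shows "\<Psi> t - \<Psi> s = integral\<^sup>L (lebesgue_on {s..t}) \<psi>" "\<Psi> s \<le> \<Psi> t"
proof -
  have "integrable (lebesgue_on {0..t}) \<psi>"
    by (rule integrable_lebesgue_on_subset[OF \<psi>_integrable]) (use assms in auto)
  from integral_lebesgue_on_split[OF this assms(1,2)]
  show *: "\<Psi> t - \<Psi> s = integral\<^sup>L (lebesgue_on {s..t}) \<psi>" by (simp add: \<Psi>_def)
  have "0 \<le> integral\<^sup>L (lebesgue_on {s..t}) \<psi>"
    using assms \<psi>_nonneg by (intro integral_nonneg_AE AE_I2) auto
  then show "\<Psi> s \<le> \<Psi> t" using * by simp
qed

context
  fixes X z :: "nat \<Rightarrow> real \<Rightarrow> 'a"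
  assumes adm: "\<And>n. admissible (z n)" and smeas: "\<And>n. (\<lambda>t. sel t (z n t)) \<in> borel_measurable L"
    and X_eq: "\<And>n t. X n t = x0 + integral\<^sup>L (lebesgue_on {0..t}) (\<lambda>\<tau>. sel \<tau> (z n \<tau>) + G (z n) \<tau>)"
    and near: "\<And>n t. t \<in> {0..T} \<Longrightarrow> \<exists>s. 0 \<le> s \<and> s \<le> t \<and> t - s \<le> T / real (Suc n) \<and> z n t = X n s"
begin

lemma X_diff_le:
  assumes "0 \<le> s" "s \<le> t" "t \<le> T"
  shows "norm (X n t - X n s) \<le> \<Psi> t - \<Psi> s"
  unfolding X_eq \<Psi>_diff(1)[OF assms] add_diff_cancel_left
  by (rule norm_primitive_diff_le[OF rate_integrable(2)[OF adm smeas] \<psi>_integrable norm_rate_le(2)[OF adm] assms])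

lemma X_equicontinuous:
  assumes "s \<in> {0..T}" "t \<in> {0..T}"
  shows "norm (X n t - X n s) \<le> \<bar>\<Psi> t - \<Psi> s\<bar>"
proof (cases "s \<le> t")
  case True
  then show ?thesis using X_diff_le[of s t n] assms by auto
next
  case False
  then show ?thesis using X_diff_le[of t s n] assms by (auto simp: norm_minus_commute)
qed

lemma norm_X_le:
  assumes t: "t \<in> {0..T}" shows "norm (X n t) \<le> r t"
proof -
  have "X n 0 = x0" unfolding X_eq by (simp only: integral_lebesgue_on_point add_0_right)
  moreover have "\<Psi> 0 = 0" unfolding \<Psi>_def by (rule integral_lebesgue_on_point)
  ultimately have "norm (X n t - x0) \<le> \<Psi> t" using X_diff_le[of 0 t n] t by simp
  then have "norm (X n t) \<le> norm x0 + \<Psi> t" using norm_triangle_sub[of "X n t" x0] by linarith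
  also have "\<dots> \<le> r t" unfolding \<Psi>_def by (rule \<psi>_integral_le_r[OF t])
  finally show ?thesis .
qed

lemma z_X_asymptotic:
  assumes t: "t \<in> {0..T}" shows "(\<lambda>n. z n t - X n t) \<longlonglongrightarrow> 0"
proof -
  obtain s where s: "\<And>n. 0 \<le> s n \<and> s n \<le> t \<and> t - s n \<le> T / real (Suc n) \<and> z n t = X n (s n)"
    using near[OF t] by metis
  have "(\<lambda>n. t - T / real (Suc n)) \<longlonglongrightarrow> t - 0"
    by (intro tendsto_intros LIMSEQ_Suc[OF lim_const_over_n])
  then have "(\<lambda>n. t - T / real (Suc n)) \<longlonglongrightarrow> t" by simp
  then have "s \<longlonglongrightarrow> t"
  proof (rule tendsto_sandwich[OF _ _ _ tendsto_const, rotated 2])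
    have "t - T / real (Suc n) \<le> s n" for n using s[of n] by linarith
    then show "\<forall>\<^sub>F n in sequentially. t - T / real (Suc n) \<le> s n" by simp
    show "\<forall>\<^sub>F n in sequentially. s n \<le> t" using s by simp
  qed
  moreover have "s n \<in> {0..T}" for n using s[of n] t by auto
  ultimately have "(\<lambda>n. \<Psi> (s n)) \<longlonglongrightarrow> \<Psi> t"
    using \<Psi>_continuous t unfolding continuous_on_sequentially o_def by blast
  then have "(\<lambda>n. \<Psi> t - \<Psi> (s n)) \<longlonglongrightarrow> \<Psi> t - \<Psi> t" by (intro tendsto_intros)
  then have "(\<lambda>n. \<Psi> t - \<Psi> (s n)) \<longlonglongrightarrow> 0" by simp
  then have "(\<lambda>n. norm (z n t - X n t)) \<longlonglongrightarrow> 0"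
  proof (rule tendsto_sandwich[OF _ _ tendsto_const, rotated 2])
    have "norm (z n t - X n t) \<le> \<Psi> t - \<Psi> (s n)" for n
      using X_diff_le[of "s n" t n] s[of n] t by (auto simp: norm_minus_commute)
    then show "\<forall>\<^sub>F n in sequentially. norm (z n t - X n t) \<le> \<Psi> t - \<Psi> (s n)" by simp
  qed auto
  then show ?thesis by (rule tendsto_norm_zero_cancel)
qed

text \<open>The exponential weight makes the integral inequality for the measure of noncompactness of the
  approximations halve any bound, so iterating forces it to vanish.\<close>

lemma X_mnc_zero:
  assumes "t \<in> {0..T}"
  shows "hausdorff_mnc (range (\<lambda>n. X n t)) \<le> 0"
proof -
  have rT: "0 \<le> r T" using r_nonneg[of T] T_pos by simp
  obtain \<mu> where \<mu>: "integrable L \<mu>" "\<And>t. t \<in> {0..T} \<Longrightarrow> 0 \<le> \<mu> t"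
    "\<And>t s x y. (t, s) \<in> D \<Longrightarrow> norm x \<le> r T + 1 \<Longrightarrow> norm y \<le> r T + 1 \<Longrightarrow> norm (g t s x - g t s y) \<le> \<mu> t * norm (x - y)"
    using g2[of "r T + 1"] rT by (metis add_nonneg_pos zero_less_one)
  \<comment> \<open>\<open>2 * k\<close> comes from \<open>F4\<close>. In the memory part the 2
    comes from the Lipschitz estimate for ranges, and \<open>T\<close> bounds the length of the
    integration interval.\<close>
  define N where "N t = 2 * k t + 2 * T * \<mu> t" for t
  have N: "integrable L (\<lambda>t. 2 * N t)" "\<And>t. t \<in> {0..T} \<Longrightarrow> 0 \<le> 2 * N t"
    unfolding N_def using F4(1,2) \<mu>(1,2) T_pos by auto
  define E where "E t = exp (integral\<^sup>L (lebesgue_on {0..t}) (\<lambda>t. 2 * N t))" for t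
  \<comment> \<open>The instance \<open>a = 1\<close>, \<open>q = 0\<close> of
    \<open>linear_integral_inequality\<close> with \<open>2 * N\<close> as \<open>p\<close>; the
    doubled coefficient is the source of the factor 1/2.\<close>
  have E_eq: "E = (\<lambda>t. 1 * exp (integral\<^sup>L (lebesgue_on {0..t}) (\<lambda>t. 2 * N t)) +
      integral\<^sup>L (lebesgue_on {0..t}) (\<lambda>s. 0 * exp (integral\<^sup>L (lebesgue_on {s..t}) (\<lambda>t. 2 * N t))))"
    by (rule ext) (simp add: E_def)
  have Eint: "integrable L (\<lambda>s. 2 * N s * E s)"
    unfolding E_eq by (rule linear_integral_inequality(4)[OF N(1) _ integrable_zero]) (use N in auto)
  have "mono_on {0..T} E"
    unfolding E_eq by (rule linear_integral_inequality(2)[OF N(1) _ integrable_zero]) (use N in auto)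
  then have Emono: "E s \<le> E t" if "0 \<le> s" "s \<le> t" "t \<le> T" for s t
    using that by (auto simp: mono_on_def)
  have Eineq: "1 + integral\<^sup>L (lebesgue_on {0..t}) (\<lambda>s. 2 * N s * E s + 0) \<le> E t" if "t \<in> {0..T}" for t
    unfolding E_eq by (rule linear_integral_inequality(5)[OF N(1) _ integrable_zero]) (use N that in auto)
  have E1: "1 \<le> E t" if "t \<in> {0..T}" for t
    unfolding E_def one_le_exp_iff using N(2) that by (intro integral_nonneg_AE AE_I2) auto
  have halve: "hausdorff_mnc (range (\<lambda>n. X n t)) \<le> ereal (S / 2 * E t)"
    if hyp: "\<And>t. t \<in> {0..T} \<Longrightarrow> hausdorff_mnc (range (\<lambda>n. X n t)) \<le> ereal (S * E t)" and S: "0 \<le> S"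
      and t: "t \<in> {0..T}" for S t
  proof -
    have SE0: "0 \<le> S * E \<tau>" for \<tau> using S by (simp add: E_def)
    have zE: "hausdorff_mnc (range (\<lambda>n. z n \<tau>)) \<le> ereal (S * E \<tau>)" if "\<tau> \<in> {0..T}" for \<tau>
      by (rule hausdorff_mnc_range_asymptotic[OF hyp[OF that] SE0 z_X_asymptotic[OF that]])
    have zr: "norm (z n \<tau>) \<le> r \<tau>" "norm (z n \<tau>) \<le> r T + 1" if "\<tau> \<in> {0..T}" for n \<tau>
      using adm[of n] that r_le_rT[OF that] by (auto simp: admissible_def) (smt (verit, best) that atLeastAtMost_iff)
    have "AE \<tau> in L. \<forall>n. integrable (lebesgue_on {0..\<tau>}) (\<lambda>s. g \<tau> s (z n s))"
      using g_section[OF adm] by (simp add: AE_all_countable)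
    with F4(3) \<sigma>_section \<sigma>r_section AE_space
    have rate: "AE \<tau> in L. hausdorff_mnc (range (\<lambda>n. sel \<tau> (z n \<tau>) + G (z n) \<tau>)) \<le> ereal (N \<tau> * (S * E \<tau>))"
    proof eventually_elim
      case (elim \<tau>)
      then have \<tau>: "\<tau> \<in> {0..T}" by simp
      have k0: "0 \<le> k \<tau>" and \<mu>0: "0 \<le> \<mu> \<tau>" using F4(2) \<mu>(2) \<tau> by auto
      have "bounded (range (\<lambda>n. z n \<tau>))" using zr(1)[OF \<tau>] by (auto simp: bounded_iff)
      then have "hausdorff_mnc (\<Union>a\<in>range (\<lambda>n. z n \<tau>). F \<tau> a) \<le> ereal (2 * k \<tau> * (S * E \<tau>))"
        using elim(1) zE[OF \<tau>] SE0 by blast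
      moreover have "range (\<lambda>n. sel \<tau> (z n \<tau>)) \<subseteq> (\<Union>a\<in>range (\<lambda>n. z n \<tau>). F \<tau> a)"
        using sel(1)[OF \<tau>] by auto
      ultimately have 1: "hausdorff_mnc (range (\<lambda>n. sel \<tau> (z n \<tau>))) \<le> ereal (2 * k \<tau> * (S * E \<tau>))"
        using hausdorff_mnc_mono order_trans by blast
      \<comment> \<open>\<open>E\<close> increases, so its value at \<tau> covers all earlier
        \<open>s\<close> and the memory integral is estimated with a constant.\<close>
      define b where "b = 2 * \<mu> \<tau> * (S * E \<tau>)"
      have b0: "0 \<le> b" using \<mu>0 SE0 by (simp add: b_def)
      have "hausdorff_mnc (range (\<lambda>n. integral\<^sup>L (lebesgue_on {0..\<tau>}) (\<lambda>s. g \<tau> s (z n s)))) \<le>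
          ereal (integral\<^sup>L (lebesgue_on {0..\<tau>}) (\<lambda>s. b))"
      proof (rule hausdorff_mnc_integral_le[where w="\<lambda>s. \<sigma> \<tau> s + \<sigma> \<tau> s * r s"])
        show "(\<lambda>s. g \<tau> s (z n s)) \<in> borel_measurable (lebesgue_on {0..\<tau>})" for n
          by (rule borel_measurable_integrable) (use elim(5) in blast)
        show "AE s in lebesgue_on {0..\<tau>}. norm (g \<tau> s (z n s)) \<le> \<sigma> \<tau> s + \<sigma> \<tau> s * r s" for n
          using norm_g_admissible[OF adm] D_iff[OF \<tau>] by (intro AE_I2) auto
        show "integrable (lebesgue_on {0..\<tau>}) (\<lambda>s. \<sigma> \<tau> s + \<sigma> \<tau> s * r s)" using elim by auto
        show "AE s in lebesgue_on {0..\<tau>}. hausdorff_mnc (range (\<lambda>n. g \<tau> s (z n s))) \<le> ereal b"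
        proof (rule AE_I2)
          fix s assume "s \<in> space (lebesgue_on {0..\<tau>})"
          then have s: "s \<in> {0..\<tau>}" "s \<in> {0..T}" "(\<tau>, s) \<in> D" using \<tau> D_iff[OF \<tau>] by auto
          have "hausdorff_mnc (range (\<lambda>n. g \<tau> s (z n s))) \<le> ereal (2 * \<mu> \<tau> * (S * E s))"
            using \<mu>(3)[OF s(3) zr(2)[OF s(2)] zr(2)[OF s(2)]]
            by (intro hausdorff_mnc_Lipschitz_range[OF zE[OF s(2)] SE0 \<mu>0]) (auto simp: dist_norm)
          also have "\<dots> \<le> ereal b"
            unfolding b_def ereal_less_eq using s \<tau> \<mu>0 S by (intro mult_left_mono Emono) auto
          finally show "hausdorff_mnc (range (\<lambda>n. g \<tau> s (z n s))) \<le> ereal b" .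
        qed
      qed (use b0 in \<open>auto simp: integrable_const_ivl\<close>)
      moreover have "integral\<^sup>L (lebesgue_on {0..\<tau>}) (\<lambda>s. b) \<le> T * b"
        using \<tau> b0 by (auto simp: measure_restrict_space intro!: mult_right_mono)
      ultimately have 2: "hausdorff_mnc (range (\<lambda>n. G (z n) \<tau>)) \<le> ereal (T * b)"
        unfolding G_def by (meson ereal_less_eq(3) order_trans)
      have "hausdorff_mnc (range (\<lambda>n. sel \<tau> (z n \<tau>) + G (z n) \<tau>)) \<le> ereal (2 * k \<tau> * (S * E \<tau>) + T * b)"
        using 1 2 by (rule hausdorff_mnc_range_add) (use k0 SE0 T_pos b0 in auto)
      also have "2 * k \<tau> * (S * E \<tau>) + T * b = N \<tau> * (S * E \<tau>)" by (simp add: N_def b_def algebra_simps)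
      finally show ?case .
    qed
    have NSE: "integrable L (\<lambda>s. N s * (S * E s))"
    proof -
      have "integrable L (\<lambda>s. (S / 2) * (2 * N s * E s))" using Eint by (rule integrable_mult_right)
      also have "(\<lambda>s. (S / 2) * (2 * N s * E s)) = (\<lambda>s. N s * (S * E s))" by (rule ext) simp
      finally show ?thesis .
    qed
    have "hausdorff_mnc (range (\<lambda>n. integral\<^sup>L (lebesgue_on {0..t}) (\<lambda>\<tau>. sel \<tau> (z n \<tau>) + G (z n) \<tau>)))
        \<le> ereal (integral\<^sup>L (lebesgue_on {0..t}) (\<lambda>s. N s * (S * E s)))"
    proof (rule hausdorff_mnc_integral_le[where w=\<psi>])
      show "(\<lambda>\<tau>. sel \<tau> (z n \<tau>) + G (z n) \<tau>) \<in> borel_measurable (lebesgue_on {0..t})" for n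
        by (rule borel_measurable_integrable, rule integrable_lebesgue_on_subset[OF rate_integrable(2)[OF adm smeas]])
          (use t in auto)
      show "AE \<tau> in lebesgue_on {0..t}. norm (sel \<tau> (z n \<tau>) + G (z n) \<tau>) \<le> \<psi> \<tau>" for n
        by (rule AE_lebesgue_on_subset[OF norm_rate_le(2)[OF adm]]) (use t in auto)
      show "integrable (lebesgue_on {0..t}) \<psi>"
        by (rule integrable_lebesgue_on_subset[OF \<psi>_integrable]) (use t in auto)
      show "integrable (lebesgue_on {0..t}) (\<lambda>s. N s * (S * E s))"
        by (rule integrable_lebesgue_on_subset[OF NSE]) (use t in auto)
      show "AE s in lebesgue_on {0..t}. 0 \<le> N s * (S * E s)"
        using N(2) S t by (intro AE_I2 mult_nonneg_nonneg) (auto simp: E_def)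
      show "AE \<tau> in lebesgue_on {0..t}. hausdorff_mnc (range (\<lambda>n. sel \<tau> (z n \<tau>) + G (z n) \<tau>)) \<le> ereal (N \<tau> * (S * E \<tau>))"
        by (rule AE_lebesgue_on_subset[OF rate]) (use t in auto)
    qed
    moreover have le: "integral\<^sup>L (lebesgue_on {0..t}) (\<lambda>s. N s * (S * E s)) \<le> S / 2 * E t"
    proof -
      have "integral\<^sup>L (lebesgue_on {0..t}) (\<lambda>s. N s * (S * E s)) = integral\<^sup>L (lebesgue_on {0..t}) (\<lambda>s. (S / 2) * (2 * N s * E s + 0))"
        by (intro Bochner_Integration.integral_cong) auto
      also have "\<dots> = (S / 2) * integral\<^sup>L (lebesgue_on {0..t}) (\<lambda>s. 2 * N s * E s + 0)"
        by (rule Bochner_Integration.integral_mult_right_zero)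
      also have "\<dots> \<le> S / 2 * E t" using Eineq[OF t] S by (intro mult_left_mono) auto
      finally show ?thesis .
    qed
    ultimately have "hausdorff_mnc (range (\<lambda>n. integral\<^sup>L (lebesgue_on {0..t}) (\<lambda>\<tau>. sel \<tau> (z n \<tau>) + G (z n) \<tau>))) \<le> ereal (S / 2 * E t)"
      by (meson ereal_less_eq(3) order_trans)
    moreover have "hausdorff_mnc (range (\<lambda>n::nat. x0)) \<le> ereal 0"
      by (rule hausdorff_mnc_leI) (auto intro!: exI[of _ "{x0}"])
    ultimately have "hausdorff_mnc (range (\<lambda>n. x0 + integral\<^sup>L (lebesgue_on {0..t}) (\<lambda>\<tau>. sel \<tau> (z n \<tau>) + G (z n) \<tau>))) \<le> ereal (0 + S / 2 * E t)"
      using S by (intro hausdorff_mnc_range_add) (auto simp: E_def)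
    then show ?thesis by (simp add: X_eq)
  qed
  \<comment> \<open>The iteration starts from the ball of radius \<open>r T\<close> around 0, which
    contains all polygons.\<close>
  have bound: "\<forall>t\<in>{0..T}. hausdorff_mnc (range (\<lambda>n. X n t)) \<le> ereal (r T / 2 ^ j * E t)" for j
  proof (induction j)
    case 0
    show ?case
    proof
      fix t assume t: "t \<in> {0..T}"
      have "r T * 1 \<le> r T * E t" using E1[OF t] rT by (rule mult_left_mono)
      then have le: "norm (X n t) \<le> r T * E t" for n using norm_X_le[OF t, of n] r_le_rT[OF t] by linarith
      show "hausdorff_mnc (range (\<lambda>n. X n t)) \<le> ereal (r T / 2 ^ 0 * E t)"
      proof (rule hausdorff_mnc_leI)
        fix \<epsilon> :: real assume "0 < \<epsilon>"
        then have "norm (X n t) \<le> r T / 2 ^ 0 * E t + \<epsilon>" for n using le[of n] by simp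
        then show "\<exists>Y. finite Y \<and> range (\<lambda>n. X n t) \<subseteq> (\<Union>x\<in>Y. cball x (r T / 2 ^ 0 * E t + \<epsilon>))"
          by (intro exI[of _ "{0}"]) auto
      qed (use rT E1[OF t] in auto)
    qed
  next
    case (Suc j)
    show ?case
    proof
      fix t assume "t \<in> {0..T}"
      then have "hausdorff_mnc (range (\<lambda>n. X n t)) \<le> ereal (r T / 2 ^ j / 2 * E t)"
        using Suc rT by (intro halve) auto
      then show "hausdorff_mnc (range (\<lambda>n. X n t)) \<le> ereal (r T / 2 ^ Suc j * E t)" by (simp add: mult.commute)
    qed
  qed
  have "(\<lambda>j. r T * (1 / 2) ^ j * E t) \<longlonglongrightarrow> r T * 0 * E t"
    by (intro tendsto_intros LIMSEQ_power_zero) auto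
  then have "(\<lambda>j. ereal (r T / 2 ^ j * E t)) \<longlonglongrightarrow> 0" by (simp add: power_one_over zero_ereal_def)
  then show ?thesis using bound assms by (intro LIMSEQ_le_const) auto
qed

text \<open>The integrals of the selections converge at every time. Convex combinations of tails
  keep these limits and also converge a.e. under an integrable bound, so the two expressions for the
  limit identify \<open>l + G x\<close> as the velocity of \<open>x\<close>.\<close>

lemma limit_solution:
  obtains v where "integrable L v"
    "\<forall>t\<in>{0..T}. norm (x0 + integral\<^sup>L (lebesgue_on {0..t}) v) \<le> r t"
    "AE t in L. v t \<in> (\<lambda>f. f + G (\<lambda>t. x0 + integral\<^sup>L (lebesgue_on {0..t}) v) t) ` F t (x0 + integral\<^sup>L (lebesgue_on {0..t}) v)"
    "AE t in L. norm (v t) \<le> \<psi> t"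
proof -
  obtain \<rho> where \<rho>: "strict_mono \<rho>" "\<And>t. t \<in> {0..T} \<Longrightarrow> convergent (\<lambda>n. X (\<rho> n) t)"
    using pointwise_convergent_subsequence[OF T_pos \<Psi>_continuous X_equicontinuous X_mnc_zero] by blast
  define x where "x t = lim (\<lambda>n. X (\<rho> n) t)" for t
  have Xlim: "(\<lambda>n. X (\<rho> n) t) \<longlonglongrightarrow> x t" if "t \<in> {0..T}" for t
    using \<rho>(2)[OF that] by (simp add: x_def convergent_LIMSEQ_iff)
  have zlim: "(\<lambda>n. z (\<rho> n) t) \<longlonglongrightarrow> x t" if "t \<in> {0..T}" for t
  proof -
    have "(\<lambda>n. z (\<rho> n) t - X (\<rho> n) t) \<longlonglongrightarrow> 0"
      using LIMSEQ_subseq_LIMSEQ[OF z_X_asymptotic[OF that] \<rho>(1)] by (simp add: o_def)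
    from tendsto_add[OF this Xlim[OF that]] show ?thesis by simp
  qed
  have admx: "admissible x" by (rule admissible_limit(1)[OF adm zlim])
  have glim: "(\<lambda>n. g t s (z (\<rho> n) s)) \<longlonglongrightarrow> g t s (x s)" if "(t, s) \<in> D" for t s
    by (rule admissible_limit(2)[OF adm zlim that])
  have "AE t in L. \<forall>n. integrable (lebesgue_on {0..t}) (\<lambda>s. g t s (z n s))"
    using g_section[OF adm] by (simp add: AE_all_countable)
  with g_section[OF admx] \<sigma>_section \<sigma>r_section AE_space
  have Glim: "AE t in L. (\<lambda>n. G (z (\<rho> n)) t) \<longlonglongrightarrow> G x t"
  proof eventually_elim
    case (elim t)
    then have t: "t \<in> {0..T}" by simp
    show ?case
      unfolding G_def
    proof (rule integral_dominated_convergence[where w="\<lambda>s. \<sigma> t s + \<sigma> t s * r s"])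
      show "(\<lambda>s. g t s (x s)) \<in> borel_measurable (lebesgue_on {0..t})" using elim(1) by (rule borel_measurable_integrable)
      show "(\<lambda>s. g t s (z (\<rho> n) s)) \<in> borel_measurable (lebesgue_on {0..t})" for n
        by (rule borel_measurable_integrable) (use elim(5) in blast)
      show "integrable (lebesgue_on {0..t}) (\<lambda>s. \<sigma> t s + \<sigma> t s * r s)" using elim by auto
      show "AE s in lebesgue_on {0..t}. (\<lambda>n. g t s (z (\<rho> n) s)) \<longlonglongrightarrow> g t s (x s)"
        using glim D_iff[OF t] by (intro AE_I2) auto
      show "AE s in lebesgue_on {0..t}. norm (g t s (z (\<rho> n) s)) \<le> \<sigma> t s + \<sigma> t s * r s" for n
        using norm_g_admissible[OF adm] D_iff[OF t] by (intro AE_I2) auto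
    qed
  qed
  define f where "f n t = sel t (z (\<rho> n) t)" for n t
  have fint: "integrable L (f n)" for n
    unfolding f_def by (rule rate_integrable(1)[OF adm smeas])
  have sub: "integrable (lebesgue_on {0..t}) u" if "integrable L u" "t \<in> {0..T}" for u :: "real \<Rightarrow> 'a" and t
    by (rule integrable_lebesgue_on_subset[OF that(1)]) (use that(2) in auto)
  have flim: "(\<lambda>n. integral\<^sup>L (lebesgue_on {0..t}) (f n)) \<longlonglongrightarrow> x t - x0 - integral\<^sup>L (lebesgue_on {0..t}) (G x)"
    if t: "t \<in> {0..T}" for t
  proof -
    have "(\<lambda>n. integral\<^sup>L (lebesgue_on {0..t}) (G (z (\<rho> n)))) \<longlonglongrightarrow> integral\<^sup>L (lebesgue_on {0..t}) (G x)"
    proof (rule integral_dominated_convergence[where w="\<lambda>s. \<sigma>bar s + \<sigma>r s"])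
      show "G x \<in> borel_measurable (lebesgue_on {0..t})"
        by (rule borel_measurable_integrable[OF sub[OF G_integrable[OF admx] t]])
      show "G (z (\<rho> n)) \<in> borel_measurable (lebesgue_on {0..t})" for n
        by (rule borel_measurable_integrable[OF sub[OF G_integrable[OF adm] t]])
      have "integrable L (\<lambda>s. \<sigma>bar s + \<sigma>r s)" using \<sigma>bar_integrable \<sigma>r_integrable by simp
      then show "integrable (lebesgue_on {0..t}) (\<lambda>s. \<sigma>bar s + \<sigma>r s)"
        by (rule integrable_lebesgue_on_subset) (use t in auto)
      show "AE s in lebesgue_on {0..t}. (\<lambda>n. G (z (\<rho> n)) s) \<longlonglongrightarrow> G x s"
        by (rule AE_lebesgue_on_subset[OF Glim]) (use t in auto)
      show "AE s in lebesgue_on {0..t}. norm (G (z (\<rho> n)) s) \<le> \<sigma>bar s + \<sigma>r s" for n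
        by (rule AE_lebesgue_on_subset[OF norm_G_le[OF adm]]) (use t in auto)
    qed
    then have "(\<lambda>n. X (\<rho> n) t - x0 - integral\<^sup>L (lebesgue_on {0..t}) (G (z (\<rho> n)))) \<longlonglongrightarrow> x t - x0 - integral\<^sup>L (lebesgue_on {0..t}) (G x)"
      by (intro tendsto_diff Xlim[OF t] tendsto_const)
    moreover have "X (\<rho> n) t - x0 - integral\<^sup>L (lebesgue_on {0..t}) (G (z (\<rho> n))) = integral\<^sup>L (lebesgue_on {0..t}) (f n)" for n
    proof -
      have "X (\<rho> n) t = x0 + (integral\<^sup>L (lebesgue_on {0..t}) (f n) + integral\<^sup>L (lebesgue_on {0..t}) (G (z (\<rho> n))))"
        unfolding X_eq Bochner_Integration.integral_add[OF sub[OF fint t] sub[OF G_integrable[OF adm] t], symmetric]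
        by (simp only: f_def)
      then show ?thesis by simp
    qed
    ultimately show ?thesis by simp
  qed
  have fbound: "AE t in L. norm (f n t) \<le> c t * r t + d t" for n
    unfolding f_def by (rule norm_rate_le(1)[OF adm])
  \<comment> \<open>The summand 1 provides the strict positivity that the weight in
    \<open>midpoints_converge_AE\<close> demands.\<close>
  define w where "w t = c t * r t + d t + 1" for t
  have wint: "integrable L w" unfolding w_def using cr_integrable F3(2) by (intro Bochner_Integration.integrable_add) (auto simp: integrable_const_ivl)
  have wpos: "0 < w t" if "t \<in> space L" for t
    using that F3(3,4)[of t] r_nonneg[of t] by (simp add: w_def add_nonneg_pos)
  have fw: "AE t in L. norm (f n t) \<le> w t" for n
    using fbound[of n] by eventually_elim (simp add: w_def)
  obtain h l where h: "\<And>j. h j \<in> midpoints f j" "AE t in L. (\<lambda>j. h j t) \<longlonglongrightarrow> l t" "l \<in> borel_measurable L"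
    by (rule midpoints_converge_AE[OF borel_measurable_integrable[OF fint] fw wint], erule wpos, rule that)
  have fall: "AE t in L. \<forall>n. norm (f n t) \<le> c t * r t + d t" using fbound by (simp add: AE_all_countable)
  then have hbound: "AE t in L. \<forall>j. norm (h j t) \<le> c t * r t + d t"
  proof eventually_elim
    case (elim t)
    have "h j t \<in> cball 0 (c t * r t + d t)" for j
      by (rule midpoints_in_convex[OF h(1)]) (use elim in auto)
    then show ?case by simp
  qed
  have lbound: "AE t in L. norm (l t) \<le> c t * r t + d t"
    using hbound h(2)
  proof eventually_elim
    case (elim t)
    then show ?case using tendsto_norm[OF elim(2)] by (intro LIMSEQ_le_const2) auto
  qed
  have lint: "integrable L l"
  proof (rule Bochner_Integration.integrable_bound[of _ "\<lambda>t. c t * r t + d t"])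
    show "AE t in L. norm (l t) \<le> norm (c t * r t + d t)" using lbound by eventually_elim auto
  qed (use cr_integrable F3(2) h(3) in auto)
  have x_eq: "x t = x0 + integral\<^sup>L (lebesgue_on {0..t}) (\<lambda>s. l s + G x s)" if t: "t \<in> {0..T}" for t
  proof -
    let ?M = "lebesgue_on {0..t}" and ?y = "x t - x0 - integral\<^sup>L (lebesgue_on {0..t}) (G x)"
    have hint: "integrable ?M (h j)" for j
      using midpoints_integral_in_convex[OF h(1) convex_UNIV sub[OF fint t]] by simp
    have "(\<lambda>j. integral\<^sup>L ?M (h j)) \<longlonglongrightarrow> integral\<^sup>L ?M l"
    proof (rule integral_dominated_convergence[where w="\<lambda>t. c t * r t + d t"])
      show "l \<in> borel_measurable ?M" by (rule borel_measurable_integrable[OF sub[OF lint t]])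
      show "h j \<in> borel_measurable ?M" for j by (rule borel_measurable_integrable[OF hint])
      have "integrable L (\<lambda>t. c t * r t + d t)" using cr_integrable F3(2) by simp
      then show "integrable ?M (\<lambda>t. c t * r t + d t)" by (rule integrable_lebesgue_on_subset) (use t in auto)
      show "AE s in ?M. (\<lambda>j. h j s) \<longlonglongrightarrow> l s" by (rule AE_lebesgue_on_subset[OF h(2)]) (use t in auto)
      have "AE s in ?M. \<forall>j. norm (h j s) \<le> c s * r s + d s" by (rule AE_lebesgue_on_subset[OF hbound]) (use t in auto)
      then show "AE s in ?M. norm (h j s) \<le> c s * r s + d s" for j by eventually_elim blast
    qed
    moreover have "(\<lambda>j. integral\<^sup>L ?M (h j)) \<longlonglongrightarrow> ?y"
    proof (rule metric_LIMSEQ_I)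
      fix e :: real assume "0 < e"
      then obtain J where J: "\<And>n. n \<ge> J \<Longrightarrow> dist (integral\<^sup>L ?M (f n)) ?y < e"
        using metric_LIMSEQ_D[OF flim[OF t]] by blast
      have "dist (integral\<^sup>L ?M (h j)) ?y < e" if "j \<ge> J" for j
      proof -
        have "integrable ?M (h j) \<and> integral\<^sup>L ?M (h j) \<in> ball ?y e"
          by (rule midpoints_integral_in_convex[OF h(1) convex_ball sub[OF fint t]]) (use J that in \<open>auto simp: dist_commute\<close>)
        then show ?thesis by (simp add: dist_commute)
      qed
      then show "\<exists>no. \<forall>n\<ge>no. dist (integral\<^sup>L ?M (h n)) ?y < e" by blast
    qed
    ultimately have "integral\<^sup>L ?M l = ?y" by (rule LIMSEQ_unique)
    moreover have "integral\<^sup>L ?M (\<lambda>s. l s + G x s) = integral\<^sup>L ?M l + integral\<^sup>L ?M (G x)"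
      by (rule Bochner_Integration.integral_add[OF sub[OF lint t] sub[OF G_integrable[OF admx] t]])
    ultimately show ?thesis by simp
  qed
  have lF: "AE t in L. l t \<in> F t (x t)"
    using h(2) F2 AE_space
  proof eventually_elim
    case (elim t)
    then have t: "t \<in> {0..T}" by simp
    show ?case
    proof (rule ccontr)
      assume "l t \<notin> F t (x t)"
      then obtain y a where y: "\<And>u. u \<in> F t (x t) \<Longrightarrow> u \<bullet> y < a" "a < l t \<bullet> y"
        using closed_convex_strict_separation[of "F t (x t)" "l t"] F_values[OF t] by blast
      \<comment> \<open>A strict half-space is weakly open, so upper semicontinuity captures the
        values at nearby states, and it is convex, so it captures the combinations too. Their limit
        \<open>l t\<close> can get no further than its boundary.\<close>
      define W where "W = {u. u \<bullet> y < a}"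
      have "weakly_open W"
        unfolding weakly_open_def
      proof
        fix u assume "u \<in> W"
        then have "0 < a - u \<bullet> y" by (simp add: W_def)
        moreover have "{v. \<forall>y'\<in>{y}. \<bar>(v - u) \<bullet> y'\<bar> < a - u \<bullet> y} \<subseteq> W" by (auto simp: W_def inner_diff_left)
        ultimately show "\<exists>Y. finite Y \<and> (\<exists>\<epsilon>>0. {v. \<forall>y\<in>Y. \<bar>(v - u) \<bullet> y\<bar> < \<epsilon>} \<subseteq> W)"
          by (intro exI[of _ "{y}"] conjI exI[of _ "a - u \<bullet> y"]) auto
      qed
      moreover have "F t (x t) \<subseteq> W" using y(1) by (auto simp: W_def)
      ultimately obtain \<delta> where \<delta>: "0 < \<delta>" "\<And>u. norm (u - x t) < \<delta> \<Longrightarrow> F t u \<subseteq> W"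
        using elim(2) unfolding usc_into_weak_def by blast
      obtain J where J: "\<And>n. n \<ge> J \<Longrightarrow> norm (z (\<rho> n) t - x t) < \<delta>"
        using LIMSEQ_D[OF zlim[OF t] \<delta>(1)] by blast
      have fW: "f n t \<in> W" if "n \<ge> J" for n
        unfolding f_def using \<delta>(2)[OF J[OF that]] sel(1)[OF t] by blast
      have "h j t \<bullet> y \<le> a" if "j \<ge> J" for j
      proof -
        have "convex W" unfolding W_def using convex_halfspace_lt[of y a] by (simp add: inner_commute)
        then have "h j t \<in> W" using fW that by (intro midpoints_in_convex[OF h(1)]) auto
        then show ?thesis by (simp add: W_def)
      qed
      then have "l t \<bullet> y \<le> a"
        using tendsto_inner[OF elim(1) tendsto_const[of y]] by (intro LIMSEQ_le_const2) auto
      then show False using y(2) by simp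
    qed
  qed
  show thesis
  proof (rule that[of "\<lambda>s. l s + G x s"])
    show "integrable L (\<lambda>s. l s + G x s)" using lint G_integrable[OF admx] by (rule Bochner_Integration.integrable_add)
    show "\<forall>t\<in>{0..T}. norm (x0 + integral\<^sup>L (lebesgue_on {0..t}) (\<lambda>s. l s + G x s)) \<le> r t"
    proof
      fix t assume t: "t \<in> {0..T}"
      show "norm (x0 + integral\<^sup>L (lebesgue_on {0..t}) (\<lambda>s. l s + G x s)) \<le> r t"
        using admx t unfolding admissible_def x_eq[OF t, symmetric] by blast
    qed
    let ?x = "\<lambda>t. x0 + integral\<^sup>L (lebesgue_on {0..t}) (\<lambda>s. l s + G x s)"
    \<comment> \<open>\<open>x\<close> is known to agree with \<open>?x\<close> only on
      \<open>{0..T}\<close>, and the memory integral looks no further.\<close>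
    have Gx: "G ?x t = G x t" if "t \<in> {0..T}" for t
      unfolding G_def[of _ t] using that x_eq by (intro Bochner_Integration.integral_cong) auto
    show "AE t in L. l t + G x t \<in> (\<lambda>f. f + G ?x t) ` F t (?x t)"
      using lF AE_space
    proof eventually_elim
      case (elim t)
      then have "t \<in> {0..T}" by simp
      from Gx[OF this] x_eq[OF this] show ?case using elim(1) by simp
    qed
    show "AE t in L. norm (l t + G x t) \<le> \<psi> t"
      using lbound norm_G_le[OF admx]
    proof eventually_elim
      case (elim t)
      then show ?case using norm_triangle_ineq[of "l t" "G x t"] by (simp add: \<psi>_eq)
    qed
  qed
qed

end

theorem solution_exists:
  "\<exists>x x'. abs_continuous_on 0 T x \<and> x 0 = x0 \<and>
     (AE t in lebesgue. t \<in> {0..T} \<longrightarrow>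
        (x has_vector_derivative x' t) (at t within {0..T}) \<and>
        x' t \<in> (\<lambda>f. f + integral\<^sup>L (lebesgue_on {0..t}) (\<lambda>s. g t s (x s))) ` F t (x t) \<and>
        norm (x' t) \<le> \<psi> t) \<and>
     (\<forall>t\<in>{0..T}. norm (x t) \<le> r t)"
proof -
  obtain X z :: "nat \<Rightarrow> real \<Rightarrow> 'a" where Xz:
    "\<And>n. admissible (z n)" "\<And>n. (\<lambda>t. sel t (z n t)) \<in> borel_measurable L"
    "\<And>n t. X n t = x0 + integral\<^sup>L (lebesgue_on {0..t}) (\<lambda>\<tau>. sel \<tau> (z n \<tau>) + G (z n) \<tau>)"
    "\<And>n t. t \<in> {0..T} \<Longrightarrow> \<exists>s. 0 \<le> s \<and> s \<le> t \<and> t - s \<le> T / real (Suc n) \<and> z n t = X n s"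
    by (rule approximate_solutions) blast
  obtain v where v: "integrable L v"
    "\<forall>t\<in>{0..T}. norm (x0 + integral\<^sup>L (lebesgue_on {0..t}) v) \<le> r t"
    "AE t in L. v t \<in> (\<lambda>f. f + G (\<lambda>t. x0 + integral\<^sup>L (lebesgue_on {0..t}) v) t) ` F t (x0 + integral\<^sup>L (lebesgue_on {0..t}) v)"
    "AE t in L. norm (v t) \<le> \<psi> t"
    by (rule limit_solution[OF Xz], assumption, rule that)
  let ?x = "\<lambda>t. x0 + integral\<^sup>L (lebesgue_on {0..t}) v"
  have "AE t in lebesgue. t \<in> {0..T} \<longrightarrow> v t \<in> (\<lambda>f. f + G ?x t) ` F t (?x t)"
    "AE t in lebesgue. t \<in> {0..T} \<longrightarrow> norm (v t) \<le> \<psi> t"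
    using v(3,4) by (simp_all add: AE_restrict_space_iff)
  with primitive_has_vector_derivative_AE[OF v(1), of x0]
  have AE: "AE t in lebesgue. t \<in> {0..T} \<longrightarrow> (?x has_vector_derivative v t) (at t within {0..T}) \<and>
        v t \<in> (\<lambda>f. f + integral\<^sup>L (lebesgue_on {0..t}) (\<lambda>s. g t s (?x s))) ` F t (?x t) \<and> norm (v t) \<le> \<psi> t"
    by eventually_elim (simp add: G_def)
  show ?thesis
  proof (rule exI[of _ ?x], rule exI[of _ v], intro conjI ballI)
    show "abs_continuous_on 0 T ?x" by (rule primitive_abs_continuous[OF v(1)])
    show "x0 + integral\<^sup>L (lebesgue_on {0..0}) v = x0" by (simp only: integral_lebesgue_on_point add_0_right)
  qed (use AE v(2) in auto)
qed

end

section \<open>Transfer to the sort of the theorem\<close>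

text \<open>The sort of the theorem does not entail the class \<open>banach\<close>, which the integration library needs.
  A copy of the type carries the missing class instance.\<close>

typedef 'a hilbert_copy = "UNIV :: 'a set"
  morphisms of_copy to_copy by simp

lemma of_to_copy [simp]: "of_copy (to_copy x) = x"
  by (simp add: to_copy_inverse)

lemma to_of_copy [simp]: "to_copy (of_copy x) = x"
  by (rule of_copy_inverse)

lemma hilbert_copy_eq_iff: "x = y \<longleftrightarrow> of_copy x = of_copy y"
  by (simp add: of_copy_inject)

instantiation hilbert_copy :: (real_inner) real_inner
begin

definition "0 = to_copy 0"
definition "x + y = to_copy (of_copy x + of_copy y)"
definition "x - y = to_copy (of_copy x - of_copy y)"
definition "- x = to_copy (- of_copy x)"
definition "a *\<^sub>R x = to_copy (a *\<^sub>R of_copy x)"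
definition "norm x = norm (of_copy x)"
definition "sgn x = to_copy (sgn (of_copy x))"
definition "dist x y = norm (of_copy x - of_copy y)"
definition "inner x y = of_copy x \<bullet> of_copy y"
definition uniformity_hilbert_copy :: "('a hilbert_copy \<times> 'a hilbert_copy) filter"
  where "uniformity_hilbert_copy = (INF e\<in>{0 <..}. principal {(x, y). dist x y < e})"
definition open_hilbert_copy :: "'a hilbert_copy set \<Rightarrow> bool"
  where "open_hilbert_copy U \<longleftrightarrow> (\<forall>x\<in>U. eventually (\<lambda>(x', y). x' = x \<longrightarrow> y \<in> U) uniformity)"

instance
  by standard
    (auto simp: hilbert_copy_eq_iff zero_hilbert_copy_def plus_hilbert_copy_def minus_hilbert_copy_def
      uminus_hilbert_copy_def scaleR_hilbert_copy_def norm_hilbert_copy_def sgn_hilbert_copy_def dist_hilbert_copy_def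
      inner_hilbert_copy_def uniformity_hilbert_copy_def open_hilbert_copy_def
      scaleR_add_left scaleR_add_right sgn_div_norm inner_add_left inner_add_right inner_commute norm_eq_sqrt_inner)

end

lemma dist_of_copy: "dist (of_copy x) (of_copy y) = dist x y"
  by (simp add: dist_hilbert_copy_def dist_norm)

lemma dist_to_copy: "dist (to_copy x) (to_copy y) = dist x y"
  by (simp add: dist_hilbert_copy_def dist_norm)

lemma norm_to_copy [simp]: "norm (to_copy x) = norm x"
  by (simp add: norm_hilbert_copy_def)

lemma norm_of_copy [simp]: "norm (of_copy x) = norm x"
  by (simp add: norm_hilbert_copy_def)

lemma bounded_linear_to_copy: "bounded_linear to_copy"
  by (rule bounded_linear_intro[of _ 1])
    (simp_all add: hilbert_copy_eq_iff plus_hilbert_copy_def scaleR_hilbert_copy_def)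

lemma bounded_linear_of_copy: "bounded_linear of_copy"
  by (rule bounded_linear_intro[of _ 1])
    (simp_all add: plus_hilbert_copy_def scaleR_hilbert_copy_def)

lemma of_copy_diff: "of_copy (x - y) = of_copy x - of_copy y"
  by (simp add: minus_hilbert_copy_def)

lemma of_copy_add: "of_copy (x + y) = of_copy x + of_copy y"
  by (simp add: plus_hilbert_copy_def)

lemma to_copy_diff: "to_copy (x - y) = to_copy x - to_copy y"
  by (simp add: minus_hilbert_copy_def)

lemma continuous_on_to_copy: "continuous_on S to_copy"
  using bounded_linear_to_copy by (rule linear_continuous_on)

lemma continuous_on_of_copy: "continuous_on S of_copy"
  using bounded_linear_of_copy by (rule linear_continuous_on)

lemma to_copy_image: "to_copy ` S = of_copy -` S"
  by force

instance hilbert_copy :: ("{real_inner,complete_space}") complete_space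
proof
  fix X :: "nat \<Rightarrow> 'a hilbert_copy" assume "Cauchy X"
  then have "Cauchy (\<lambda>n. of_copy (X n))" by (simp add: Cauchy_def dist_of_copy)
  then obtain l where "(\<lambda>n. of_copy (X n)) \<longlonglongrightarrow> l" by (auto simp: Cauchy_convergent_iff convergent_def)
  then have "(\<lambda>n. to_copy (of_copy (X n))) \<longlonglongrightarrow> to_copy l"
    by (rule bounded_linear.tendsto[OF bounded_linear_to_copy])
  then show "convergent X" by (auto simp: convergent_def)
qed

instance hilbert_copy :: ("{real_inner,complete_space}") banach ..

instance hilbert_copy :: ("{real_inner,second_countable_topology}") second_countable_topology
proof
  obtain B :: "'a set set" where B: "countable B" "topological_basis B" using ex_countable_basis by blast
  have "topological_basis ((\<lambda>U. of_copy -` U) ` B)"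
    unfolding topological_basis_def
  proof (intro conjI ballI allI impI)
    fix b assume "b \<in> (\<lambda>U. of_copy -` U) ` B"
    then obtain U where "U \<in> B" "b = of_copy -` U" by blast
    moreover have "open U" using \<open>U \<in> B\<close> B(2) topological_basis_open by blast
    ultimately show "open b" using open_vimage[OF _ continuous_on_of_copy] by blast
  next
    fix V :: "'a hilbert_copy set" assume "open V"
    then have "open (to_copy -` V)" by (rule open_vimage[OF _ continuous_on_to_copy])
    then obtain B' where B': "B' \<subseteq> B" "\<Union>B' = to_copy -` V" using B(2) unfolding topological_basis_def by blast
    have "\<Union>((\<lambda>U. of_copy -` U) ` B') = of_copy -` \<Union>B'" by blast
    also have "\<dots> = V" unfolding B'(2) by auto
    finally show "\<exists>B''\<subseteq>(\<lambda>U. of_copy -` U) ` B. \<Union>B'' = V" using B'(1) by blast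
  qed
  then have "open = generate_topology ((\<lambda>U. of_copy -` U) ` B)" by (rule topological_basis_imp_subbasis)
  then show "\<exists>B :: 'a hilbert_copy set set. countable B \<and> open = generate_topology B" using B(1) by blast
qed

text \<open>The centres are mapped along with the set. It serves once in each direction between the
  type and its copy.\<close>

lemma hausdorff_mnc_isometry_le:
  fixes f :: "'a::metric_space \<Rightarrow> 'b::metric_space"
  assumes "\<And>x y. dist (f x) (f y) = dist x y"
  shows "hausdorff_mnc (f ` A) \<le> hausdorff_mnc A"
  unfolding hausdorff_mnc_def
proof (rule Inf_superset_mono, safe)
  fix \<rho> :: real and X assume "0 < \<rho>" "finite X" "A \<subseteq> (\<Union>x\<in>X. cball x \<rho>)"
  moreover from this have "f ` A \<subseteq> (\<Union>x\<in>f ` X. cball x \<rho>)" using assms by fastforce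
  ultimately show "\<exists>r. ereal \<rho> = ereal r \<and> 0 < r \<and> (\<exists>X. finite X \<and> f ` A \<subseteq> (\<Union>x\<in>X. cball x r))" by blast
qed

text \<open>Weak neighbourhoods correspond because the copy preserves inner products:
  \<open>of_copy\<close> carries back the finite set of test vectors.\<close>

lemma usc_into_weak_copy:
  assumes "usc_into_weak F"
  shows "usc_into_weak (\<lambda>v. to_copy ` F (of_copy v))"
  unfolding usc_into_weak_def
proof (intro allI impI)
  fix v :: "'a hilbert_copy" and W assume vW: "weakly_open W \<and> to_copy ` F (of_copy v) \<subseteq> W"
  have "weakly_open (to_copy -` W)"
    unfolding weakly_open_def
  proof
    fix w assume "w \<in> to_copy -` W"
    then obtain Y \<epsilon> where Y: "finite Y" "0 < \<epsilon>" "{z. \<forall>y\<in>Y. \<bar>(z - to_copy w) \<bullet> y\<bar> < \<epsilon>} \<subseteq> W"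
      using vW unfolding weakly_open_def by blast
    have "{z. \<forall>y\<in>of_copy ` Y. \<bar>(z - w) \<bullet> y\<bar> < \<epsilon>} \<subseteq> to_copy -` W"
      using Y(3) by (force simp: inner_hilbert_copy_def of_copy_diff)
    then show "\<exists>Y. finite Y \<and> (\<exists>\<epsilon>>0. {z. \<forall>y\<in>Y. \<bar>(z - w) \<bullet> y\<bar> < \<epsilon>} \<subseteq> to_copy -` W)" using Y(1,2) by blast
  qed
  moreover have "F (of_copy v) \<subseteq> to_copy -` W" using vW by blast
  ultimately obtain \<delta> where \<delta>: "0 < \<delta>" "\<And>u. norm (u - of_copy v) < \<delta> \<Longrightarrow> F u \<subseteq> to_copy -` W"
    using assms unfolding usc_into_weak_def by blast
  have "to_copy ` F (of_copy u) \<subseteq> W" if "norm (u - v) < \<delta>" for u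
    using \<delta>(2)[of "of_copy u"] that by (auto simp flip: of_copy_diff)
  then show "\<exists>\<delta>>0. \<forall>u. norm (u - v) < \<delta> \<longrightarrow> to_copy ` F (of_copy u) \<subseteq> W" using \<delta>(1) by blast
qed

text \<open>In the Kuratowski case the Hausdorff bound for \<open>A\<close> is doubled on entry and
  the return costs nothing, which gives \<open>2 * k\<close>. The Hausdorff case has the smaller
  constant \<open>k\<close>.\<close>

lemma mnc_Lipschitz_hausdorff:
  assumes "(\<forall>A. bounded A \<longrightarrow> kuratowski_mnc (\<Union>a\<in>A. F a) \<le> ereal k * kuratowski_mnc A) \<or>
    (\<forall>A. bounded A \<longrightarrow> hausdorff_mnc (\<Union>a\<in>A. F a) \<le> ereal k * hausdorff_mnc A)"
    and A: "bounded A" "0 \<le> b" "hausdorff_mnc A \<le> ereal b" and "0 \<le> k"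
  shows "hausdorff_mnc (\<Union>a\<in>A. F a) \<le> ereal (2 * k * b)"
  using assms(1)
proof
  assume "\<forall>A. bounded A \<longrightarrow> kuratowski_mnc (\<Union>a\<in>A. F a) \<le> ereal k * kuratowski_mnc A"
  then have "kuratowski_mnc (\<Union>a\<in>A. F a) \<le> ereal k * kuratowski_mnc A" using A(1) by blast
  also have "\<dots> \<le> ereal k * ereal (2 * b)"
    using kuratowski_le_hausdorff[OF A(3,2)] \<open>0 \<le> k\<close> by (intro ereal_mult_left_mono) auto
  finally show ?thesis using A(2) \<open>0 \<le> k\<close> by (intro hausdorff_le_kuratowski) (auto simp: mult_ac)
next
  assume "\<forall>A. bounded A \<longrightarrow> hausdorff_mnc (\<Union>a\<in>A. F a) \<le> ereal k * hausdorff_mnc A"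
  then have "hausdorff_mnc (\<Union>a\<in>A. F a) \<le> ereal k * hausdorff_mnc A" using A(1) by blast
  also have "\<dots> \<le> ereal k * ereal b" using A(3) \<open>0 \<le> k\<close> by (intro ereal_mult_left_mono) auto
  also have "\<dots> \<le> ereal (2 * k * b)" using A(2) \<open>0 \<le> k\<close> by simp
  finally show ?thesis .
qed

theorem theorem4p3:
  fixes T :: real and x0 :: "'a::{real_inner, complete_space, second_countable_topology}"
    and F :: "real \<Rightarrow> 'a \<Rightarrow> 'a set"
    and c d k :: "real \<Rightarrow> real"
    and g :: "real \<Rightarrow> real \<Rightarrow> 'a \<Rightarrow> 'a"
    and \<sigma> :: "real \<Rightarrow> real \<Rightarrow> real"
  defines "D \<equiv> {(t, s). t \<in> {0..T} \<and> s \<in> {0..T} \<and> s \<le> t}"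
  assumes T_pos: "T > 0"
    and F_values: "\<forall>t\<in>{0..T}. \<forall>v. F t v \<noteq> {} \<and> closed (F t v) \<and> convex (F t v)"
    and F1: "\<forall>v. measurable_multimap T (\<lambda>t. F t v)"
    and F2: "AE t in lebesgue. t \<in> {0..T} \<longrightarrow> usc_into_weak (F t)"
    and F3: "integrable (lebesgue_on {0..T}) c" "integrable (lebesgue_on {0..T}) d"
            "\<forall>t\<in>{0..T}. c t \<ge> 0 \<and> d t \<ge> 0"
            "AE t in lebesgue. t \<in> {0..T} \<longrightarrow>
               (\<forall>v. (INF w\<in>F t v. norm w) \<le> c t * norm v + d t)"
    and F4: "integrable (lebesgue_on {0..T}) k" "\<forall>t\<in>{0..T}. k t \<ge> 0"
            "(\<forall>\<^sub>F t in ae_filter lebesgue. t \<in> {0..T} \<longrightarrow>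
                (\<forall>A. bounded A \<longrightarrow> kuratowski_mnc (\<Union>a\<in>A. F t a) \<le> ereal (k t) * kuratowski_mnc A))
             \<or> (\<forall>\<^sub>F t in ae_filter lebesgue. t \<in> {0..T} \<longrightarrow>
                (\<forall>A. bounded A \<longrightarrow> hausdorff_mnc (\<Union>a\<in>A. F t a) \<le> ereal (k t) * hausdorff_mnc A))"
    and g1: "\<forall>v. (\<lambda>(t, s). g t s v) \<in> borel_measurable (lebesgue_on ({0..T} \<times> {0..T}))"
    and g2: "\<forall>r>0. \<exists>\<mu>. integrable (lebesgue_on {0..T}) \<mu> \<and> (\<forall>t\<in>{0..T}. \<mu> t \<ge> 0) \<and>
               (\<forall>t s x y. (t, s) \<in> D \<and> norm x \<le> r \<and> norm y \<le> r \<longrightarrow>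
                  norm (g t s x - g t s y) \<le> \<mu> t * norm (x - y))"
    and g3: "integrable (lebesgue_on D) (\<lambda>(t, s). \<sigma> t s)"
            "\<forall>(t, s)\<in>D. \<sigma> t s \<ge> 0"
            "\<forall>(t, s)\<in>D. \<forall>x. norm (g t s x) \<le> \<sigma> t s * (1 + norm x)"
  shows "\<exists>x x'. abs_continuous_on 0 T x \<and> x 0 = x0 \<and>
           (AE t in lebesgue. t \<in> {0..T} \<longrightarrow>
              (x has_vector_derivative x' t) (at t within {0..T}) \<and>
              x' t \<in> (\<lambda>f. f + integral\<^sup>L (lebesgue_on {0..t}) (\<lambda>s. g t s (x s))) ` F t (x t) \<and>
              norm (x' t) \<le> psi_fun x0 c d \<sigma> t) \<and>
           (\<forall>t\<in>{0..T}. norm (x t) \<le> r_fun x0 c d \<sigma> t)"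
proof -
  define F' where "F' t v = to_copy ` F t (of_copy v)" for t and v :: "'a hilbert_copy"
  define g' where "g' t s v = to_copy (g t s (of_copy v))" for t s and v :: "'a hilbert_copy"
  have AE_on: "(AE t in lebesgue. t \<in> {0..T} \<longrightarrow> P t) \<longleftrightarrow> (AE t in lebesgue_on {0..T}. P t)" for P
    by (simp add: AE_restrict_space_iff)
  have F4': "AE t in lebesgue_on {0..T}. \<forall>A b. bounded A \<longrightarrow> 0 \<le> b \<longrightarrow> hausdorff_mnc A \<le> ereal b \<longrightarrow>
      hausdorff_mnc (\<Union>a\<in>A. F t a) \<le> ereal (2 * k t * b)"
  proof -
    \<comment> \<open>The choice between the two measures is moved inside the a.e. quantifier, where
      it is resolved for each \<open>t\<close> separately.\<close>
    have "AE t in lebesgue. t \<in> {0..T} \<longrightarrow>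
        (\<forall>A. bounded A \<longrightarrow> kuratowski_mnc (\<Union>a\<in>A. F t a) \<le> ereal (k t) * kuratowski_mnc A) \<or>
        (\<forall>A. bounded A \<longrightarrow> hausdorff_mnc (\<Union>a\<in>A. F t a) \<le> ereal (k t) * hausdorff_mnc A)"
      using F4(3) by (rule disjE) (erule eventually_mono, blast)+
    then show ?thesis unfolding AE_on using AE_space
    proof eventually_elim
      case (elim t)
      have "0 \<le> k t" using elim(2) F4(2) by simp
      then show ?case by (intro allI impI mnc_Lipschitz_hausdorff[OF elim(1)])
    qed
  qed
  interpret volterra_inclusion T "to_copy x0" F' c d k g' \<sigma> D
  proof unfold_locales
    show "D = {(t, s). t \<in> {0..T} \<and> s \<in> {0..T} \<and> s \<le> t}" by (simp add: D_def)
    show "F' t v \<noteq> {} \<and> closed (F' t v) \<and> convex (F' t v)" if "t \<in> {0..T}" for t v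
    proof (intro conjI)
      have F: "F t (of_copy v) \<noteq> {}" "closed (F t (of_copy v))" "convex (F t (of_copy v))"
        using F_values that by auto
      show "F' t v \<noteq> {}" using F(1) by (simp add: F'_def)
      show "closed (F' t v)" unfolding F'_def to_copy_image using F(2) continuous_on_of_copy by (rule closed_vimage)
      show "convex (F' t v)" unfolding F'_def
        using bounded_linear.linear[OF bounded_linear_to_copy] F(3) by (rule convex_linear_image)
    qed
    show "measurable_multimap T (\<lambda>t. F' t v)" for v
      unfolding measurable_multimap_def
    proof (intro allI impI)
      fix U :: "'a hilbert_copy set" assume "open U"
      then have "open (to_copy -` U)" by (rule open_vimage[OF _ continuous_on_to_copy])
      then have "{t\<in>{0..T}. F t (of_copy v) \<inter> to_copy -` U \<noteq> {}} \<in> sets (lebesgue_on {0..T})"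
        using F1 unfolding measurable_multimap_def by blast
      also have "{t\<in>{0..T}. F t (of_copy v) \<inter> to_copy -` U \<noteq> {}} = {t\<in>{0..T}. F' t v \<inter> U \<noteq> {}}"
        unfolding F'_def by blast
      finally show "{t\<in>{0..T}. F' t v \<inter> U \<noteq> {}} \<in> sets (lebesgue_on {0..T})" .
    qed
    have "AE t in lebesgue_on {0..T}. usc_into_weak (F t)" using F2 by (simp only: AE_on)
    then show "AE t in lebesgue_on {0..T}. usc_into_weak (F' t)"
      by eventually_elim (simp add: F'_def[abs_def] usc_into_weak_copy)
    have "AE t in lebesgue_on {0..T}. \<forall>v. (INF w\<in>F t v. norm w) \<le> c t * norm v + d t"
      using F3(4) by (simp only: AE_on)
    then show "AE t in lebesgue_on {0..T}. \<forall>v. (INF w\<in>F' t v. norm w) \<le> c t * norm v + d t"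
    proof eventually_elim
      case (elim t)
      show ?case
      proof
        fix v show "(INF w\<in>F' t v. norm w) \<le> c t * norm v + d t"
          using elim[rule_format, of "of_copy v"] by (simp add: F'_def image_image)
      qed
    qed
    show "AE t in lebesgue_on {0..T}. \<forall>A b. bounded A \<longrightarrow> 0 \<le> b \<longrightarrow> hausdorff_mnc A \<le> ereal b \<longrightarrow>
        hausdorff_mnc (\<Union>a\<in>A. F' t a) \<le> ereal (2 * k t * b)"
      using F4'
    proof eventually_elim
      case (elim t)
      show ?case
      proof (intro allI impI)
        fix A :: "'a hilbert_copy set" and b :: real
        assume A: "bounded A" "0 \<le> b" "hausdorff_mnc A \<le> ereal b"
        have "hausdorff_mnc (of_copy ` A) \<le> hausdorff_mnc A" by (rule hausdorff_mnc_isometry_le[OF dist_of_copy])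
        moreover have "bounded (of_copy ` A)" using A(1) bounded_linear_of_copy by (rule bounded_linear_image)
        ultimately have "hausdorff_mnc (\<Union>a\<in>of_copy ` A. F t a) \<le> ereal (2 * k t * b)"
          using elim A(2,3) by (meson order_trans)
        moreover have "(\<Union>a\<in>A. F' t a) = to_copy ` (\<Union>a\<in>of_copy ` A. F t a)" unfolding F'_def by blast
        ultimately show "hausdorff_mnc (\<Union>a\<in>A. F' t a) \<le> ereal (2 * k t * b)"
          using hausdorff_mnc_isometry_le[OF dist_to_copy, of "\<Union>a\<in>of_copy ` A. F t a"] by (metis order_trans)
      qed
    qed
    show "(\<lambda>(t, s). g' t s v) \<in> borel_measurable (lebesgue_on ({0..T} \<times> {0..T}))" for v
    proof -
      have "(to_copy :: 'a \<Rightarrow> _) \<in> borel_measurable borel"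
        using continuous_on_to_copy by (rule borel_measurable_continuous_onI)
      from measurable_compose[OF g1[rule_format, of "of_copy v"] this] show ?thesis
        by (simp add: g'_def case_prod_beta')
    qed
    show "\<exists>\<mu>. integrable (lebesgue_on {0..T}) \<mu> \<and> (\<forall>t\<in>{0..T}. \<mu> t \<ge> 0) \<and>
               (\<forall>t s x y. (t, s) \<in> D \<and> norm x \<le> \<rho> \<and> norm y \<le> \<rho> \<longrightarrow>
                  norm (g' t s x - g' t s y) \<le> \<mu> t * norm (x - y))" if \<rho>: "0 < \<rho>" for \<rho>
    proof -
      obtain \<mu> where \<mu>: "integrable (lebesgue_on {0..T}) \<mu>" "\<forall>t\<in>{0..T}. \<mu> t \<ge> 0"
        "\<And>t s x y. (t, s) \<in> D \<Longrightarrow> norm x \<le> \<rho> \<Longrightarrow> norm y \<le> \<rho> \<Longrightarrow> norm (g t s x - g t s y) \<le> \<mu> t * norm (x - y)"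
        using g2 \<rho> by metis
      have "norm (g' t s x - g' t s y) \<le> \<mu> t * norm (x - y)" if "(t, s) \<in> D" "norm x \<le> \<rho>" "norm y \<le> \<rho>" for t s x y
        using \<mu>(3)[of t s "of_copy x" "of_copy y"] that
        by (simp add: g'_def flip: to_copy_diff of_copy_diff)
      then show ?thesis using \<mu>(1,2) by blast
    qed
    show "integrable (lebesgue_on D) (\<lambda>(t, s). \<sigma> t s)" by (rule g3(1))
    show "0 \<le> \<sigma> t s" if "(t, s) \<in> D" for t s using g3(2) that by blast
    show "norm (g' t s x) \<le> \<sigma> t s * (1 + norm x)" if "(t, s) \<in> D" for t s x
    proof -
      have "norm (g t s (of_copy x)) \<le> \<sigma> t s * (1 + norm (of_copy x))" using g3(3) that by blast
      then show ?thesis by (simp add: g'_def)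
    qed
  qed (use T_pos F3 F4 in auto)
  obtain y y' where y: "abs_continuous_on 0 T y" "y 0 = to_copy x0"
    "AE t in lebesgue. t \<in> {0..T} \<longrightarrow>
        (y has_vector_derivative y' t) (at t within {0..T}) \<and>
        y' t \<in> (\<lambda>f. f + integral\<^sup>L (lebesgue_on {0..t}) (\<lambda>s. g' t s (y s))) ` F' t (y t) \<and>
        norm (y' t) \<le> psi_fun (to_copy x0) c d \<sigma> t"
    "\<forall>t\<in>{0..T}. norm (y t) \<le> r_fun (to_copy x0) c d \<sigma> t"
    using solution_exists by blast
  have r_copy: "r_fun (to_copy x0) c d \<sigma> = r_fun x0 c d \<sigma>" by (rule ext) (simp add: r_fun_def)
  have psi_copy: "psi_fun (to_copy x0) c d \<sigma> = psi_fun x0 c d \<sigma>" by (rule ext) (simp add: psi_fun_def r_copy)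
  \<comment> \<open>Both maps are bounded and linear and inverse to each other, so integrability is
    the same on both sides, and a non-integrable \<open>u\<close> gives 0 on both.\<close>
  have int: "of_copy (integral\<^sup>L M (\<lambda>s. to_copy (u s))) = integral\<^sup>L M u" for M :: "real measure" and u :: "real \<Rightarrow> 'a"
    using integral_bounded_linear'[OF bounded_linear_to_copy bounded_linear_of_copy, of M u] by simp
  show ?thesis
  proof (rule exI[of _ "\<lambda>t. of_copy (y t)"], rule exI[of _ "\<lambda>t. of_copy (y' t)"], intro conjI)
    show "abs_continuous_on 0 T (\<lambda>t. of_copy (y t))"
      using y(1) by (simp add: abs_continuous_on_def flip: of_copy_diff)
    show "of_copy (y 0) = x0" by (simp add: y(2))
    show "\<forall>t\<in>{0..T}. norm (of_copy (y t)) \<le> r_fun x0 c d \<sigma> t" using y(4) by (simp add: r_copy)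
    show "AE t in lebesgue. t \<in> {0..T} \<longrightarrow>
        ((\<lambda>t. of_copy (y t)) has_vector_derivative of_copy (y' t)) (at t within {0..T}) \<and>
        of_copy (y' t) \<in> (\<lambda>f. f + integral\<^sup>L (lebesgue_on {0..t}) (\<lambda>s. g t s (of_copy (y s)))) ` F t (of_copy (y t)) \<and>
        norm (of_copy (y' t)) \<le> psi_fun x0 c d \<sigma> t"
      using y(3)
    proof eventually_elim
      case (elim t)
      show ?case
      proof (intro impI conjI)
        assume "t \<in> {0..T}"
        with elim have t: "(y has_vector_derivative y' t) (at t within {0..T})"
          "y' t \<in> (\<lambda>f. f + integral\<^sup>L (lebesgue_on {0..t}) (\<lambda>s. g' t s (y s))) ` F' t (y t)"
          "norm (y' t) \<le> psi_fun (to_copy x0) c d \<sigma> t" by auto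
        show "((\<lambda>t. of_copy (y t)) has_vector_derivative of_copy (y' t)) (at t within {0..T})"
          by (rule bounded_linear.has_vector_derivative[OF bounded_linear_of_copy t(1)])
        obtain f where "f \<in> F t (of_copy (y t))"
          "y' t = to_copy f + integral\<^sup>L (lebesgue_on {0..t}) (\<lambda>s. g' t s (y s))"
          using t(2) unfolding F'_def by blast
        then show "of_copy (y' t) \<in> (\<lambda>f. f + integral\<^sup>L (lebesgue_on {0..t}) (\<lambda>s. g t s (of_copy (y s)))) ` F t (of_copy (y t))"
          by (simp add: of_copy_add g'_def int)
        show "norm (of_copy (y' t)) \<le> psi_fun x0 c d \<sigma> t" using t(3) by (simp add: psi_copy)
      qed
    qed
  qed
qed

end
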